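(* Let $r,p,n$ be positive integers with $p$ dividing $r$. Then every automorphism of $G(r,p,n)$ is of the form $$(\eta_{r,p,n})^{i_1}\circ(\eta'_{r,p,n})^{i_2}\circ\mathrm{Ad}(g)\circ\alpha_{j,k,z}$$ for some $g\in G(r,1,n)$, $i_1,i_2,j,k\in\mathbb Z$, and $z\in C(r,p,n)$.
   Context: $\mathbb Z_r$ is the additive cyclic group of integers modulo $r$. $S_n$ acts on $(\mathbb Z_r)^n$ by $\pi(x)=(x_{\pi^{-1}(1)},\dots,x_{\pi^{-1}(n)})$. $G(r,1,n)=\mathbb Z_r\wr S_n$ is the set of pairs $(x,\pi)$, $x\in(\mathbb Z_r)^n$, $\pi\in S_n$, with $(x,\pi)(y,\sigma)=(\sigma^{-1}(x)+y,\pi\sigma)$; $(\mathbb Z_r)^n$ and $S_n$ are identified with subgroups in the obvious way. Let $\Delta(x)=x_1+\dots+x_n$ and $\Delta(x,\pi)=\Delta(x)$. For $p$ dividing $r$, $G(r,p,n)=\{g\in\mathbb Z_r\wr S_n:\Delta(g)\in p\mathbb Z_r\}$, a normal subgroup of $G(r,1,n)$. Put $C(r,p,n)=(\mathbb Z_r)^n\cap Z(G(r,p,n))$. Let $e_i$ be the standard basis vectors of $(\mathbb Z_r)^n$ and set $s_i=(0,(i\ i{+}1))$ and $s_i'=(e_i-e_{i+1},(i\ i{+}1))$ for $1\le i\le n-1$, $s=(e_1-e_2,1)$, $t=(e_1,1)$, $c=(e_1+\dots+e_n,1)$. The group $G(r,p,n)$ is generated by $s_1',s_1,\dots,s_{n-1},t^p$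 (also by $s_1,\dots,s_{n-1},s,t^p$), where $s_1'$ and $s$ may be omitted if $p=1$ and $t^p$ may be omitted if $p=r$. For $g\in G(r,1,n)$, $\mathrm{Ad}(g)$ denotes the automorphism $x\mapsto gxg^{-1}$ restricted to $G(r,p,n)$. For $j,k\in\mathbb Z$ and $z\in C(r,1,n)$, $\alpha_{j,k,z}$ is the map $$\alpha_{j,k,z}:(x,\pi)\mapsto z^{\ell(\pi)}c^{\Delta(x)\cdot k}(jx,\pi),$$ where $\ell(\pi)$ is the number of inversions of $\pi$. The automorphisms $\eta_{r,p,n},\eta'_{r,p,n}$ of $G(r,p,n)$ are defined on generators by: - $\eta_{2,1,2}$: $s_1\mapsto t$, $t\mapsto s_1$; - $\eta_{2,2,2}$: $s_1\mapsto s$, $s_1'\mapsto s_1$, $s\mapsto s_1'$; - $\eta_{4,2,2}$: $s_1\mapsto t^2$, $s_1'\mapsto s_1$, $t^2\mapsto s_1'$; - $\eta_{3,3,3}$: $s_1\mapsto s_2$, $s_2\mapsto s_1'$, $s_1'\mapsto s_1$; - $\eta'_{3,3,3}$: $s_1\mapsto s_1$, $s_2\mapsto s_2$, $s_1'\mapsto s_2'$; - $\eta_{2,2,4}$: $s_1\mapsto s_1'$, $s_2\mapsto s_2$, $s_3\mapsto s_1$, $s_1'\mapsto s_3$; - $\eta_{1,1,6}$: $s_1\mapsto(1\,2)(3\,4)(5\,6)$, $s_2\mapsto(1\,5)(2\,3)(4\,6)$, $s_3\mapsto(1\,2)(3\,6)(4\,5)$, $s_4\mapsto(1\,5)(2\,6)(3\,4)$,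 $s_5\mapsto(1\,2)(3\,5)(4\,6)$; and in all other cases $\eta_{r,p,n}=1$ and $\eta'_{r,p,n}=1$ (the identity). *)

theory Defs
  imports
    "HOL-Algebra.Sym_Groups"
    "HOL-Algebra.Product_Groups"
    "HOL-Algebra.Bij"
begin

text \<open>Elements of \<open>(\<int>\<^sub>r)\<^sup>n\<close> are functions on \<open>{1..n}\<close> (\<open>undefined\<close> outside) with values in
  \<open>{0..<r}\<close>. The group is written multiplicatively by the library, so \<open>\<otimes>\<close> is addition of
  vectors and \<open>x [^] j\<close> is the scalar multiple \<open>j x\<close>.\<close>

definition Zvec :: "nat \<Rightarrow> nat \<Rightarrow> (nat \<Rightarrow> int) monoid" where
  "Zvec r n = product_group {1..n} (\<lambda>_. integer_mod_group r)"

definition perm_act :: "nat \<Rightarrow> (nat \<Rightarrow> nat) \<Rightarrow> (nat \<Rightarrow> int) \<Rightarrow> (nat \<Rightarrow> int)" where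
  "perm_act n \<pi> x = (\<lambda>i\<in>{1..n}. x ((inv\<^bsub>sym_group n\<^esub> \<pi>) i))"

definition wreath :: "nat \<Rightarrow> nat \<Rightarrow> ((nat \<Rightarrow> int) \<times> (nat \<Rightarrow> nat)) monoid" where
  "wreath r n =
    \<lparr>carrier = carrier (Zvec r n) \<times> carrier (sym_group n),
     mult = (\<lambda>(x, \<pi>) (y, \<sigma>).
       (perm_act n (inv\<^bsub>sym_group n\<^esub> \<sigma>) x \<otimes>\<^bsub>Zvec r n\<^esub> y, \<pi> \<otimes>\<^bsub>sym_group n\<^esub> \<sigma>)),
     one = (\<one>\<^bsub>Zvec r n\<^esub>, \<one>\<^bsub>sym_group n\<^esub>)\<rparr>"

definition Delta :: "nat \<Rightarrow> nat \<Rightarrow> (nat \<Rightarrow> int) \<Rightarrow> int" where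
  "Delta r n x = (\<Sum>i = 1..n. x i) mod int r"

definition Grpn :: "nat \<Rightarrow> nat \<Rightarrow> nat \<Rightarrow> ((nat \<Rightarrow> int) \<times> (nat \<Rightarrow> nat)) monoid" where
  "Grpn r p n = (wreath r n)
    \<lparr>carrier := {g \<in> carrier (wreath r n).
       Delta r n (fst g) \<in> (\<lambda>a. int p * a mod int r) ` carrier (integer_mod_group r)}\<rparr>"

definition group_center :: "('a, 'b) monoid_scheme \<Rightarrow> 'a set" where
  "group_center G = {z \<in> carrier G. \<forall>g \<in> carrier G. z \<otimes>\<^bsub>G\<^esub> g = g \<otimes>\<^bsub>G\<^esub> z}"

definition Crpn :: "nat \<Rightarrow> nat \<Rightarrow> nat \<Rightarrow> ((nat \<Rightarrow> int) \<times> (nat \<Rightarrow> nat)) set" where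
  "Crpn r p n = (\<lambda>x. (x, id)) ` carrier (Zvec r n) \<inter> group_center (Grpn r p n)"

text \<open>The reduction \<open>1 mod r\<close> matters for \<open>r = 1\<close>, where the only element of \<open>\<int>\<^sub>r\<close> is \<open>0\<close>.\<close>

definition basis_vec :: "nat \<Rightarrow> nat \<Rightarrow> nat \<Rightarrow> (nat \<Rightarrow> int)" where
  "basis_vec r n i = (\<lambda>m\<in>{1..n}. if m = i then 1 mod int r else 0)"

definition root_vec :: "nat \<Rightarrow> nat \<Rightarrow> nat \<Rightarrow> (nat \<Rightarrow> int)" where
  "root_vec r n i =
    basis_vec r n i \<otimes>\<^bsub>Zvec r n\<^esub> inv\<^bsub>Zvec r n\<^esub> (basis_vec r n (i + 1))"

definition gen_s :: "nat \<Rightarrow> nat \<Rightarrow> nat \<Rightarrow> (nat \<Rightarrow> int) \<times> (nat \<Rightarrow> nat)" where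
  "gen_s r n i = (\<one>\<^bsub>Zvec r n\<^esub>, transpose i (i + 1))"

definition gen_s' :: "nat \<Rightarrow> nat \<Rightarrow> nat \<Rightarrow> (nat \<Rightarrow> int) \<times> (nat \<Rightarrow> nat)" where
  "gen_s' r n i = (root_vec r n i, transpose i (i + 1))"

definition elt_s :: "nat \<Rightarrow> nat \<Rightarrow> (nat \<Rightarrow> int) \<times> (nat \<Rightarrow> nat)" where
  "elt_s r n = (root_vec r n 1, id)"

definition elt_t :: "nat \<Rightarrow> nat \<Rightarrow> (nat \<Rightarrow> int) \<times> (nat \<Rightarrow> nat)" where
  "elt_t r n = (basis_vec r n 1, id)"

definition elt_c :: "nat \<Rightarrow> nat \<Rightarrow> (nat \<Rightarrow> int) \<times> (nat \<Rightarrow> nat)" where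
  "elt_c r n = ((\<lambda>i\<in>{1..n}. 1 mod int r), id)"

definition inversions :: "nat \<Rightarrow> (nat \<Rightarrow> nat) \<Rightarrow> nat" where
  "inversions n \<pi> = card {(i, j). 1 \<le> i \<and> i < j \<and> j \<le> n \<and> \<pi> j < \<pi> i}"

definition Ad :: "nat \<Rightarrow> nat \<Rightarrow> nat \<Rightarrow> (nat \<Rightarrow> int) \<times> (nat \<Rightarrow> nat) \<Rightarrow>
    (nat \<Rightarrow> int) \<times> (nat \<Rightarrow> nat) \<Rightarrow> (nat \<Rightarrow> int) \<times> (nat \<Rightarrow> nat)" where
  "Ad r p n g =
    (\<lambda>x\<in>carrier (Grpn r p n). g \<otimes>\<^bsub>wreath r n\<^esub> x \<otimes>\<^bsub>wreath r n\<^esub> inv\<^bsub>wreath r n\<^esub> g)"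

text \<open>The exponent \<open>\<Delta>(x) k\<close> is taken with the representative \<open>0 \<le> \<Delta>(x) < r\<close>; this choice of
  representative is immaterial because \<open>c\<^sup>r = 1\<close>. The map need not be an automorphism for
  arbitrary \<open>j\<close>, \<open>k\<close>, \<open>z\<close>.\<close>

definition alpha :: "nat \<Rightarrow> nat \<Rightarrow> nat \<Rightarrow> int \<Rightarrow> int \<Rightarrow> (nat \<Rightarrow> int) \<times> (nat \<Rightarrow> nat) \<Rightarrow>
    (nat \<Rightarrow> int) \<times> (nat \<Rightarrow> nat) \<Rightarrow> (nat \<Rightarrow> int) \<times> (nat \<Rightarrow> nat)" where
  "alpha r p n j k z =
    (\<lambda>(x, \<pi>)\<in>carrier (Grpn r p n).
       (z [^]\<^bsub>wreath r n\<^esub> inversions n \<pi>)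
       \<otimes>\<^bsub>wreath r n\<^esub> (elt_c r n [^]\<^bsub>wreath r n\<^esub> (Delta r n x * k))
       \<otimes>\<^bsub>wreath r n\<^esub> (x [^]\<^bsub>Zvec r n\<^esub> j, \<pi>))"

text \<open>The automorphism with prescribed values on a list of generators; it is unique if the
  first components generate \<open>G\<close>, since members of \<^const>\<open>auto\<close> are extensional.\<close>

definition aut_of :: "('a, 'b) monoid_scheme \<Rightarrow> ('a \<times> 'a) list \<Rightarrow> 'a \<Rightarrow> 'a" where
  "aut_of G ps = (THE \<phi>. \<phi> \<in> auto G \<and> (\<forall>(a, b) \<in> set ps. \<phi> a = b))"

definition eta :: "nat \<Rightarrow> nat \<Rightarrow> nat \<Rightarrow>
    (nat \<Rightarrow> int) \<times> (nat \<Rightarrow> nat) \<Rightarrow> (nat \<Rightarrow> int) \<times> (nat \<Rightarrow> nat)" where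
  "eta r p n =
    (let G = Grpn r p n; s = gen_s r n; s' = gen_s' r n; t = elt_t r n;
         \<tau> = (\<lambda>a b c d e f.
           (\<one>\<^bsub>Zvec r n\<^esub>, transpose a b \<circ> transpose c d \<circ> transpose e f))
     in
       if (r, p, n) = (2, 1, 2) then aut_of G [(s 1, t), (t, s 1)]
       else if (r, p, n) = (2, 2, 2) then
         aut_of G [(s 1, elt_s r n), (s' 1, s 1), (elt_s r n, s' 1)]
       else if (r, p, n) = (4, 2, 2) then
         aut_of G [(s 1, t [^]\<^bsub>wreath r n\<^esub> (2::nat)), (s' 1, s 1),
                   (t [^]\<^bsub>wreath r n\<^esub> (2::nat), s' 1)]
       else if (r, p, n) = (3, 3, 3) then
         aut_of G [(s 1, s 2), (s 2, s' 1), (s' 1, s 1)]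
       else if (r, p, n) = (2, 2, 4) then
         aut_of G [(s 1, s' 1), (s 2, s 2), (s 3, s 1), (s' 1, s 3)]
       else if (r, p, n) = (1, 1, 6) then
         aut_of G [(s 1, \<tau> 1 2 3 4 5 6), (s 2, \<tau> 1 5 2 3 4 6), (s 3, \<tau> 1 2 3 6 4 5),
                   (s 4, \<tau> 1 5 2 6 3 4), (s 5, \<tau> 1 2 3 5 4 6)]
       else \<one>\<^bsub>AutoGroup G\<^esub>)"

definition eta' :: "nat \<Rightarrow> nat \<Rightarrow> nat \<Rightarrow>
    (nat \<Rightarrow> int) \<times> (nat \<Rightarrow> nat) \<Rightarrow> (nat \<Rightarrow> int) \<times> (nat \<Rightarrow> nat)" where
  "eta' r p n =
    (let G = Grpn r p n; s = gen_s r n; s' = gen_s' r n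
     in
       if (r, p, n) = (3, 3, 3) then
         aut_of G [(s 1, s 1), (s 2, s 2), (s' 1, s' 2)]
       else \<one>\<^bsub>AutoGroup G\<^esub>)"

end

theory Submission
  imports Defs "HOL-Number_Theory.Cong" "HOL-Algebra.Multiplicative_Group" Complex_Main
begin

text \<open>Let \<open>N\<close> be the diagonal subgroup of \<open>G(r,p,n)\<close> and let \<open>\<phi>\<close> be an automorphism.

  If \<open>\<phi>\<close> preserves \<open>N\<close>, it induces an automorphism of \<open>S\<^sub>n\<close>. The image of a transposition is an
  involution any two conjugates of which have a product of order at most \<open>3\<close>; this makes it a
  transposition, and the induced automorphism inner, unless \<open>n = 6\<close>, where the exotic automorphisms
  are incompatible with the action on \<open>N\<close> for \<open>r > 1\<close> and are accounted for by \<open>\<eta>\<close> for \<open>r = 1\<close>. After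
  conjugation, \<open>\<phi>\<close> is given by an \<open>S\<^sub>n\<close>-equivariant endomorphism of \<open>N\<close>, necessarily
  \<open>x \<mapsto> j x + k \<Delta>(x) (1,\<dots>,1)\<close>, and a cocycle on \<open>S\<^sub>n\<close>, necessarily the sum of a coboundary, which
  is removed by a diagonal conjugation, and a multiple \<open>\<ell>(\<pi>) z\<close> of a central involution.

  If \<open>\<phi>\<close> does not preserve \<open>N\<close>, the abelian normal subgroup \<open>\<phi>(N)\<close> contains some \<open>(x, \<sigma>)\<close> with
  \<open>\<sigma> \<noteq> 1\<close>, and its commutators with \<open>v \<in> N\<close> are constant vectors. Hence \<open>v - \<sigma> v\<close> is constant for
  all \<open>v \<in> N\<close>, which leaves only a few triples \<open>(r,p,n)\<close>. For each of them a product of powers of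
  \<open>\<eta>\<close> and \<open>\<eta>'\<close> moves \<open>\<phi>(N)\<close> back to \<open>N\<close>.\<close>

section \<open>Permutations\<close>

text \<open>The maps \<open>eta\<close> and \<open>eta'\<close> are specified by values on
  generators, so \<open>aut_of\<close> says nothing until an automorphism with these values is known
  to exist. No presentation of the groups is used: the prescribed pairs lie in a relation on G x G
  that is closed under products, and such a relation is the graph of an automorphism as soon as it
  relates the identity to nothing but itself. The relations come from an intertwiner of the monomial
  representation, from the multiplication table of the Klein four-group, and from the action on
  synthematic totals. The exponents of \<open>eta\<close> and \<open>eta'\<close> are found by
  looking at the image of one vector: a root \<open>e_a - e_b\<close>, or \<open>p e_1\<close> if
  \<open>p < r\<close>. Outside the diagonal subgroup it has few possible values, and each is
  recognised as the value of some power at a diagonal element. This extends to all of N because the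
  diagonal elements with diagonal image form a subgroup that is stable under permutations. The
  commutator argument leaves one triple too many: (4,4,2) satisfies all its congruences and is
  disposed of by element orders.\<close>

lemma permutes_adjacent_induct [consumes 1, case_names id adj]:
  assumes p: "p permutes {1..n::nat}"
    and id: "P id"
    and adj: "\<And>i p. 1 \<le> i \<Longrightarrow> i < n \<Longrightarrow> p permutes {1..n} \<Longrightarrow> P p \<Longrightarrow> P (p \<circ> transpose i (i + 1))"
  shows "P p"
proof -
  have list: "P (q \<circ> apply_adj_transps xs)"
    if "\<forall>x\<in>set xs. 1 \<le> x \<and> x < n" "P q" "q permutes {1..n}" for xs q
    using that
  proof (induction xs arbitrary: q)
    case (Cons x xs)
    have "P (q \<circ> transpose x (x + 1) \<circ> apply_adj_transps xs)"
      using Cons.prems by (intro Cons.IH adj permutes_compose permutes_swap_id) auto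
    then show ?case
      by (simp only: o_assoc apply_adj_transps_Cons)
  qed simp
  have swap_less: "P (q \<circ> transpose a b)" if "a \<in> {1..n}" "b \<in> {1..n}" "a < b" "P q" "q permutes {1..n}" for a b q
    using list[of "adj_transp_seq a b" q] adj_transp_seq_correct[of a b] set_adj_transp_seq[of a b] that
    by auto
  show ?thesis
    using finite_atLeastAtMost p
  proof (induction rule: permutes_rev_induct)
    case (swap a b q)
    then consider "a < b" | "b < a" by linarith
    then show ?case
    proof cases
      case 2
      then have "P (q \<circ> transpose b a)" using swap_less[of b a q] swap by blast
      then show ?thesis by (simp only: transpose_commute)
    qed (use swap_less[of a b q] swap in blast)
  qed (rule id)
qed

text \<open>Right multiplication by an adjacent transposition toggles the pair
  \<open>(k, k + 1)\<close> and matches up all other inversions, hence changes the parity of their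
  number. This links \<open>alpha\<close>, which counts inversions, with the cocycle computation,
  which sees only the sign.\<close>

lemma evenperm_iff_even_inversions:
  assumes "p permutes {1..n}"
  shows "evenperm p \<longleftrightarrow> even (inversions n p)"
  using assms
proof (induction rule: permutes_adjacent_induct)
  case id
  have "{(i, j). 1 \<le> i \<and> i < j \<and> j \<le> n \<and> id j < id i} = {}" by auto
  then show ?case by (simp only: inversions_def card.empty) (simp add: evenperm_id)
next
  case (adj k q)
  define I where "I q = {(i, j). 1 \<le> i \<and> i < j \<and> j \<le> n \<and> q j < q i}" for q :: "nat \<Rightarrow> nat"
  let ?s = "transpose k (k + 1)"
  have fin: "finite (I q)" for q
    by (rule finite_subset[of _ "{1..n} \<times> {1..n}"]) (auto simp: I_def)
  have qk: "q k \<noteq> q (k + 1)"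
    using inj_eq[OF permutes_inj[OF adj(3)], of k "k + 1"] by simp
  have le: "?s x \<in> {1..n} \<longleftrightarrow> x \<in> {1..n}" for x
    using permutes_in_image[OF permutes_swap_id[of k "{1..n}" "k + 1"], of x] adj(1,2) by simp
  have lt: "?s i < ?s j" if "i < j" "(i, j) \<noteq> (k, k + 1)" for i j
    using that by (auto simp: transpose_def)
  \<comment> \<open>Stated for every \<open>q\<close>, so that its instance at
    \<open>q \<circ> ?s\<close> provides the inverse map as well.\<close>
  have step: "map_prod ?s ?s x \<in> I q - {(k, k + 1)}" if "x \<in> I (q \<circ> ?s) - {(k, k + 1)}" for q x
  proof -
    obtain i j where x: "x = (i, j)" by fastforce
    then have *: "i \<in> {1..n}" "j \<in> {1..n}" "i < j" "q (?s j) < q (?s i)" "(i, j) \<noteq> (k, k + 1)"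
      using that by (auto simp: I_def)
    have "(?s i, ?s j) \<noteq> (k, k + 1)"
      using \<open>i < j\<close> by (auto simp: transpose_def split: if_splits)
    moreover have "?s i \<in> {1..n}" "?s j \<in> {1..n}" "?s i < ?s j"
      using * lt[of i j] le[of i] le[of j] by blast+
    ultimately show ?thesis
      using *(4) unfolding x I_def by simp
  qed
  have "bij_betw (map_prod ?s ?s) (I (q \<circ> ?s) - {(k, k + 1)}) (I q - {(k, k + 1)})"
  proof (rule bij_betw_byWitness[where f' = "map_prod ?s ?s"])
    show "map_prod ?s ?s ` (I (q \<circ> ?s) - {(k, k + 1)}) \<subseteq> I q - {(k, k + 1)}"
      by (intro image_subsetI step)
    show "map_prod ?s ?s ` (I q - {(k, k + 1)}) \<subseteq> I (q \<circ> ?s) - {(k, k + 1)}"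
    proof (intro image_subsetI step)
      fix x assume "x \<in> I q - {(k, k + 1)}"
      then show "x \<in> I (q \<circ> ?s \<circ> ?s) - {(k, k + 1)}"
        by (simp only: comp_assoc transpose_comp_involutory comp_id)
    qed
  qed (simp_all add: map_prod_def split: prod.split)
  then have card: "card (I (q \<circ> ?s) - {(k, k + 1)}) = card (I q - {(k, k + 1)})"
    by (rule bij_betw_same_card)
  have "(k, k + 1) \<in> I (q \<circ> ?s) \<longleftrightarrow> (k, k + 1) \<notin> I q"
    using adj qk by (auto simp: I_def)
  then have "card (I (q \<circ> ?s)) = Suc (card (I q)) \<or> card (I q) = Suc (card (I (q \<circ> ?s)))"
    using card fin by (metis Diff_empty Diff_insert0 card_Suc_Diff1)
  then have "even (inversions n (q \<circ> ?s)) \<longleftrightarrow> odd (inversions n q)"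
    by (auto simp: inversions_def I_def)
  moreover have "evenperm (q \<circ> ?s) \<longleftrightarrow> \<not> evenperm q"
    using adj permutes_imp_permutation[OF _ adj(3)]
    by (subst evenperm_comp) (auto simp: evenperm_swap permutation_swap_id)
  ultimately show ?case
    using adj(4) by (simp only: not_not)
qed

lemma permutes_two_points:
  assumes "a \<in> A" "b \<in> A" "a \<noteq> b" "c \<in> A" "d \<in> A" "c \<noteq> d"
  obtains g where "g permutes A" "g a = c" "g b = d"
proof
  let ?g = "transpose (transpose a c b) d \<circ> transpose a c"
  have "transpose a c b \<in> A"
    using assms by (auto simp: transpose_def)
  then show "?g permutes A"
    using assms by (intro permutes_compose permutes_swap_id)
  show "?g a = c" "?g b = d"
    using assms by (auto simp: transpose_def)
qed

lemma conj_transpose: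
  assumes "bij g"
  shows "g \<circ> transpose a b \<circ> inv' g = transpose (g a) (g b)"
proof
  fix x
  obtain y where y: "x = g y"
    using assms by (meson bij_pointE)
  have "inv' g (g y) = y" "g u = g v \<longleftrightarrow> u = v" for u v
    using assms by (simp_all add: bij_is_inj inj_eq)
  then show "(g \<circ> transpose a b \<circ> inv' g) x = transpose (g a) (g b) x"
    unfolding y by (simp add: transpose_def)
qed

lemma transpose_mult_pow3:
  assumes "x \<noteq> y" "y \<noteq> z" "x \<noteq> z" and \<rho>: "\<rho> = transpose x y \<circ> transpose y z"
  shows "\<rho> \<circ> \<rho> \<circ> \<rho> = id"
proof
  fix w show "(\<rho> \<circ> \<rho> \<circ> \<rho>) w = id w"
    unfolding \<rho> comp_apply id_apply
    using assms(1-3) by (cases "w = x"; cases "w = y"; cases "w = z") simp_all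
qed

text \<open>Two transpositions are equal, disjoint or share one point, and their product has order
  1, 2 or 3 accordingly. The form with compositions can be pushed through an endomorphism of the
  symmetric group.\<close>

lemma transpose_mult_pow:
  assumes "a \<noteq> b" "c \<noteq> d" and \<rho>: "\<rho> = transpose a b \<circ> transpose c d"
  shows "\<rho> = id \<or> \<rho> \<circ> \<rho> = id \<or> \<rho> \<circ> \<rho> \<circ> \<rho> = id"
proof -
  consider "a = c" "b = d" | "a = d" "b = c" | "a \<noteq> c" "a \<noteq> d" "b \<noteq> c" "b \<noteq> d"
    | "a = c" "b \<noteq> d" | "a = d" "b \<noteq> c" | "b = c" "a \<noteq> d" | "b = d" "a \<noteq> c"
    using assms by blast
  then show ?thesis
  proof cases
    case 3
    have "\<rho> \<circ> \<rho> = id"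
    proof
      fix w show "(\<rho> \<circ> \<rho>) w = id w"
        unfolding \<rho> comp_apply id_apply
        using 3 assms(1,2) by (cases "w = a"; cases "w = b"; cases "w = c"; cases "w = d") simp_all
    qed
    then show ?thesis by blast
  next
    case 4
    then show ?thesis
      using transpose_mult_pow3[of b a d \<rho>] assms by (simp only: transpose_commute) blast
  next
    case 5
    then show ?thesis
      using transpose_mult_pow3[of b a c \<rho>] assms by (simp only: transpose_commute) blast
  next
    case 6
    then show ?thesis
      using transpose_mult_pow3[of a b d \<rho>] assms by blast
  next
    case 7
    then show ?thesis
      using transpose_mult_pow3[of a b c \<rho>] assms by (simp only: transpose_commute) blast
  qed (simp_all only: \<rho> transpose_commute transpose_comp_involutory simp_thms)
qed

lemma transposition_eqI:
  assumes "\<tau> permutes A" "\<tau> c \<noteq> c" "\<And>x. x \<noteq> c \<Longrightarrow> x \<noteq> \<tau> c \<Longrightarrow> \<tau> x = x"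
  shows "\<tau> = transpose c (\<tau> c)"
proof
  fix x
  have inj: "\<tau> u = \<tau> v \<longleftrightarrow> u = v" for u v
    using permutes_inj[OF assms(1)] by (rule inj_eq)
  have "\<tau> (\<tau> c) = c"
    using assms(2) assms(3)[of "\<tau> (\<tau> c)"] inj by metis
  then show "\<tau> x = transpose c (\<tau> c) x"
    using assms(3)[of x] by (cases "x = c"; cases "x = \<tau> c") simp_all
qed

text \<open>The point \<open>f\<close> travels along \<open>e\<close>, \<open>c\<close> and
  \<open>\<tau> (\<tau>' c)\<close> under \<open>\<rho>\<close>, and none of these is
  \<open>f\<close>. In the first application \<open>\<rho>\<close> contains a five-cycle, in the
  second a four-cycle.\<close>

lemma five_cycle_order:
  assumes \<rho>: "\<rho> = \<tau> \<circ> \<tau>'"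
    and tau: "\<tau> d = c" "\<tau> h = e"
    and tau': "\<tau>' f = h" "\<tau>' e = d" "\<tau> (\<tau>' c) \<noteq> f"
    and dist: "c \<noteq> f" "e \<noteq> f"
  shows "\<rho> \<noteq> id" "\<rho> \<circ> \<rho> \<noteq> id" "\<rho> \<circ> \<rho> \<circ> \<rho> \<noteq> id"
proof -
  have "\<rho> f = e" "(\<rho> \<circ> \<rho>) f = c" "(\<rho> \<circ> \<rho> \<circ> \<rho>) f = \<tau> (\<tau>' c)"
    unfolding \<rho> comp_apply tau tau' by simp_all
  then show "\<rho> \<noteq> id" "\<rho> \<circ> \<rho> \<noteq> id" "\<rho> \<circ> \<rho> \<circ> \<rho> \<noteq> id"
    using tau' dist by (metis id_apply)+
qed

lemma transpose_comp_triple':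
  assumes "x \<noteq> y" "c \<noteq> y"
  shows "transpose c x \<circ> transpose c y \<circ> transpose c x = transpose x y"
  using transpose_comp_triple[OF assms] by (simp only: transpose_commute)

lemma transpose_commute_fixed:
  assumes "bij f" "f c = c" "f d = d"
  shows "transpose c d \<circ> f = f \<circ> transpose c d"
proof
  fix x
  have "f x = c \<longleftrightarrow> x = c" "f x = d \<longleftrightarrow> x = d"
    using bij_is_inj[OF assms(1)] assms(2,3) by (metis injD)+
  then show "(transpose c d \<circ> f) x = (f \<circ> transpose c d) x"
    using assms(2,3) by (cases "x = c"; cases "x = d") simp_all
qed

section \<open>Injective endomorphisms of a finite symmetric group\<close>

locale sym_endomorphism =
  fixes A :: "'a set" and \<beta> :: "('a \<Rightarrow> 'a) \<Rightarrow> 'a \<Rightarrow> 'a"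
  assumes finite: "finite A"
    and permutes: "p permutes A \<Longrightarrow> \<beta> p permutes A"
    and comp: "p permutes A \<Longrightarrow> q permutes A \<Longrightarrow> \<beta> (p \<circ> q) = \<beta> p \<circ> \<beta> q"
    and inj: "p permutes A \<Longrightarrow> q permutes A \<Longrightarrow> \<beta> p = \<beta> q \<Longrightarrow> p = q"
begin

lemma surj:
  assumes "q permutes A"
  obtains p where "p permutes A" "\<beta> p = q"
proof -
  have "\<beta> ` {p. p permutes A} = {p. p permutes A}"
    using finite_permutations[OF finite] permutes inj
    by (intro endo_inj_surj inj_onI) auto
  then have "q \<in> \<beta> ` {p. p permutes A}"
    using assms by simp
  then show ?thesis
    using that by auto
qed

lemma id: "\<beta> id = id"
proof -
  obtain p where "p permutes A" "\<beta> p = id"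
    using surj[OF permutes_id] by blast
  then show ?thesis
    using comp[of p id] permutes_id[of A] by (metis comp_id id_comp)
qed

lemma inv: "p permutes A \<Longrightarrow> \<beta> (inv' p) = inv' (\<beta> p)"
  using comp[of p "inv' p"] permutes[of p] permutes_inv[of p A] permutes_inv_o(1)[of p A] id
  by (metis inv_unique_comp permutes_inv_o(2) comp)

lemma conj:
  "p permutes A \<Longrightarrow> g permutes A \<Longrightarrow> \<beta> (g \<circ> p \<circ> inv' g) = \<beta> g \<circ> \<beta> p \<circ> inv' (\<beta> g)"
  by (simp only: comp inv permutes_compose permutes_inv)

lemma transposition_conj:
  assumes "a \<in> A" "b \<in> A" "a \<noteq> b" "c \<in> A" "d \<in> A" "c \<noteq> d"
  obtains g where "g permutes A" "\<beta> (transpose c d) = g \<circ> \<beta> (transpose a b) \<circ> inv' g"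
proof -
  obtain h where h: "h permutes A" "h a = c" "h b = d"
    using permutes_two_points[OF assms] .
  have "\<beta> (h \<circ> transpose a b \<circ> inv' h) = \<beta> h \<circ> \<beta> (transpose a b) \<circ> inv' (\<beta> h)"
    using assms h by (intro conj permutes_swap_id)
  moreover have "h \<circ> transpose a b \<circ> inv' h = transpose c d"
    using conj_transpose[OF permutes_bij[OF h(1)], of a b] h by simp
  ultimately show ?thesis
    using that[of "\<beta> h"] h permutes by simp
qed

lemma transposition_involution:
  assumes "a \<in> A" "b \<in> A"
  shows "\<beta> (transpose a b) (\<beta> (transpose a b) x) = x"
  using comp[of "transpose a b" "transpose a b"] permutes_swap_id[OF assms] id
  by (metis comp_apply id_apply transpose_comp_involutory)

text \<open>As \<open>\<beta>\<close> is onto, \<open>g\<close> is itself an image, so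
  \<open>\<rho>\<close> is the image of a product of two transpositions.\<close>

lemma conj_mult_order:
  assumes "a \<in> A" "b \<in> A" "a \<noteq> b" "g permutes A"
    and \<rho>: "\<rho> = \<beta> (transpose a b) \<circ> (g \<circ> \<beta> (transpose a b) \<circ> inv' g)"
  shows "\<rho> = id \<or> \<rho> \<circ> \<rho> = id \<or> \<rho> \<circ> \<rho> \<circ> \<rho> = id"
proof -
  obtain h where h: "h permutes A" "\<beta> h = g"
    using surj assms by blast
  let ?t = "transpose a b"
  have t: "?t permutes A" "h \<circ> ?t \<circ> inv' h permutes A"
    using assms h by (intro permutes_compose permutes_swap_id permutes_inv; simp)+
  have "\<rho> = \<beta> (?t \<circ> (h \<circ> ?t \<circ> inv' h))"
    unfolding \<rho> using conj[OF t(1) h(1)] comp[OF t] h by simp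
  moreover have "h a \<noteq> h b"
    using permutes_inj[OF h(1)] assms(3) by (simp add: inj_eq)
  then have "\<exists>q. q permutes A \<and> \<beta> q = \<rho> \<and> (q = id \<or> q \<circ> q = id \<or> q \<circ> q \<circ> q = id)"
    using transpose_mult_pow[OF assms(3), of "h a" "h b"] conj_transpose[OF permutes_bij[OF h(1)], of a b]
      calculation t permutes_compose[OF t(2,1)] by metis
  ultimately show ?thesis
    using comp id permutes_compose by metis
qed

text \<open>Two transpositions have a product of order at most \<open>3\<close>, hence so do two conjugates of the
  image of a transposition. An involution that is not a transposition violates this, except on
  four or six points without fixed points.\<close>

lemma transposition_image:
  assumes ab: "a \<in> A" "b \<in> A" "a \<noteq> b"
  defines "\<tau> \<equiv> \<beta> (transpose a b)"
  shows "(\<exists>c\<in>A. \<exists>d\<in>A. c \<noteq> d \<and> \<tau> = transpose c d)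
    \<or> (card A = 4 \<or> card A = 6) \<and> (\<forall>x\<in>A. \<tau> x \<noteq> x)"
proof -
  have perm: "\<tau> permutes A"
    unfolding \<tau>_def using ab by (intro permutes permutes_swap_id)
  have inA: "\<tau> x \<in> A \<longleftrightarrow> x \<in> A" for x
    using permutes_in_image[OF perm] .
  have invol: "\<tau> (\<tau> x) = x" for x
    unfolding \<tau>_def using ab by (intro transposition_involution)
  have injt: "\<tau> x = \<tau> y \<longleftrightarrow> x = y" for x y
    using invol by metis
  have outside: "\<tau> x = x" if "x \<notin> A" for x
    using perm that by (rule permutes_not_in)
  have "\<tau> \<noteq> id"
  proof
    assume "\<tau> = id"
    then have "transpose a b = id"
      unfolding \<tau>_def using inj[of "transpose a b" id] id ab by (simp add: permutes_swap_id permutes_id)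
    then show False using ab by (simp add: transpose_eq_id_iff)
  qed
  then obtain c where c: "\<tau> c \<noteq> c"
    by (auto simp: fun_eq_iff)
  define d where "d = \<tau> c"
  have dc: "\<tau> d = c" "\<tau> c = d" "d \<noteq> c" using invol c by (auto simp: d_def)
  have cA: "c \<in> A" "d \<in> A" using c outside inA by (auto simp: d_def)
  have order: "\<rho> = id \<or> \<rho> \<circ> \<rho> = id \<or> \<rho> \<circ> \<rho> \<circ> \<rho> = id"
    if "g permutes A" "\<rho> = \<tau> \<circ> (g \<circ> \<tau> \<circ> inv' g)" for g \<rho>
    using conj_mult_order[OF ab that(1)] that(2) unfolding \<tau>_def by blast
  have inv_g: "(g \<circ> \<tau> \<circ> inv' g) y = z" if "g permutes A" "g u = y" "g (\<tau> u) = z" for g u y z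
    using that permutes_inverses(2)[OF that(1), of u] by auto
  show ?thesis
  proof (cases "\<forall>x. x \<noteq> c \<longrightarrow> x \<noteq> d \<longrightarrow> \<tau> x = x")
    case True
    then show ?thesis
      using transposition_eqI[OF perm c] cA dc unfolding d_def by metis
  next
    case False
    then obtain e where e: "e \<noteq> c" "e \<noteq> d" "\<tau> e \<noteq> e" by blast
    define h where "h = \<tau> e"
    have he: "\<tau> h = e" "\<tau> e = h" "h \<noteq> e" using invol e by (auto simp: h_def)
    have eA: "e \<in> A" "h \<in> A" using e outside inA by (auto simp: h_def)
    have hcd: "h \<noteq> c" "h \<noteq> d" using dc he e by metis+
    show ?thesis
    proof (cases "\<forall>x\<in>A. \<tau> x \<noteq> x")
      case False
      then obtain f where f: "f \<in> A" "\<tau> f = f" by blast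
      have fdist: "f \<noteq> c" "f \<noteq> d" "f \<noteq> e" "f \<noteq> h" using f dc he by metis+
      define g where "g = transpose c d \<circ> transpose d e \<circ> transpose e h \<circ> transpose h f"
      have g: "g permutes A"
        unfolding g_def using cA eA f by (intro permutes_compose permutes_swap_id)
      have gval: "g c = d" "g d = e" "g e = h" "g h = f" "g f = c"
        using fdist hcd e(1,2) dc he unfolding g_def by (auto simp: transpose_def)
      let ?\<tau>' = "g \<circ> \<tau> \<circ> inv' g"
      have tau': "?\<tau>' f = h" "?\<tau>' e = d" "?\<tau>' c = c"
        using inv_g[OF g gval(4), of h] inv_g[OF g gval(2), of d] inv_g[OF g gval(5), of c]
          he dc f gval by simp_all
      have "\<tau> (?\<tau>' c) \<noteq> f"
        using tau'(3) dc fdist by simp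
      from five_cycle_order[OF refl dc(1) he(1) tau'(1,2) this] fdist order[OF g refl]
      show ?thesis by metis
    next
      case fpf: True
      show ?thesis
      proof (cases "A \<subseteq> {c, d, e, h}")
        case True
        then have "A = {c, d, e, h}" using cA eA by blast
        then have "card A = 4" using hcd e(1,2) dc he by simp
        then show ?thesis using fpf by blast
      next
        case False
        then obtain i where i: "i \<in> A" "i \<noteq> c" "i \<noteq> d" "i \<noteq> e" "i \<noteq> h" by blast
        define j where "j = \<tau> i"
        have ij: "\<tau> j = i" "\<tau> i = j" "j \<noteq> i" "j \<in> A" using invol fpf inA i by (auto simp: j_def)
        have jd: "j \<noteq> c" "j \<noteq> d" "j \<noteq> e" "j \<noteq> h" using dc he ij i by metis+
        show ?thesis
        proof (cases "A \<subseteq> {c, d, e, h, i, j}")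
          case True
          then have "A = {c, d, e, h, i, j}" using cA eA i ij by blast
          then have "card A = 6" using hcd e(1,2) dc he i ij jd by simp
          then show ?thesis using fpf by blast
        next
          case False
          then obtain k where k: "k \<in> A" "k \<noteq> c" "k \<noteq> d" "k \<noteq> e" "k \<noteq> h" "k \<noteq> i" "k \<noteq> j" by blast
          define l where "l = \<tau> k"
          have kl: "\<tau> l = k" "\<tau> k = l" "l \<noteq> k" "l \<in> A" using invol fpf inA k by (auto simp: l_def)
          have ld: "l \<noteq> c" "l \<noteq> d" "l \<noteq> e" "l \<noteq> h" "l \<noteq> i" "l \<noteq> j" using dc he ij kl k by metis+
          \<comment> \<open>The cycle through all eight points turns one set of alternate edges of
            an octagon into the other. The product of the two matchings moves each corner by two
            steps, giving cycles of length four.\<close>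
          define g where "g = transpose c d \<circ> transpose d e \<circ> transpose e h \<circ> transpose h i
            \<circ> transpose i j \<circ> transpose j k \<circ> transpose k l"
          have g: "g permutes A"
            unfolding g_def using cA eA i ij k kl by (intro permutes_compose permutes_swap_id)
          have gval: "g c = d" "g d = e" "g e = h" "g h = i" "g i = j" "g j = k" "g k = l" "g l = c"
            using hcd e(1,2) dc he i ij jd k kl ld unfolding g_def by simp_all
          let ?\<tau>' = "g \<circ> \<tau> \<circ> inv' g"
          have tau': "?\<tau>' c = l" "?\<tau>' k = j" "?\<tau>' i = h"
            using inv_g[OF g gval(8), of l] inv_g[OF g gval(6), of j] inv_g[OF g gval(4), of h]
              he dc ij kl gval by simp_all
          have "\<tau> (?\<tau>' i) \<noteq> c"
            using tau'(3) he e(1) by simp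
          from five_cycle_order[OF refl ij(1) kl(1) tau'(1,2) this] i k order[OF g refl]
          show ?thesis by metis
        qed
      qed
    qed
  qed
qed

text \<open>Four points are excluded as well: the fixed point free involutions of a four-element set
  commute with one another, while \<open>(a b)\<close> and \<open>(a c)\<close> do not. Freeness
  from fixed points spreads from one transposition to all by conjugacy.\<close>

lemma transposition_image_cases:
  obtains (transposition)
    "\<And>a b. a \<in> A \<Longrightarrow> b \<in> A \<Longrightarrow> a \<noteq> b \<Longrightarrow> \<exists>c\<in>A. \<exists>d\<in>A. c \<noteq> d \<and> \<beta> (transpose a b) = transpose c d"
  | (fixed_point_free) "card A = 6"
    "\<And>a b x. a \<in> A \<Longrightarrow> b \<in> A \<Longrightarrow> a \<noteq> b \<Longrightarrow> x \<in> A \<Longrightarrow> \<beta> (transpose a b) x \<noteq> x"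
proof (cases "\<forall>a\<in>A. \<forall>b\<in>A. a \<noteq> b \<longrightarrow> (\<exists>c\<in>A. \<exists>d\<in>A. c \<noteq> d \<and> \<beta> (transpose a b) = transpose c d)")
  case True
  then show ?thesis using transposition by blast
next
  case False
  then obtain a b where ab: "a \<in> A" "b \<in> A" "a \<noteq> b"
    and nt: "\<not> (\<exists>c\<in>A. \<exists>d\<in>A. c \<noteq> d \<and> \<beta> (transpose a b) = transpose c d)" by blast
  then have card: "card A = 4 \<or> card A = 6" and fpf: "\<And>x. x \<in> A \<Longrightarrow> \<beta> (transpose a b) x \<noteq> x"
    using transposition_image[OF ab] by blast+
  have fpf': "\<beta> (transpose c d) x \<noteq> x" if cd: "c \<in> A" "d \<in> A" "c \<noteq> d" "x \<in> A" for c d x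
  proof
    assume eq: "\<beta> (transpose c d) x = x"
    obtain g where g: "g permutes A" "\<beta> (transpose c d) = g \<circ> \<beta> (transpose a b) \<circ> inv' g"
      using transposition_conj[OF ab cd(1-3)] .
    have "\<beta> (transpose a b) (inv' g x) = inv' g x"
      using eq unfolding g(2) comp_apply by (metis permutes_inverses(2)[OF g(1)])
    then show False
      using fpf[of "inv' g x"] permutes_in_image[OF permutes_inv[OF g(1)]] cd(4) by simp
  qed
  show ?thesis
  proof (cases "card A = 6")
    case True
    then show ?thesis using fixed_point_free fpf' by blast
  next
    case False
    then have "card (A - {a, b}) \<noteq> 0" using card ab finite by (simp add: card_Diff_subset)
    then obtain c where c: "c \<in> A" "c \<noteq> a" "c \<noteq> b"
      by (metis Diff_iff card.empty equals0I insertI1 insertI2)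
    define s where "s = \<beta> (transpose a b)"
    define t where "t = \<beta> (transpose a c)"
    have sp: "s permutes A" and tp: "t permutes A"
      unfolding s_def t_def using ab c by (auto intro!: permutes permutes_swap_id)
    have s: "s (s x) = x" and t: "t (t x) = x" for x
      unfolding s_def t_def using ab c transposition_involution by auto
    have s': "s x \<noteq> x" "s x \<in> A" and t': "t x \<noteq> x" "t x \<in> A" if "x \<in> A" for x
      using that fpf fpf'[OF ab(1) c(1)] c(2) permutes_in_image[OF sp] permutes_in_image[OF tp]
      by (auto simp: s_def t_def)
    \<comment> \<open>If \<open>t x \<noteq> s x\<close>, both sides avoid \<open>x\<close>,
      \<open>s x\<close> and \<open>t x\<close>, which leaves a single one of the four
      points.\<close>
    have "s (t x) = t (s x)" for x
    proof (cases "x \<in> A")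
      case True
      have "s (t x) = t (s x)" if "t x \<noteq> s x"
      proof -
        have "s (t x) \<noteq> x" using s t that by metis
        moreover have "s (t x) \<noteq> s x" using s t' True by metis
        moreover have "s (t x) \<noteq> t x" using s' t' True by metis
        moreover have "s (t x) \<in> A" using s' t' True by metis
        ultimately have st: "s (t x) \<in> A - {x, s x, t x}" by simp
        have "t (s x) \<noteq> x" using s t that by metis
        moreover have "t (s x) \<noteq> s x" using s' t' True by metis
        moreover have "t (s x) \<noteq> t x" using t s' True by metis
        moreover have "t (s x) \<in> A" using s' t' True by metis
        ultimately have ts: "t (s x) \<in> A - {x, s x, t x}" by simp
        have "x \<noteq> s x" "x \<noteq> t x" "t x \<in> A" "s x \<in> A"
          using s'[OF True] t'[OF True] by simp_all
        then have "card (A - {x, s x, t x}) = 1"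
          using card \<open>card A \<noteq> 6\<close> True that finite by (simp add: card_Diff_subset)
        then obtain y where "A - {x, s x, t x} = {y}"
          by (rule card_1_singletonE)
        then show ?thesis using st ts by simp
      qed
      moreover have "s (t x) = t (s x)" if "t x = s x"
        using s[of x] t[of x] by (simp only: that)
      ultimately show ?thesis by blast
    next
      case False
      then show ?thesis using sp tp by (simp add: permutes_not_in)
    qed
    then have "\<beta> (transpose a b \<circ> transpose a c) = \<beta> (transpose a c \<circ> transpose a b)"
      using ab c by (simp add: comp permutes_swap_id fun_eq_iff s_def t_def)
    then have "transpose a b \<circ> transpose a c = transpose a c \<circ> transpose a b"
      by (rule inj[rotated 2]) (use ab c in \<open>auto intro!: permutes_compose permutes_swap_id\<close>)
    from fun_cong[OF this, of a] show ?thesis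
      using ab c by simp
  qed
qed

text \<open>The images of the \<open>(a i)\<close> are transpositions no two of which commute, so
  any two of them meet in one point. Either all share a point \<open>c\<close>, or three of them
  form a triangle, which injectivity forbids. Then \<open>g i\<close> is the partner of
  \<open>c\<close> in the image of \<open>(a i)\<close>.\<close>

lemma inner:
  assumes transp: "\<And>a b. a \<in> A \<Longrightarrow> b \<in> A \<Longrightarrow> a \<noteq> b \<Longrightarrow> \<exists>c\<in>A. \<exists>d\<in>A. c \<noteq> d \<and> \<beta> (transpose a b) = transpose c d"
  obtains g where "g permutes A" "\<And>p. p permutes A \<Longrightarrow> \<beta> p = g \<circ> p \<circ> inv' g"
proof (cases "A = {}")
  case True
  show ?thesis
    using that[of id] id True by (simp add: permutes_empty)
next
  case False
  then obtain a where a: "a \<in> A" by blast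
  define t where "t i = \<beta> (transpose a i)" for i
  have t: "\<exists>c\<in>A. \<exists>d\<in>A. c \<noteq> d \<and> t i = transpose c d" if "i \<in> A" "i \<noteq> a" for i
    using transp[of a i] a that by (auto simp: t_def)
  have tp: "t i permutes A" if "i \<in> A" for i
    unfolding t_def using a that by (intro permutes permutes_swap_id)
  have move: "t i = transpose c (t i c)" if "i \<in> A" "i \<noteq> a" "t i c \<noteq> c" for i c
  proof -
    from t[OF that(1,2)] obtain x y where "t i = transpose x y" by blast
    then show ?thesis
      using that(3) by (cases "c = x"; cases "c = y") (simp_all add: transpose_commute)
  qed
  have tinj: "t i = t j \<Longrightarrow> i = j" if "i \<in> A" "j \<in> A" for i j
    using inj[of "transpose a i" "transpose a j"] a that
    by (metis permutes_swap_id t_def transpose_apply_first)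
  have triple: "transpose i j = transpose a i \<circ> transpose a j \<circ> transpose a i"
    if "i \<noteq> j" "i \<noteq> a" "j \<noteq> a" for i j
    by (rule transpose_comp_triple'[symmetric]) (use that in auto)
  have beta_triple: "\<beta> (transpose i j) = t i \<circ> t j \<circ> t i"
    if "i \<noteq> j" "i \<noteq> a" "j \<noteq> a" "i \<in> A" "j \<in> A" for i j
    unfolding triple[OF that(1-3)] t_def using a that by (simp add: comp permutes_swap_id permutes_compose)
  have noncomm: "t i \<circ> t j \<noteq> t j \<circ> t i" if "i \<noteq> j" "i \<noteq> a" "j \<noteq> a" "i \<in> A" "j \<in> A" for i j
  proof
    assume "t i \<circ> t j = t j \<circ> t i"
    then have "\<beta> (transpose i j) = t j \<circ> (t i \<circ> t i)"
      using beta_triple[OF that] by (simp only: o_assoc)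
    also have "t i \<circ> t i = id"
      unfolding t_def using transposition_involution[OF a that(4)] by (simp add: fun_eq_iff)
    finally have "\<beta> (transpose i j) = \<beta> (transpose a j)"
      by (simp add: t_def)
    then have "transpose i j = transpose a j"
      by (rule inj[rotated 2]) (use a that in \<open>auto intro!: permutes_swap_id\<close>)
    then show False
      using that by (metis transpose_apply_second transpose_apply_first transpose_apply_other)
  qed
  have "\<exists>c\<in>A. \<forall>i\<in>A - {a}. t i c \<noteq> c"
  proof (cases "\<exists>i j. i \<in> A - {a} \<and> j \<in> A - {a} \<and> i \<noteq> j")
    case False
    show ?thesis
    proof (cases "A - {a} = {}")
      case True
      then show ?thesis using a by blast
    next
      case ne: False
      then obtain i where i: "i \<in> A - {a}" by blast
      then obtain c where "c \<in> A" "t i c \<noteq> c"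
        using t[of i] by (metis Diff_iff singletonI transpose_apply_first)
      then show ?thesis using False i by blast
    qed
  next
    case True
    then obtain i j where ij: "i \<in> A" "i \<noteq> a" "j \<in> A" "j \<noteq> a" "i \<noteq> j" by blast
    obtain c d where cd: "c \<in> A" "d \<in> A" "c \<noteq> d" "t i = transpose c d" using t ij by blast
    have "t j c \<noteq> c \<or> t j d \<noteq> d"
    proof (rule ccontr)
      assume "\<not> ?thesis"
      then have "t i \<circ> t j = t j \<circ> t i"
        unfolding cd(4) by (intro transpose_commute_fixed permutes_bij[OF tp[OF ij(3)]]) simp_all
      then show False using noncomm[of i j] ij by metis
    qed
    then obtain c d where cd: "c \<in> A" "d \<in> A" "c \<noteq> d" "t i = transpose c d" "t j c \<noteq> c"
      using cd by (metis transpose_commute)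
    define e where "e = t j c"
    have e: "e \<noteq> c" "t j = transpose c e" "e \<in> A"
      using cd(5) move[OF ij(3,4)] permutes_in_image[OF tp[OF ij(3)]] cd(1) by (auto simp: e_def)
    have ed: "e \<noteq> d" using tinj[OF ij(1,3)] ij e cd by auto
    have "t k c \<noteq> c" if k: "k \<in> A" "k \<noteq> a" for k
    proof
      assume kc: "t k c = c"
      have ki: "k \<noteq> i" "k \<noteq> j" using kc cd e by auto
      obtain u v where uv: "u \<noteq> v" "t k = transpose u v" using t k by blast
      have uvc: "u \<noteq> c" "v \<noteq> c" using kc uv by auto
      have d: "t k d \<noteq> d"
      proof
        assume "t k d = d"
        then have "t i \<circ> t k = t k \<circ> t i"
          unfolding cd(4) using kc
          by (intro transpose_commute_fixed permutes_bij[OF tp[OF k(1)]])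
        then show False using noncomm[of i k] ij k ki by metis
      qed
      have e': "t k e \<noteq> e"
      proof
        assume "t k e = e"
        then have "t j \<circ> t k = t k \<circ> t j"
          unfolding e(2) using kc
          by (intro transpose_commute_fixed permutes_bij[OF tp[OF k(1)]])
        then show False using noncomm[of j k] ij k ki by metis
      qed
      \<comment> \<open>The triangle \<open>(c d)\<close>, \<open>(c e)\<close>,
        \<open>(d e)\<close>: its third side is the conjugate of the second by the first, that is
        the image of \<open>(i j)\<close>, so \<open>(i j)\<close> would equal
        \<open>(a k)\<close>.\<close>
      have tk: "t k = transpose d e"
        using move[OF k d] e' ed by (metis transpose_apply_other)
      have "\<beta> (transpose i j) = transpose c d \<circ> transpose c e \<circ> transpose c d"
        using beta_triple[of i j] ij cd e by simp
      also have "\<dots> = transpose d e"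
        using cd e ed by (intro transpose_comp_triple') simp_all
      finally have "\<beta> (transpose i j) = \<beta> (transpose a k)"
        using tk by (simp add: t_def)
      then have "transpose i j = transpose a k"
        by (rule inj[rotated 2]) (use a ij k in \<open>auto intro!: permutes_swap_id\<close>)
      then show False
        using ij by (metis transpose_apply_first transpose_apply_other)
    qed
    then show ?thesis using cd by blast
  qed
  then obtain c where c: "c \<in> A" "\<And>i. i \<in> A \<Longrightarrow> i \<noteq> a \<Longrightarrow> t i c \<noteq> c" by blast
  \<comment> \<open>At \<open>i = a\<close> this gives \<open>c\<close>, because \<open>t a\<close>
    is the identity.\<close>
  define g where "g i = (if i \<in> A then t i c else i)" for i
  have ga: "g a = c"
    using a id by (simp add: g_def t_def)
  have tg: "t i = transpose c (g i)" if "i \<in> A" for i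
    using move[OF that] c(2)[OF that] that id by (cases "i = a") (auto simp: g_def t_def)
  have gA: "g i \<in> A" if "i \<in> A" for i
    using permutes_in_image[OF tp[OF that]] c(1) that by (simp add: g_def)
  have gp: "g permutes A"
  proof (rule inj_imp_permutes)
    show "inj_on g A"
      using tg tinj by (intro inj_onI) metis
  qed (use gA finite in \<open>auto simp: g_def\<close>)
  have tgg: "\<beta> (transpose i j) = g \<circ> transpose i j \<circ> inv' g" if ij: "i \<in> A" "j \<in> A" "i \<noteq> j" for i j
  proof -
    have *: "g i \<noteq> g j" using permutes_inj[OF gp] ij(3) by (simp add: inj_eq)
    have "\<beta> (transpose i j) = transpose (g i) (g j)"
    proof (cases "i = a \<or> j = a")
      case True
      then show ?thesis
        using tg ij ga unfolding t_def by (metis transpose_commute)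
    next
      case False
      have "g i \<noteq> c" "g j \<noteq> c"
        using False ij c(2) by (auto simp: g_def)
      then have "transpose c (g i) \<circ> transpose c (g j) \<circ> transpose c (g i) = transpose (g i) (g j)"
        using * by (intro transpose_comp_triple') simp_all
      then show ?thesis
        using beta_triple[of i j] False ij tg by simp
    qed
    then show ?thesis
      using conj_transpose[OF permutes_bij[OF gp]] by simp
  qed
  note beta_id = id
  have "\<beta> p = g \<circ> p \<circ> inv' g" if "p permutes A" for p
    using that finite
  proof (induction rule: permutes_induct)
    case id
    show ?case using beta_id permutes_inv_o(1)[OF gp] by (simp only: comp_id)
  next
    case (swap i j p)
    have "\<beta> (transpose i j \<circ> p) = \<beta> (transpose i j) \<circ> \<beta> p"
      using swap by (intro comp permutes_swap_id)
    also have "\<dots> = g \<circ> transpose i j \<circ> (inv' g \<circ> g) \<circ> p \<circ> inv' g"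
      unfolding tgg[OF swap(1-3)] swap.IH by (simp only: comp_assoc)
    finally show ?case
      unfolding permutes_inv_o(2)[OF gp] by (simp only: comp_assoc id_comp comp_id)
  qed
  then show ?thesis using that gp by blast
qed

end

section \<open>The groups \<open>G(r,p,n)\<close>\<close>

declare One_nat_def [simp del]

text \<open>Vectors are entered as arbitrary integer functions and reduced only here. Equality
  becomes a coordinatewise congruence, and computations need not keep their entries in
  \<open>{0..<r}\<close>.\<close>

definition wr :: "nat \<Rightarrow> nat \<Rightarrow> (nat \<Rightarrow> int) \<Rightarrow> (nat \<Rightarrow> nat) \<Rightarrow> (nat \<Rightarrow> int) \<times> (nat \<Rightarrow> nat)" where
  "wr r n f \<pi> = ((\<lambda>i\<in>{1..n}. f i mod int r), \<pi>)"

lemma snd_wr [simp]: "snd (wr r n f \<pi>) = \<pi>"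
  by (simp add: wr_def)

lemma wr_eq_iff:
  "wr r n f \<pi> = wr r n g \<sigma> \<longleftrightarrow> \<pi> = \<sigma> \<and> (\<forall>i\<in>{1..n}. [f i = g i] (mod int r))"
proof -
  have "restrict u A = restrict v A \<longleftrightarrow> (\<forall>i\<in>A. u i = v i)" for u v :: "nat \<Rightarrow> int" and A
    by (metis restrict_apply restrict_ext)
  then show ?thesis
    by (auto simp: wr_def cong_def)
qed

lemma wr_eqI: "(\<And>i. 1 \<le> i \<Longrightarrow> i \<le> n \<Longrightarrow> [f i = g i] (mod int r)) \<Longrightarrow> wr r n f \<pi> = wr r n g \<pi>"
  by (simp add: wr_eq_iff)

lemma wr_cong: "(\<And>i. 1 \<le> i \<Longrightarrow> i \<le> n \<Longrightarrow> f i = g i) \<Longrightarrow> wr r n f \<pi> = wr r n g \<pi>"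
  by (simp add: wr_eq_iff)

locale wreath_group =
  fixes r n :: nat
  assumes r_pos: "r > 0"
begin

abbreviation W where "W \<equiv> wreath r n"
abbreviation el where "el \<equiv> wr r n"

lemma Zvec_carrier: "x \<in> carrier (Zvec r n) \<longleftrightarrow> x \<in> {1..n} \<rightarrow>\<^sub>E {0..<int r}"
  using r_pos by (simp add: Zvec_def carrier_integer_mod_group)

lemma fst_el_carrier: "fst (el f \<pi>) \<in> carrier (Zvec r n)"
  using r_pos by (auto simp: Zvec_carrier wr_def)

lemma Zvec_el: "x \<in> carrier (Zvec r n) \<Longrightarrow> (x, \<pi>) = el x \<pi>"
  unfolding Zvec_carrier wr_def by (auto simp: PiE_iff extensional_def)

lemma el_carrier_iff [simp]: "el f \<pi> \<in> carrier W \<longleftrightarrow> \<pi> permutes {1..n}"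
  using fst_el_carrier[of f \<pi>] by (auto simp: wreath_def sym_group_carrier wr_def)

lemma el_cases:
  assumes "g \<in> carrier W"
  obtains f \<pi> where "g = el f \<pi>" "\<pi> permutes {1..n}"
  using assms Zvec_el that by (auto simp: wreath_def sym_group_carrier)

lemma Zvec_mult: "x \<otimes>\<^bsub>Zvec r n\<^esub> y = (\<lambda>i\<in>{1..n}. (x i + y i) mod int r)"
  by (simp add: Zvec_def)

lemma el_mult:
  assumes "\<pi> permutes {1..n}" "\<sigma> permutes {1..n}"
  shows "el f \<pi> \<otimes>\<^bsub>W\<^esub> el g \<sigma> = el (\<lambda>i. f (\<sigma> i) + g i) (\<pi> \<circ> \<sigma>)"
proof -
  have "inv\<^bsub>sym_group n\<^esub> (inv\<^bsub>sym_group n\<^esub> \<sigma>) = \<sigma>"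
    using assms(2) by (intro group.inv_inv[OF sym_group_is_group]) (simp add: sym_group_carrier)
  moreover have "\<sigma> i \<in> {1..n} \<longleftrightarrow> i \<in> {1..n}" for i
    using permutes_in_image[OF assms(2)] .
  ultimately show ?thesis
    by (simp add: wreath_def wr_def perm_act_def Zvec_mult sym_group_mult mod_simps cong: restrict_cong)
qed

lemma el_one: "\<one>\<^bsub>W\<^esub> = el (\<lambda>_. 0) id"
  by (auto simp: wreath_def wr_def Zvec_def sym_group_one)

lemma el_left_inv:
  assumes "\<pi> permutes {1..n}"
  shows "el (\<lambda>i. - f (inv' \<pi> i)) (inv' \<pi>) \<otimes>\<^bsub>W\<^esub> el f \<pi> = \<one>\<^bsub>W\<^esub>"
  using assms by (simp add: el_mult permutes_inv permutes_inverses permutes_inv_o el_one)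

sublocale W: group W
proof (rule groupI)
  fix x y z
  assume "x \<in> carrier W" "y \<in> carrier W" "z \<in> carrier W"
  then obtain a b c \<pi> \<sigma> \<tau> where "x = el a \<pi>" "y = el b \<sigma>" "z = el c \<tau>"
    "\<pi> permutes {1..n}" "\<sigma> permutes {1..n}" "\<tau> permutes {1..n}"
    by (metis el_cases)
  then show "x \<otimes>\<^bsub>W\<^esub> y \<otimes>\<^bsub>W\<^esub> z = x \<otimes>\<^bsub>W\<^esub> (y \<otimes>\<^bsub>W\<^esub> z)"
    by (simp add: el_mult permutes_compose add.assoc comp_assoc)
next
  fix x y
  assume "x \<in> carrier W" "y \<in> carrier W"
  then show "x \<otimes>\<^bsub>W\<^esub> y \<in> carrier W"
    by (elim el_cases) (simp add: el_mult permutes_compose)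
next
  fix x
  assume "x \<in> carrier W"
  then obtain f \<pi> where x: "x = el f \<pi>" "\<pi> permutes {1..n}" by (rule el_cases)
  then show "\<one>\<^bsub>W\<^esub> \<otimes>\<^bsub>W\<^esub> x = x"
    by (simp add: el_one el_mult permutes_id)
  show "\<exists>y\<in>carrier W. y \<otimes>\<^bsub>W\<^esub> x = \<one>\<^bsub>W\<^esub>"
    using el_left_inv x permutes_inv by (metis el_carrier_iff)
qed (simp add: el_one permutes_id)

lemma el_inv:
  assumes "\<pi> permutes {1..n}"
  shows "inv\<^bsub>W\<^esub> (el f \<pi>) = el (\<lambda>i. - f (inv' \<pi> i)) (inv' \<pi>)"
  using assms by (intro W.inv_equality el_left_inv) (simp_all add: permutes_inv)

lemma el_mult_diag: "el f id \<otimes>\<^bsub>W\<^esub> el g id = el (\<lambda>i. f i + g i) id"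
  by (simp only: el_mult[OF permutes_id permutes_id] comp_id id_apply)

lemma el_nat_pow: "el f id [^]\<^bsub>W\<^esub> (k :: nat) = el (\<lambda>i. int k * f i) id"
proof (induction k)
  case (Suc k)
  have "el f id [^]\<^bsub>W\<^esub> Suc k = el (\<lambda>i. int k * f i + f i) id"
    by (simp only: Suc W.nat_pow_Suc el_mult_diag)
  also have "\<dots> = el (\<lambda>i. int (Suc k) * f i) id"
    by (intro wr_cong) (simp add: algebra_simps)
  finally show ?case .
qed (simp only: W.nat_pow_0 el_one of_nat_0 mult_zero_left)

lemma el_int_pow: "el f id [^]\<^bsub>W\<^esub> (k :: int) = el (\<lambda>i. k * f i) id"
proof (cases k)
  case (neg m)
  have "el f id [^]\<^bsub>W\<^esub> k = inv\<^bsub>W\<^esub> (el (\<lambda>i. int (Suc m) * f i) id)"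
    unfolding neg using W.int_pow_neg_int[of "el f id" "Suc m"] el_nat_pow[of f "Suc m"]
      permutes_id[of "{1..n}"] by (simp only: el_carrier_iff simp_thms)
  also have "\<dots> = el (\<lambda>i. - (int (Suc m) * f i)) id"
    using el_inv[OF permutes_id] by (simp only: inv_id id_apply)
  finally show ?thesis
    by (simp only: neg minus_mult_left)
qed (simp add: int_pow_int el_nat_pow)

lemma Zvec_group: "group (Zvec r n)"
  unfolding Zvec_def by simp

lemma Zvec_nat_pow: "fst (el f \<pi>) [^]\<^bsub>Zvec r n\<^esub> (k :: nat) = fst (el (\<lambda>i. int k * f i) \<pi>)"
proof (induction k)
  case 0
  then show ?case
    by (simp add: Zvec_def wr_def)
next
  case (Suc k)
  show ?case
    by (simp add: Suc.IH Zvec_mult) (auto simp: wr_def mod_simps algebra_simps intro!: restrict_ext)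
qed

lemma Zvec_int_pow: "fst (el f \<pi>) [^]\<^bsub>Zvec r n\<^esub> (k :: int) = fst (el (\<lambda>i. k * f i) \<pi>)"
proof (cases k)
  case (nonneg m)
  then show ?thesis
    using Zvec_nat_pow by (simp add: int_pow_int)
next
  case (neg m)
  have "inv\<^bsub>Zvec r n\<^esub> fst (el g \<pi>) = fst (el (\<lambda>i. - g i) \<pi>)" for g
  proof (rule group.inv_equality[OF Zvec_group])
    show "fst (el (\<lambda>i. - g i) \<pi>) \<otimes>\<^bsub>Zvec r n\<^esub> fst (el g \<pi>) = \<one>\<^bsub>Zvec r n\<^esub>"
      by (auto simp: Zvec_mult) (auto simp: wr_def Zvec_def mod_simps)
  qed (rule fst_el_carrier)+
  then show ?thesis
    using Zvec_nat_pow[of f \<pi> "Suc m"] neg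
    by (simp add: group.int_pow_neg_int[OF Zvec_group fst_el_carrier] algebra_simps del: of_nat_Suc)
qed

lemma Delta_el: "Delta r n (fst (el f \<pi>)) = (\<Sum>i = 1..n. f i) mod int r"
  by (simp add: Delta_def wr_def mod_sum_eq)

lemma gen_s_el: "gen_s r n i = el (\<lambda>_. 0) (transpose i (i + 1))"
  by (auto simp: gen_s_def wr_def Zvec_def)

lemma root_vec_el:
  "(root_vec r n i, \<pi>) = el (\<lambda>m. (if m = i then 1 else 0) - (if m = i + 1 then 1 else 0)) \<pi>"
proof -
  have *: "basis_vec r n j = fst (el (\<lambda>m. if m = j then 1 else 0) \<pi>)" for j
    by (auto simp: basis_vec_def wr_def)
  have "inv\<^bsub>Zvec r n\<^esub> fst (el g \<pi>) = fst (el g \<pi>) [^]\<^bsub>Zvec r n\<^esub> (- 1 :: int)" for g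
    using group.int_pow_neg[OF Zvec_group fst_el_carrier, of g \<pi> 1]
      group.int_pow_1[OF Zvec_group fst_el_carrier, of g \<pi>] by simp
  then have "root_vec r n i = fst (el (\<lambda>m. (if m = i then 1 else 0) - (if m = i + 1 then 1 else 0)) \<pi>)"
    unfolding root_vec_def * Zvec_int_pow Zvec_mult
    by (auto simp: wr_def mod_simps intro!: restrict_ext)
  then show ?thesis
    by (simp add: wr_def)
qed

lemma elt_t_el: "elt_t r n = el (\<lambda>m. if m = 1 then 1 else 0) id"
  by (auto simp: elt_t_def basis_vec_def wr_def)

lemma elt_c_el: "elt_c r n = el (\<lambda>_. 1) id"
  by (auto simp: elt_c_def wr_def)

end

section \<open>The subgroup G(r,p,n) and explicit formulas for \<open>alpha\<close> and
  \<open>Ad\<close>\<close>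

locale grpn = wreath_group +
  fixes p :: nat
  assumes p_pos: "p > 0" and p_dvd: "p dvd r"
begin

abbreviation G where "G \<equiv> Grpn r p n"

lemma p_dvd_int: "int p dvd int r"
  using p_dvd by simp

text \<open>As \<open>p\<close> divides \<open>r\<close>, divisibility by \<open>p\<close> does not
  depend on the representative; the membership test of \<open>Grpn\<close> becomes a condition on
  the unreduced coordinate sum.\<close>

lemma in_image_iff: "a mod int r \<in> (\<lambda>a. int p * a mod int r) ` carrier (integer_mod_group r) \<longleftrightarrow> int p dvd a"
proof
  assume "a mod int r \<in> (\<lambda>a. int p * a mod int r) ` carrier (integer_mod_group r)"
  then obtain b where "a mod int r = int p * b mod int r" by blast
  then have "int r dvd a - int p * b"
    by (simp add: mod_eq_dvd_iff)
  then have "int p dvd a - int p * b"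
    using p_dvd_int by (rule dvd_trans[rotated])
  then show "int p dvd a"
    by (metis dvd_add_times_triv_right_iff diff_add_cancel dvd_add_left_iff dvd_triv_left)
next
  assume "int p dvd a"
  then obtain b where "a = int p * b" by (rule dvdE)
  then have "a mod int r = int p * (b mod int r) mod int r"
    by (simp add: mod_mult_right_eq)
  then show "a mod int r \<in> (\<lambda>a. int p * a mod int r) ` carrier (integer_mod_group r)"
    using r_pos by (intro image_eqI[of _ _ "b mod int r"]) (simp_all add: carrier_integer_mod_group)
qed

lemma el_G_iff [simp]: "el f \<pi> \<in> carrier G \<longleftrightarrow> \<pi> permutes {1..n} \<and> int p dvd (\<Sum>i = 1..n. f i)"
  by (simp add: Grpn_def Delta_el in_image_iff)

lemma G_subset: "carrier G \<subseteq> carrier W"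
  by (auto simp: Grpn_def)

lemma G_cases:
  assumes "g \<in> carrier G"
  obtains f \<pi> where "g = el f \<pi>" "\<pi> permutes {1..n}" "int p dvd (\<Sum>i = 1..n. f i)"
proof -
  obtain f \<pi> where "g = el f \<pi>" "\<pi> permutes {1..n}"
    using assms G_subset el_cases by blast
  then show ?thesis
    using assms that by simp
qed

lemma sum_perm: "\<pi> permutes {1..n} \<Longrightarrow> (\<Sum>i = 1..n. f (\<pi> i)) = (\<Sum>i = 1..n. f i :: int)"
  using sum.permute[of \<pi> "{1..n}" f] by (simp add: comp_def)

lemma G_mult [simp]: "(\<otimes>\<^bsub>G\<^esub>) = (\<otimes>\<^bsub>W\<^esub>)"
  by (simp add: Grpn_def)

lemma G_one [simp]: "\<one>\<^bsub>G\<^esub> = \<one>\<^bsub>W\<^esub>"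
  by (simp add: Grpn_def)

lemma G_subgroup: "subgroup (carrier G) W"
proof (rule W.subgroupI)
  fix g h assume "g \<in> carrier G" "h \<in> carrier G"
  then show "g \<otimes>\<^bsub>W\<^esub> h \<in> carrier G"
    by (elim G_cases) (simp add: el_mult permutes_compose sum.distrib sum_perm)
next
  fix g assume "g \<in> carrier G"
  then show "inv\<^bsub>W\<^esub> g \<in> carrier G"
    by (elim G_cases) (simp add: el_inv permutes_inv sum_negf sum_perm)
next
  have "el (\<lambda>_. 0) id \<in> carrier G" by (simp add: permutes_id)
  then show "carrier G \<noteq> {}" by blast
qed (rule G_subset)

lemma G_eq: "G = W\<lparr>carrier := carrier G\<rparr>"
  by (simp add: Grpn_def)

sublocale G: group G
  using G_subgroup W.group_axioms subgroup.subgroup_is_group G_eq by metis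

lemma G_inv: "g \<in> carrier G \<Longrightarrow> inv\<^bsub>G\<^esub> g = inv\<^bsub>W\<^esub> g"
  using W.m_inv_consistent[OF G_subgroup] G_eq by metis

lemma G_finite: "finite (carrier G)"
proof -
  have "finite (carrier W)"
    unfolding wreath_def using r_pos finite_permutations[of "{1..n}"]
    by (auto simp: Zvec_def carrier_integer_mod_group sym_group_def intro!: finite_cartesian_product finite_PiE)
  then show ?thesis using G_subset finite_subset by blast
qed

lemma alpha_el:
  assumes "el f \<pi> \<in> carrier G"
  shows "alpha r p n j k (el (\<lambda>_. a) id) (el f \<pi>)
    = el (\<lambda>i. int (inversions n \<pi>) * a + (\<Sum>i = 1..n. f i) * k + j * f i) \<pi>"
proof -
  obtain x where x: "el f \<pi> = (x, \<pi>)" by (simp add: wr_def)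
  have x1: "x = fst (el f \<pi>)" using x by simp
  have xj: "(x [^]\<^bsub>Zvec r n\<^esub> j, \<pi>) = el (\<lambda>i. j * f i) \<pi>"
    unfolding x1 Zvec_int_pow by (simp add: wr_def)
  have D: "Delta r n x = (\<Sum>i = 1..n. f i) mod int r"
    unfolding x1 by (rule Delta_el)
  have "alpha r p n j k (el (\<lambda>_. a) id) (x, \<pi>) =
    el (\<lambda>i. int (inversions n \<pi>) * a + ((\<Sum>i = 1..n. f i) mod int r) * k + j * f i) \<pi>"
    using assms assms[unfolded el_G_iff, THEN conjunct1] x unfolding alpha_def
    by (simp add: xj D elt_c_el el_int_pow el_nat_pow el_mult permutes_id)
  also have "\<dots> = el (\<lambda>i. int (inversions n \<pi>) * a + (\<Sum>i = 1..n. f i) * k + j * f i) \<pi>"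
    by (intro wr_eqI) (auto simp: cong_def mod_simps intro!: mod_add_cong)
  finally show ?thesis using x by simp
qed

lemma Ad_el:
  assumes "el f \<pi> \<in> carrier G" "\<gamma> permutes {1..n}"
  shows "Ad r p n (el v \<gamma>) (el f \<pi>)
    = el (\<lambda>i. v (\<pi> (inv' \<gamma> i)) + f (inv' \<gamma> i) - v (inv' \<gamma> i)) (\<gamma> \<circ> \<pi> \<circ> inv' \<gamma>)"
  using assms by (simp add: Ad_def el_mult el_inv permutes_inv permutes_compose)

text \<open>Constant vectors are invariant under all permutations, hence central; the hypothesis
  puts them into G(r,p,n).\<close>

lemma const_in_Crpn:
  assumes "int p dvd int n * a"
  shows "el (\<lambda>_. a) id \<in> Crpn r p n"
proof -
  have "el (\<lambda>_. a) id \<in> (\<lambda>x. (x, id)) ` carrier (Zvec r n)"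
    using fst_el_carrier[of "\<lambda>_. a" id] by (auto simp: wr_def)
  moreover have "el (\<lambda>_. a) id \<in> group_center G"
    using assms unfolding group_center_def
    by (auto simp: permutes_id el_mult add.commute elim!: G_cases)
  ultimately show ?thesis
    by (simp add: Crpn_def)
qed

end

text \<open>Proof by linear combination: the multipliers are supplied by hand, and an identity of
  integers remains.\<close>

lemma cong_lin2:
  fixes m :: int
  assumes "[a = b] (mod m)" "[c = d] (mod m)" "e - f = x * (a - b) + y * (c - d)"
  shows "[e = f] (mod m)"
  using assms(1,2) unfolding cong_iff_dvd_diff assms(3) by simp

lemma cong_lin3:
  fixes m :: int
  assumes "[a = b] (mod m)" "[c = d] (mod m)" "[g = h] (mod m)"
    "e - f = x * (a - b) + y * (c - d) + z * (g - h)"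
  shows "[e = f] (mod m)"
  using assms(1-3) unfolding cong_iff_dvd_diff assms(4) by simp

abbreviation unit :: "nat \<Rightarrow> nat \<Rightarrow> int" where "unit a \<equiv> \<lambda>i. if i = a then 1 else 0"

lemma unit_transpose: "unit a (transpose a b i) = unit b i"
  by (auto simp: transpose_def)

section \<open>Endomorphisms that induce the identity on the symmetric group\<close>

context wreath_group
begin

lemma el_fst: "g \<in> carrier W \<Longrightarrow> el (fst g) (snd g) = g"
  by (elim el_cases) (auto simp: wr_def)

text \<open>The vector \<open>f\<close> is the sum of all \<open>f b (e_b - e_1)\<close> with
  \<open>b \<ge> 2\<close> and of a multiple of \<open>e_1\<close> by its coordinate sum, which is
  divisible by \<open>q\<close>.\<close>

lemma diag_generated:
  assumes n: "n > 0" and H: "subgroup H W"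
    and root: "\<And>b. 2 \<le> b \<Longrightarrow> b \<le> n \<Longrightarrow> el (\<lambda>i. unit b i - unit 1 i) id \<in> H"
    and t: "el (\<lambda>i. int q * unit 1 i) id \<in> H"
    and f: "int q dvd (\<Sum>i = 1..n. f i)"
  shows "el f id \<in> H"
proof -
  define S where "S m = (\<Sum>i = 2..m. f i)" for m
  have pow: "el (\<lambda>i. k * g i) id \<in> H" if "el g id \<in> H" for k g
    using W.subgroup_int_pow_closed[OF H that, of k] by (simp only: el_int_pow)
  \<comment> \<open>Coordinate 1 carries minus the sum of the entries treated so far, which keeps
    the total at zero.\<close>
  have step: "el (\<lambda>i. if i = 1 then - S m else if i \<le> m then f i else 0) id \<in> H" if "1 \<le> m" "m \<le> n" for m
    using that
  proof (induction m rule: dec_induct)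
    case base
    have "el (\<lambda>i. if i = 1 then - S 1 else if i \<le> 1 then f i else 0) id = el (\<lambda>_. 0) id"
      by (intro wr_cong) (auto simp: S_def)
    then show ?case
      using subgroup.one_closed[OF H] by (simp only: el_one)
  next
    case (step m)
    have "el (\<lambda>i. if i = 1 then - S m else if i \<le> m then f i else 0) id
      \<otimes>\<^bsub>W\<^esub> el (\<lambda>i. f (Suc m) * (unit (Suc m) i - unit 1 i)) id \<in> H"
      using step by (intro subgroup.m_closed[OF H] pow root) (auto simp del: id_apply)
    moreover have "S (Suc m) = S m + f (Suc m)"
      using step by (simp add: S_def)
    ultimately show ?case
      unfolding el_mult_diag using step
      by (elim back_subst[of "\<lambda>x. x \<in> H"], intro wr_cong) (auto simp: le_Suc_eq)
  qed
  obtain c where c: "(\<Sum>i = 1..n. f i) = int q * c"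
    using f by (rule dvdE)
  have "(\<Sum>i = 1..n. f i) = f 1 + S n"
    using n by (simp add: S_def sum.atLeast_Suc_atMost numeral_2_eq_2)
  then have f1: "f 1 = - S n + int q * c"
    using c by simp
  have "el (\<lambda>i. if i = 1 then - S n else if i \<le> n then f i else 0) id
      \<otimes>\<^bsub>W\<^esub> el (\<lambda>i. c * (int q * unit 1 i)) id \<in> H"
    using n by (intro subgroup.m_closed[OF H] pow step t) auto
  then show ?thesis
    unfolding el_mult_diag
    by (elim back_subst[of "\<lambda>x. x \<in> H"], intro wr_cong) (use f1 in auto)
qed

end

text \<open>An endomorphism of \<open>G(r,p,n)\<close> that induces the identity on \<open>S\<^sub>n\<close> is described by its
  restriction \<open>F\<close> to the diagonal subgroup and by a cocycle \<open>w\<close> on \<open>S\<^sub>n\<close>.\<close>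

locale grpn_endo = grpn +
  fixes \<phi>
  assumes hom: "\<phi> \<in> hom G G"
    and snd_phi: "\<And>f \<pi>. el f \<pi> \<in> carrier G \<Longrightarrow> snd (\<phi> (el f \<pi>)) = \<pi>"
begin

definition F where "F f = fst (\<phi> (el f id))"
definition w where "w \<pi> = fst (\<phi> (el (\<lambda>_. 0) \<pi>))"

abbreviation good :: "(nat \<Rightarrow> int) \<Rightarrow> bool" where "good f \<equiv> int p dvd (\<Sum>i = 1..n. f i)"

lemma phi_mult: "g \<in> carrier G \<Longrightarrow> h \<in> carrier G \<Longrightarrow> \<phi> (g \<otimes>\<^bsub>W\<^esub> h) = \<phi> g \<otimes>\<^bsub>W\<^esub> \<phi> h"
  using hom by (simp add: hom_def)

lemma phi_closed: "g \<in> carrier G \<Longrightarrow> \<phi> g \<in> carrier G"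
  using hom by (simp add: hom_def Pi_iff)

lemma phi_fst:
  assumes "el f \<pi> \<in> carrier G"
  shows "\<phi> (el f \<pi>) = el (fst (\<phi> (el f \<pi>))) \<pi>"
proof -
  have "\<phi> (el f \<pi>) \<in> carrier W"
    using phi_closed[OF assms] G_subset by blast
  from el_fst[OF this] show ?thesis
    unfolding snd_phi[OF assms] by (rule sym)
qed

lemma phi_diag: "good f \<Longrightarrow> \<phi> (el f id) = el (F f) id"
  unfolding F_def by (rule phi_fst) (simp add: permutes_id)

lemma phi_perm: "\<pi> permutes {1..n} \<Longrightarrow> \<phi> (el (\<lambda>_. 0) \<pi>) = el (w \<pi>) \<pi>"
  unfolding w_def by (rule phi_fst) simp

lemma good_F:
  assumes "good f"
  shows "good (F f)"
proof -
  have "\<phi> (el f id) \<in> carrier G"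
    using assms by (intro phi_closed) (simp add: permutes_id)
  then show ?thesis
    by (simp add: phi_diag[OF assms])
qed

lemma good_w:
  assumes "\<pi> permutes {1..n}"
  shows "good (w \<pi>)"
proof -
  have "\<phi> (el (\<lambda>_. 0) \<pi>) \<in> carrier G"
    using assms by (intro phi_closed) simp
  then show ?thesis
    by (simp add: phi_perm[OF assms])
qed

lemma F_cong: "(\<And>i. 1 \<le> i \<Longrightarrow> i \<le> n \<Longrightarrow> [f i = g i] (mod int r)) \<Longrightarrow> F f = F g"
  unfolding F_def using wr_eqI[of n f g r id] by simp

lemma phi_eq:
  assumes "el f \<pi> \<in> carrier G"
  shows "\<phi> (el f \<pi>) = el (\<lambda>i. w \<pi> i + F f i) \<pi>"
proof -
  have \<pi>: "\<pi> permutes {1..n}" and f: "good f"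
    using assms by simp_all
  have "el f \<pi> = el (\<lambda>_. 0) \<pi> \<otimes>\<^bsub>W\<^esub> el f id"
    using el_mult[OF \<pi> permutes_id] by (simp only: comp_id id_apply add_0)
  then have "\<phi> (el f \<pi>) = el (w \<pi>) \<pi> \<otimes>\<^bsub>W\<^esub> el (F f) id"
    using phi_mult[of "el (\<lambda>_. 0) \<pi>" "el f id"] \<pi> f phi_perm phi_diag permutes_id[of "{1..n}"]
    by (simp del: id_apply)
  then show ?thesis
    using el_mult[OF \<pi> permutes_id] by (simp only: comp_id id_apply)
qed

lemma F_add:
  assumes "good f" "good g" "1 \<le> i" "i \<le> n"
  shows "[F (\<lambda>i. f i + g i) i = F f i + F g i] (mod int r)"
proof -
  have fg: "good (\<lambda>i. f i + g i)"
    using assms by (simp add: sum.distrib)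
  have "\<phi> (el f id \<otimes>\<^bsub>W\<^esub> el g id) = \<phi> (el f id) \<otimes>\<^bsub>W\<^esub> \<phi> (el g id)"
    using assms by (intro phi_mult) (simp_all add: permutes_id)
  then have "el (F (\<lambda>i. f i + g i)) id = el (\<lambda>i. F f i + F g i) id"
    unfolding phi_diag[OF assms(1)] phi_diag[OF assms(2)] el_mult_diag phi_diag[OF fg] .
  then show ?thesis
    using assms(3,4) by (simp add: wr_eq_iff)
qed

lemma F_minus:
  assumes "good f" "1 \<le> i" "i \<le> n"
  shows "[F (\<lambda>i. - f i) i = - F f i] (mod int r)"
proof -
  have "good (\<lambda>i. - f i)"
    using assms by (simp add: sum_negf)
  then have 1: "[F (\<lambda>_. 0) i = F f i + F (\<lambda>i. - f i) i] (mod int r)"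
    using F_add[of f "\<lambda>i. - f i" i] assms by simp
  have 2: "[F (\<lambda>_. 0) i = F (\<lambda>_. 0) i + F (\<lambda>_. 0) i] (mod int r)"
    using F_add[of "\<lambda>_. 0" "\<lambda>_. 0" i] assms by (simp only: add_0_right sum.neutral_const dvd_0_right)
  show ?thesis
    by (rule cong_lin2[OF 1 2, of _ _ "-1" "-1"]) simp
qed

lemma F_diff:
  assumes "good f" "good g" "1 \<le> i" "i \<le> n"
  shows "[F (\<lambda>i. f i - g i) i = F f i - F g i] (mod int r)"
proof -
  have "good (\<lambda>i. - g i)"
    using assms by (simp add: sum_negf)
  then have "[F (\<lambda>i. f i - g i) i = F f i + F (\<lambda>i. - g i) i] (mod int r)"
    using F_add[of f "\<lambda>i. - g i" i] assms by simp
  from cong_lin2[OF this F_minus[OF assms(2-4)], of _ _ 1 1] show ?thesis by simp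
qed

lemma F_zero: "1 \<le> i \<Longrightarrow> i \<le> n \<Longrightarrow> [F (\<lambda>_. 0) i = 0] (mod int r)"
  using F_diff[of "\<lambda>_. 0" "\<lambda>_. 0" i] by simp

lemma F_nat_mult:
  assumes "good f" "1 \<le> i" "i \<le> n"
  shows "[F (\<lambda>i. int k * f i) i = int k * F f i] (mod int r)"
proof (induction k)
  case 0
  then show ?case using F_zero assms by simp
next
  case (Suc k)
  have "good (\<lambda>i. int k * f i)"
    using assms by (simp flip: sum_distrib_left)
  then have "[F (\<lambda>i. int k * f i + f i) i = F (\<lambda>i. int k * f i) i + F f i] (mod int r)"
    using assms by (intro F_add)
  from cong_lin2[OF this Suc.IH, of _ _ 1 1] show ?case
    by (simp add: algebra_simps)
qed

text \<open>The cocycle value \<open>w \<pi>\<close> occurs on both sides and cancels, since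
  diagonal elements commute.\<close>

lemma F_equivariant:
  assumes "good f" "\<pi> permutes {1..n}" "1 \<le> i" "i \<le> n"
  shows "[F (\<lambda>i. f (\<pi> i)) i = F f (\<pi> i)] (mod int r)"
proof -
  let ?\<pi> = "el (\<lambda>_. 0) \<pi>"
  have fp: "good (\<lambda>i. f (\<pi> i))"
    using assms by (simp add: sum_perm)
  have "el f id \<otimes>\<^bsub>W\<^esub> ?\<pi> = ?\<pi> \<otimes>\<^bsub>W\<^esub> el (\<lambda>i. f (\<pi> i)) id"
    using el_mult[OF permutes_id assms(2)] el_mult[OF assms(2) permutes_id]
    by (simp only: comp_id id_comp id_apply add_0 add_0_right)
  then have "el (F f) id \<otimes>\<^bsub>W\<^esub> el (w \<pi>) \<pi> = el (w \<pi>) \<pi> \<otimes>\<^bsub>W\<^esub> el (F (\<lambda>i. f (\<pi> i))) id"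
    using phi_mult[of "el f id" ?\<pi>] phi_mult[of ?\<pi> "el (\<lambda>i. f (\<pi> i)) id"]
      assms fp permutes_id[of "{1..n}"] phi_diag phi_perm
    by (simp del: id_apply)
  then have "[F f (\<pi> i) + w \<pi> i = w \<pi> i + F (\<lambda>i. f (\<pi> i)) i] (mod int r)"
    using el_mult[OF permutes_id assms(2)] el_mult[OF assms(2) permutes_id] assms(3,4)
    by (simp only: comp_id id_comp id_apply wr_eq_iff) simp
  from cong_lin2[OF this cong_refl, of _ _ "-1" 0] show ?thesis by simp
qed

lemma w_mult:
  assumes "\<pi> permutes {1..n}" "\<sigma> permutes {1..n}" "1 \<le> i" "i \<le> n"
  shows "[w (\<pi> \<circ> \<sigma>) i = w \<pi> (\<sigma> i) + w \<sigma> i] (mod int r)"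
proof -
  have "el (\<lambda>_. 0) \<pi> \<otimes>\<^bsub>W\<^esub> el (\<lambda>_. 0) \<sigma> = el (\<lambda>_. 0) (\<pi> \<circ> \<sigma>)"
    using el_mult[OF assms(1,2)] by simp
  then have "el (w (\<pi> \<circ> \<sigma>)) (\<pi> \<circ> \<sigma>) = el (w \<pi>) \<pi> \<otimes>\<^bsub>W\<^esub> el (w \<sigma>) \<sigma>"
    using phi_mult[of "el (\<lambda>_. 0) \<pi>" "el (\<lambda>_. 0) \<sigma>"] assms phi_perm permutes_compose[OF assms(2,1)]
    by simp
  then show ?thesis
    using assms(3,4) by (simp only: el_mult[OF assms(1,2)] wr_eq_iff) simp
qed

lemma w_id: "1 \<le> i \<Longrightarrow> i \<le> n \<Longrightarrow> [w id i = 0] (mod int r)"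
  using w_mult[OF permutes_id permutes_id, of i] cong_lin2[OF _ cong_refl, of "w id i" "w id i + w id i" _ "w id i" 0 "-1" 0]
  by simp

lemma good_unit_diff:
  assumes "a \<in> {1..n}" "b \<in> {1..n}"
  shows "good (\<lambda>i. unit a i - unit b i)"
  using assms by (simp add: sum_subtractf)

text \<open>Double transitivity gives the image of \<open>e_a - e_b\<close> the same entry
  \<open>j\<close> at \<open>a\<close> for all pairs, and a change of sign gives \<open>-j\<close>
  at \<open>b\<close>. At a third point \<open>i\<close>, the splitting
  \<open>(e_a - e_i) + (e_i - e_b)\<close> yields \<open>-j + j\<close>.\<close>

lemma F_root:
  "\<exists>j. \<forall>a\<in>{1..n}. \<forall>b\<in>{1..n}. \<forall>i\<in>{1..n}. a \<noteq> b \<longrightarrow>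
    [F (\<lambda>i. unit a i - unit b i) i = j * (unit a i - unit b i)] (mod int r)"
proof -
  let ?u = "\<lambda>a b i. unit a i - unit b i"
  define j where "j = F (?u 1 2) 1"
  have diag: "[F (?u a b) a = j] (mod int r)" if ab: "a \<in> {1..n}" "b \<in> {1..n}" "a \<noteq> b" for a b
  proof -
    have n2: "2 \<le> n" using ab by auto
    obtain \<pi> where \<pi>: "\<pi> permutes {1..n}" "\<pi> a = 1" "\<pi> b = 2"
      using permutes_two_points[OF ab, of 1 2] n2 by auto
    have inj: "\<pi> x = \<pi> y \<longleftrightarrow> x = y" for x y
      using permutes_inj[OF \<pi>(1)] by (rule inj_eq)
    have "?u a b = (\<lambda>i. ?u 1 2 (\<pi> i))"
      using inj[of _ a] inj[of _ b] \<pi>(2,3) by (intro ext) simp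
    then show ?thesis
      using F_equivariant[OF good_unit_diff[of 1 2] \<pi>(1), of a] \<pi>(2) ab n2 by (simp add: j_def)
  qed
  have off: "[F (?u a b) b = - j] (mod int r)" if ab: "a \<in> {1..n}" "b \<in> {1..n}" "a \<noteq> b" for a b
  proof -
    have 1: "[F (?u b a) b = - F (?u a b) b] (mod int r)"
      using F_minus[OF good_unit_diff[OF ab(1,2)], of b] ab by simp
    show ?thesis
      by (rule cong_lin2[OF 1 diag[of b a], of _ _ 1 "-1"]) (use ab in auto)
  qed
  have "[F (?u a b) i = j * ?u a b i] (mod int r)"
    if ab: "a \<in> {1..n}" "b \<in> {1..n}" "a \<noteq> b" "i \<in> {1..n}" for a b i
  proof -
    consider "i = a" | "i = b" | "i \<noteq> a" "i \<noteq> b" by blast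
    then show ?thesis
    proof cases
      case 3
      have "?u a b = (\<lambda>k. ?u a i k + ?u i b k)"
        by (intro ext) simp
      then have "[F (?u a b) i = F (?u a i) i + F (?u i b) i] (mod int r)"
        using F_add[OF good_unit_diff[of a i] good_unit_diff[of i b], of i] ab by simp
      from cong_lin3[OF this off[of a i] diag[of i b], of _ _ 1 1 1] show ?thesis
        using ab 3 by simp
    qed (use diag[of a b] off[of a b] ab in simp_all)
  qed
  then show ?thesis by (intro exI[of _ j]) simp
qed

text \<open>The diagonal subgroup is generated by the \<open>e_b - e_1\<close> and by
  \<open>p e_1\<close>. The former determine \<open>j\<close>; the image of the latter is constant
  away from coordinate 1, and this constant, a multiple of \<open>p\<close>, determines
  \<open>k\<close>.\<close>

lemma F_scalar:
  assumes n: "n > 0"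
  shows "\<exists>j k. \<forall>f. good f \<longrightarrow> (\<forall>i\<in>{1..n}. [F f i = j * f i + (\<Sum>i = 1..n. f i) * k] (mod int r))"
proof -
  have gt: "good (\<lambda>i. int p * unit a i)" if "a \<in> {1..n}" for a
    by (simp flip: sum_distrib_left)
  have "\<exists>j k. (\<forall>b i. 2 \<le> b \<longrightarrow> b \<le> n \<longrightarrow> i \<in> {1..n} \<longrightarrow>
      [F (\<lambda>i. unit b i - unit 1 i) i = j * (unit b i - unit 1 i)] (mod int r)) \<and>
    (\<forall>i\<in>{1..n}. [F (\<lambda>i. int p * unit 1 i) i = j * (int p * unit 1 i) + int p * k] (mod int r))"
  proof (cases "n = 1")
    case True
    obtain j where "F (\<lambda>i. int p * unit 1 i) 1 = int p * j"
      using good_F[OF gt[of 1]] True by auto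
    \<comment> \<open>With one coordinate only \<open>j + k\<close> matters, so \<open>k = 0\<close>
      is a valid choice.\<close>
    then show ?thesis
      using True by (intro exI[of _ j] exI[of _ 0]) auto
  next
    case False
    then have n2: "2 \<le> n" using n by simp
    obtain j where j: "\<And>a b i. a \<in> {1..n} \<Longrightarrow> b \<in> {1..n} \<Longrightarrow> a \<noteq> b \<Longrightarrow> i \<in> {1..n} \<Longrightarrow>
      [F (\<lambda>i. unit a i - unit b i) i = j * (unit a i - unit b i)] (mod int r)"
      using F_root by blast
    let ?t = "\<lambda>i. int p * unit 1 i"
    define d where "d = F ?t 2"
    have const: "[F ?t i = d] (mod int r)" if "2 \<le> i" "i \<le> n" for i
    proof -
      have "(\<lambda>k. ?t (transpose 2 i k)) = ?t"
        using that by (intro ext) (auto simp: transpose_def)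
      then show ?thesis
        using F_equivariant[OF gt permutes_swap_id[of 2 _ i], of 1 2] that n by (simp add: d_def cong_sym)
    qed
    obtain q where q: "r = p * q" using p_dvd by (rule dvdE)
    \<comment> \<open>\<open>q\<close> times \<open>p e_1\<close> is zero, so \<open>q d\<close>
      vanishes modulo \<open>r = p q\<close>, and \<open>p\<close> divides \<open>d\<close>.\<close>
    have "[int q * d = F (\<lambda>i. int q * ?t i) 2] (mod int r)"
      using F_nat_mult[OF gt[of 1], of 2 q] n2 by (simp add: d_def cong_sym)
    moreover have "F (\<lambda>i. int q * ?t i) = F (\<lambda>_. 0)"
      by (rule F_cong) (simp add: q cong_def)
    ultimately have "[int q * d = 0] (mod int r)"
      using F_zero[of 2] n2 cong_trans by fastforce
    then have "int q * int p dvd int q * d"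
      by (simp add: cong_0_iff q mult.commute)
    then have "int p dvd d"
      using r_pos q by simp
    then obtain k where k: "d = int p * k" by (rule dvdE)
    \<comment> \<open>Coordinate 1 comes from \<open>p (e_1 - e_2) = p e_1 - p e_2\<close>, where
      the image of the left side is known through \<open>j\<close>.\<close>
    have "[F ?t 1 = int p * j + int p * k] (mod int r)"
    proof -
      have "(\<lambda>k. ?t (transpose 1 2 k)) = (\<lambda>i. int p * unit 2 i)"
        by (intro ext) (auto simp: transpose_def)
      then have 1: "[F (\<lambda>i. int p * unit 2 i) 1 = d] (mod int r)"
        using F_equivariant[OF gt[of 1] permutes_swap_id[of 1 _ 2], of 1] n2 by (simp add: d_def)
      have "(\<lambda>i. int p * (unit 1 i - unit 2 i)) = (\<lambda>i. int p * unit 1 i - int p * unit 2 i)"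
        by (simp only: right_diff_distrib)
      then have "[F (\<lambda>i. int p * (unit 1 i - unit 2 i)) 1 = F ?t 1 - F (\<lambda>i. int p * unit 2 i) 1] (mod int r)"
        using F_diff[OF gt[of 1] gt[of 2], of 1] n2 by simp
      from cong_trans[OF cong_sym[OF F_nat_mult[OF good_unit_diff[of 1 2], of 1 p]] this]
      have 2: "[int p * F (\<lambda>i. unit 1 i - unit 2 i) 1 = F ?t 1 - F (\<lambda>i. int p * unit 2 i) 1] (mod int r)"
        using n2 by simp
      show ?thesis
        by (rule cong_lin3[OF 1 2 j[of 1 2 1], of _ _ 1 "-1" "int p"])
          (use n2 k in \<open>auto simp: algebra_simps\<close>)
    qed
    moreover have "[F ?t i = int p * k] (mod int r)" if "2 \<le> i" "i \<le> n" for i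
      using const[OF that] k by simp
    ultimately have "[F ?t i = j * (int p * unit 1 i) + int p * k] (mod int r)" if "i \<in> {1..n}" for i
      using that by (cases "i = 1") (auto simp: mult.commute)
    then show ?thesis
      using j by (intro exI[of _ j] exI[of _ k]) auto
  qed
  then obtain j k where
    jk1: "\<And>b i. 2 \<le> b \<Longrightarrow> b \<le> n \<Longrightarrow> i \<in> {1..n} \<Longrightarrow>
      [F (\<lambda>i. unit b i - unit 1 i) i = j * (unit b i - unit 1 i)] (mod int r)"
    and jk2: "\<And>i. i \<in> {1..n} \<Longrightarrow> [F (\<lambda>i. int p * unit 1 i) i = j * (int p * unit 1 i) + int p * k] (mod int r)"
    by blast
  \<comment> \<open>The vectors obeying the formula form a subgroup that contains the generators.
    Different integer functions may name the same element, so the formula is transferred back to a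
    given \<open>f\<close> at the end.\<close>
  define Q where "Q f \<longleftrightarrow> good f \<and> (\<forall>i\<in>{1..n}. [F f i = j * f i + (\<Sum>i = 1..n. f i) * k] (mod int r))" for f
  define H where "H = {el f id | f. Q f}"
  have HQ: "\<exists>f. x = el f id \<and> Q f" if "x \<in> H" for x
    using that by (auto simp: H_def)
  have QH: "el f id \<in> H" if "Q f" for f
    using that by (auto simp: H_def)
  have Q_add: "Q (\<lambda>i. f i + g i)" if "Q f" "Q g" for f g
    unfolding Q_def
  proof (intro conjI ballI)
    fix i assume i: "i \<in> {1..n}"
    show "[F (\<lambda>i. f i + g i) i = j * (f i + g i) + (\<Sum>i = 1..n. f i + g i) * k] (mod int r)"
      by (rule cong_lin3[OF F_add[of f g i] bspec[OF conjunct2[OF that(1)[unfolded Q_def]] i]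
            bspec[OF conjunct2[OF that(2)[unfolded Q_def]] i], of _ _ 1 1 1])
        (use that i in \<open>auto simp: Q_def sum.distrib algebra_simps\<close>)
  qed (use that in \<open>auto simp: Q_def sum.distrib\<close>)
  have Q_minus: "Q (\<lambda>i. - f i)" if "Q f" for f
    unfolding Q_def
  proof (intro conjI ballI)
    fix i assume i: "i \<in> {1..n}"
    show "[F (\<lambda>i. - f i) i = j * - f i + (\<Sum>i = 1..n. - f i) * k] (mod int r)"
      by (rule cong_lin2[OF F_minus[of f i] bspec[OF conjunct2[OF that(1)[unfolded Q_def]] i], of _ _ 1 "-1"])
        (use that i in \<open>auto simp: Q_def sum_negf algebra_simps\<close>)
  qed (use that in \<open>auto simp: Q_def sum_negf\<close>)
  have "subgroup H W"
  proof (rule W.subgroupI)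
    show "H \<subseteq> carrier W" by (auto simp: H_def permutes_id)
    have "Q (\<lambda>_. 0)" using F_zero by (simp add: Q_def)
    then show "H \<noteq> {}" using QH by blast
    show "inv\<^bsub>W\<^esub> x \<in> H" if "x \<in> H" for x
    proof -
      from HQ[OF that] obtain f where f: "x = el f id" "Q f" by blast
      have "inv\<^bsub>W\<^esub> x = el (\<lambda>i. - f i) id"
        unfolding f(1) el_inv[OF permutes_id] by (simp only: inv_id id_apply)
      then show ?thesis using QH[OF Q_minus[OF f(2)]] by simp
    qed
    show "x \<otimes>\<^bsub>W\<^esub> y \<in> H" if "x \<in> H" "y \<in> H" for x y
    proof -
      from HQ[OF that(1)] HQ[OF that(2)] obtain f g where fg: "x = el f id" "Q f" "y = el g id" "Q g"
        by blast
      then show ?thesis using QH[OF Q_add[OF fg(2,4)]] by (simp only: el_mult_diag)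
    qed
  qed
  then have mem: "el f id \<in> H" if "good f" for f
  proof (rule diag_generated[OF n _ _ _ that])
    show "el (\<lambda>i. unit b i - unit 1 i) id \<in> H" if "2 \<le> b" "b \<le> n" for b
      using that n jk1 good_unit_diff[of b 1] by (intro QH) (simp add: Q_def sum_subtractf)
    show "el (\<lambda>i. int p * unit 1 i) id \<in> H"
      using jk2 gt[of 1] n by (intro QH) (simp add: Q_def flip: sum_distrib_left)
  qed
  have "[F f i = j * f i + (\<Sum>i = 1..n. f i) * k] (mod int r)" if "good f" "i \<in> {1..n}" for f i
  proof -
    from HQ[OF mem[OF that(1)]] obtain g where g: "el f id = el g id" "Q g" by blast
    have fg: "[f i = g i] (mod int r)" if "i \<in> {1..n}" for i
      using g(1) that by (simp add: wr_eq_iff)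
    have 1: "[F f i = j * g i + (\<Sum>i = 1..n. g i) * k] (mod int r)"
      using g that by (simp add: Q_def F_def)
    have 2: "[(\<Sum>i = 1..n. f i) = (\<Sum>i = 1..n. g i)] (mod int r)"
      using fg by (intro cong_sum)
    show ?thesis
      by (rule cong_lin3[OF 1 2 fg[OF that(2)], of _ _ 1 "-k" "-j"]) (simp add: algebra_simps)
  qed
  then show ?thesis by (intro exI[of _ j] exI[of _ k]) simp
qed

text \<open>On each adjacent transposition the cocycle has one and the same value \<open>z\<close>
  off the two moved points, and \<open>2 z = 0\<close> because transpositions are involutions. The
  values at moved points are absorbed by a potential \<open>v\<close>; what remains is one
  \<open>z\<close> per adjacent factor, which depends only on the sign.\<close>

lemma w_coboundary:
  assumes n: "n > 0"
  shows "\<exists>v z. [2 * z = 0] (mod int r) \<and> int p dvd int n * z \<and> (\<forall>\<pi> i. \<pi> permutes {1..n} \<longrightarrow> i \<in> {1..n} \<longrightarrow>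
    [w \<pi> i = v (\<pi> i) - v i + (if evenperm \<pi> then 0 else z)] (mod int r))"
proof -
  define h where "h a b = w (transpose a b)" for a b
  have h_comm: "h a b = h b a" for a b
    by (simp add: h_def transpose_commute)
  have h_invol: "[h a b (transpose a b i) + h a b i = 0] (mod int r)"
    if "a \<in> {1..n}" "b \<in> {1..n}" "i \<in> {1..n}" for a b i
  proof -
    have 1: "[w id i = w (transpose a b) (transpose a b i) + w (transpose a b) i] (mod int r)"
      using w_mult[OF permutes_swap_id permutes_swap_id, OF that(1,2,1,2), of i] that(3)
      by (simp only: transpose_comp_involutory) simp
    show ?thesis
      by (rule cong_lin2[OF 1 w_id[of i], of _ _ "-1" 1]) (use that in \<open>auto simp: h_def\<close>)
  qed
  \<comment> \<open>Disjoint transpositions commute; the two expansions of the cocycle on their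
    product are compared at \<open>c\<close>.\<close>
  have h_disj: "[h a b c = h a b d] (mod int r)"
    if "a \<in> {1..n}" "b \<in> {1..n}" "c \<in> {1..n}" "d \<in> {1..n}" "c \<noteq> a" "c \<noteq> b" "d \<noteq> a" "d \<noteq> b" for a b c d
  proof (cases "c = d")
    case False
    have "transpose a b \<circ> transpose c d = transpose c d \<circ> transpose a b"
      using that by (intro transpose_commute_fixed[symmetric] bij_transpose) auto
    then have 1: "[w (transpose c d \<circ> transpose a b) c = h a b d + h c d c] (mod int r)"
      using w_mult[of "transpose a b" "transpose c d" c] that by (simp add: h_def permutes_swap_id)
    have 2: "[w (transpose c d \<circ> transpose a b) c = h c d c + h a b c] (mod int r)"
      using w_mult[of "transpose c d" "transpose a b" c] that by (simp add: h_def permutes_swap_id)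
    show ?thesis
      by (rule cong_lin2[OF 1 2, of _ _ 1 "-1"]) simp
  qed simp
  \<comment> \<open>The cocycle is expanded along \<open>(a b)(b c)(a b) = (a c)\<close> at the
    point \<open>b\<close>; the two contributions of \<open>(a b)\<close> cancel.\<close>
  have h_triple: "[h b c a = h a c b] (mod int r)"
    if "a \<in> {1..n}" "b \<in> {1..n}" "c \<in> {1..n}" "a \<noteq> b" "b \<noteq> c" "a \<noteq> c" for a b c
  proof -
    have eq: "transpose a b \<circ> transpose b c \<circ> transpose a b = transpose a c"
      using that by (intro transpose_comp_triple) auto
    have perm: "transpose a b permutes {1..n}" "transpose b c permutes {1..n}"
      "transpose a b \<circ> transpose b c permutes {1..n}"
      using that by (intro permutes_compose permutes_swap_id; simp)+
    have 1: "[h a c b = w (transpose a b \<circ> transpose b c) a + h a b b] (mod int r)"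
      using w_mult[OF perm(3,1), of b] that unfolding eq by (simp add: h_def)
    have 2: "[w (transpose a b \<circ> transpose b c) a = h a b a + h b c a] (mod int r)"
      using w_mult[OF perm(1,2), of a] that by (simp add: h_def)
    show ?thesis
      by (rule cong_lin3[OF 1 2 h_invol[of a b b], of _ _ "-1" "-1" "-1"]) (use that in auto)
  qed
  \<comment> \<open>With at most two points, none lies outside a transposition, and
    \<open>z = 0\<close> serves.\<close>
  define z where "z = (if n \<le> 2 then 0 else h 1 2 3)"
  have z2: "[2 * z = 0] (mod int r)"
    using h_invol[of 1 2 3] by (auto simp: z_def)
  have adj: "[h i (i + 1) c = z] (mod int r)"
    if "1 \<le> i" "i + 1 \<le> n" "c \<in> {1..n}" "c \<noteq> i" "c \<noteq> i + 1" for i c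
    using that
  proof (induction i arbitrary: c rule: nat_induct_at_least)
    case base
    then have "3 \<le> n" by auto
    then show ?case
      using h_disj[of 1 2 c 3] base by (simp add: z_def)
  next
    case (Suc i)
    \<comment> \<open>The value outside the support is first moved to the point \<open>i\<close>;
      two rotations of the triple \<open>i\<close>, \<open>i + 1\<close>, \<open>i + 2\<close> then
      turn it into the value of the preceding transposition at \<open>i + 2\<close>.\<close>
    have 1: "[h (i + 1) (i + 2) c = h (i + 1) (i + 2) i] (mod int r)"
      using Suc by (intro h_disj) auto
    have 2: "[h (i + 1) (i + 2) i = h i (i + 2) (i + 1)] (mod int r)"
      using Suc by (intro h_triple) auto
    have 3: "[h (i + 2) i (i + 1) = h (i + 1) i (i + 2)] (mod int r)"
      using Suc by (intro h_triple) auto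
    have 4: "[h i (i + 1) (i + 2) = z] (mod int r)"
      using Suc by (intro Suc.IH) auto
    show ?case
      using cong_trans[OF 1 cong_trans[OF 2]] 3 4 h_comm cong_trans by (metis Suc_eq_plus1 add_Suc_right one_add_one plus_1_eq_Suc)
  qed
  \<comment> \<open>Telescoping choice: \<open>v (k + 1) - v k + z\<close> is the cocycle value of
    \<open>(k k+1)\<close> at \<open>k\<close>.\<close>
  define v where "v m = (\<Sum>i = 1..<m. h i (i + 1) i - z)" for m
  have v: "v (i + 1) = v i + h i (i + 1) i - z" if "1 \<le> i" for i
    using that sum.atLeastLessThan_Suc[of 1 i "\<lambda>i. h i (i + 1) i - z"]
    by (simp only: v_def Suc_eq_plus1)
  have gen: "[w (transpose k (k + 1)) i = v (transpose k (k + 1) i) - v i + z] (mod int r)"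
    if k: "1 \<le> k" "k < n" and i: "i \<in> {1..n}" for k i
  proof -
    consider "i = k" | "i = k + 1" | "i \<noteq> k" "i \<noteq> k + 1" by blast
    then show ?thesis
    proof cases
      case 1
      then show ?thesis using v[OF k(1)] by (simp add: h_def)
    next
      case 2
      have "[h k (k + 1) k + h k (k + 1) (k + 1) = 0] (mod int r)"
        using h_invol[of k "k + 1" "k + 1"] k by simp
      from cong_lin2[OF this z2, of _ _ 1 "-1"] show ?thesis
        using v[OF k(1)] 2 by (simp add: h_def)
    next
      case 3
      then show ?thesis using adj[of k i] k i by (simp add: h_def)
    qed
  qed
  have "[w \<pi> i = v (\<pi> i) - v i + (if evenperm \<pi> then 0 else z)] (mod int r)"
    if "\<pi> permutes {1..n}" "i \<in> {1..n}" for \<pi> i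
    using that
  proof (induction arbitrary: i rule: permutes_adjacent_induct)
    case id
    then have "[w id i = v (id i) - v i + (if evenperm id then 0 else z)] (mod int r)"
      using w_id[of i] by simp
    then show ?case .
  next
    case (adj k \<pi>)
    let ?s = "transpose k (k + 1)"
    have s: "?s permutes {1..n}"
      using adj by (intro permutes_swap_id) auto
    have si: "?s i \<in> {1..n}"
      using permutes_in_image[OF s] adj by simp
    have even: "evenperm (\<pi> \<circ> ?s) \<longleftrightarrow> \<not> evenperm \<pi>"
      using permutes_imp_permutation[OF _ adj(3)]
      by (subst evenperm_comp) (auto simp: evenperm_swap permutation_swap_id)
    have 1: "[w (\<pi> \<circ> ?s) i = w \<pi> (?s i) + w ?s i] (mod int r)"
      using w_mult[OF adj(3) s, of i] adj.prems by simp
    have 2: "[w (\<pi> \<circ> ?s) i = v (\<pi> (?s i)) - v i + ((if evenperm \<pi> then 0 else z) + z)] (mod int r)"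
      by (rule cong_lin3[OF 1 adj.IH[OF si] gen[OF adj(1,2) adj.prems], of _ _ 1 1 1]) simp
    have "[w (\<pi> \<circ> ?s) i = v ((\<pi> \<circ> ?s) i) - v i + (if evenperm (\<pi> \<circ> ?s) then 0 else z)] (mod int r)"
    proof (cases "evenperm \<pi>")
      case True
      then show ?thesis using 2 even by simp
    next
      case False
      show ?thesis
        by (rule cong_lin2[OF 2 z2, of _ _ 1 1]) (use False even in simp)
    qed
    then show ?case .
  qed
  moreover have "int p dvd int n * z"
  proof (cases "n \<le> 2")
    case False
    let ?s = "transpose 1 (1 + 1)"
    have s: "?s permutes {1..n}"
      using False by (intro permutes_swap_id) auto
    \<comment> \<open>Coboundaries have coordinate sum zero, so the cocycle on \<open>(1 2)\<close>
      has sum \<open>n z\<close>, and this sum is divisible by \<open>p\<close>.\<close>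
    have "[(\<Sum>i = 1..n. w ?s i) = (\<Sum>i = 1..n. v (?s i) - v i + z)] (mod int r)"
      using False gen[of 1] by (intro cong_sum) auto
    also have "(\<Sum>i = 1..n. v (?s i) - v i + z) = int n * z"
      using sum_perm[OF s, of v] by (simp add: sum.distrib sum_subtractf)
    finally have "[(\<Sum>i = 1..n. w ?s i) = int n * z] (mod int p)"
      using p_dvd_int cong_dvd_modulus by blast
    then show ?thesis
      using good_w[OF s] cong_dvd_iff by blast
  qed (simp add: z_def)
  ultimately show ?thesis using z2 by (intro exI[of _ v] exI[of _ z]) simp
qed

text \<open>Because \<open>2 z = 0\<close>, the sign may be replaced by the number of inversions, as
  \<open>alpha\<close> requires.\<close>

lemma endo_form:
  assumes n: "n > 0"
  shows "\<exists>v z j k. int p dvd int n * z \<and> (\<forall>f \<pi>. el f \<pi> \<in> carrier G \<longrightarrow>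
      \<phi> (el f \<pi>) = el (\<lambda>i. v (\<pi> i) - v i + int (inversions n \<pi>) * z + (\<Sum>i = 1..n. f i) * k + j * f i) \<pi>)"
proof -
  obtain j k where F: "\<And>f i. good f \<Longrightarrow> i \<in> {1..n} \<Longrightarrow>
    [F f i = j * f i + (\<Sum>i = 1..n. f i) * k] (mod int r)"
    using F_scalar[OF n] by blast
  obtain v z where z: "[2 * z = 0] (mod int r)" "int p dvd int n * z"
    and w: "\<And>\<pi> i. \<pi> permutes {1..n} \<Longrightarrow> i \<in> {1..n} \<Longrightarrow>
      [w \<pi> i = v (\<pi> i) - v i + (if evenperm \<pi> then 0 else z)] (mod int r)"
    using w_coboundary[OF n] by blast
  have inv: "[int (inversions n \<pi>) * z = (if evenperm \<pi> then 0 else z)] (mod int r)"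
    if "\<pi> permutes {1..n}" for \<pi>
  proof -
    define m where "m = inversions n \<pi> div 2"
    have "inversions n \<pi> = 2 * m + (if evenperm \<pi> then 0 else 1)"
      using evenperm_iff_even_inversions[OF that] by (auto simp: m_def dest: odd_pos)
    then have "int (inversions n \<pi>) * z - (if evenperm \<pi> then 0 else z) = int m * (2 * z - 0) + 0 * (z - z)"
      by (auto simp: algebra_simps)
    then show ?thesis
      by (rule cong_lin2[OF z(1) cong_refl])
  qed
  have "\<phi> (el f \<pi>) = el (\<lambda>i. v (\<pi> i) - v i + int (inversions n \<pi>) * z + (\<Sum>i = 1..n. f i) * k + j * f i) \<pi>"
    if fp: "el f \<pi> \<in> carrier G" for f \<pi>
    unfolding phi_eq[OF fp]
  proof (rule wr_eqI)
    fix i assume i: "1 \<le> i" "i \<le> n"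
    show "[w \<pi> i + F f i = v (\<pi> i) - v i + int (inversions n \<pi>) * z + (\<Sum>i = 1..n. f i) * k + j * f i] (mod int r)"
      by (rule cong_lin3[OF w[of \<pi> i] F[of f i] inv[of \<pi>], of _ _ 1 1 "-1"]) (use fp i in simp_all)
  qed
  then show ?thesis using z(2) by (intro exI[of _ v] exI[of _ z] exI[of _ j] exI[of _ k]) blast
qed

end

section \<open>Automorphisms that preserve the diagonal subgroup\<close>

locale grpn_auto = grpn +
  fixes \<phi>
  assumes aut: "\<phi> \<in> auto G"
begin

lemma phi_hom: "\<phi> \<in> hom G G"
  using aut by (simp add: auto_def)

lemma phi_mult: "g \<in> carrier G \<Longrightarrow> h \<in> carrier G \<Longrightarrow> \<phi> (g \<otimes>\<^bsub>W\<^esub> h) = \<phi> g \<otimes>\<^bsub>W\<^esub> \<phi> h"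
  using phi_hom by (simp add: hom_def)

lemma phi_closed: "g \<in> carrier G \<Longrightarrow> \<phi> g \<in> carrier G"
  using phi_hom by (simp add: hom_def Pi_iff)

lemma phi_inj: "g \<in> carrier G \<Longrightarrow> h \<in> carrier G \<Longrightarrow> \<phi> g = \<phi> h \<Longrightarrow> g = h"
  using aut by (auto simp: auto_def Bij_def bij_betw_def dest: inj_onD)

lemma phi_surj:
  assumes "g \<in> carrier G"
  shows "\<exists>h\<in>carrier G. \<phi> h = g"
proof -
  have "g \<in> \<phi> ` carrier G"
    using aut assms by (simp add: auto_def Bij_def bij_betw_def)
  then show ?thesis
    by (rule imageE) (rule bexI, erule sym)
qed

lemma phi_ext: "\<phi> \<in> extensional (carrier G)"
  using aut by (simp add: auto_def Bij_def)

lemma phi_el: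
  assumes "g \<in> carrier G"
  obtains f \<pi> where "\<phi> g = el f \<pi>" "\<pi> permutes {1..n}" "int p dvd (\<Sum>i = 1..n. f i)"
  using phi_closed[OF assms] by (rule G_cases)

end

locale grpn_diag_auto = grpn_auto +
  assumes diag: "\<And>f. int p dvd (\<Sum>i = 1..n. f i) \<Longrightarrow> snd (\<phi> (el f id)) = id"
begin

abbreviation good :: "(nat \<Rightarrow> int) \<Rightarrow> bool" where "good f \<equiv> int p dvd (\<Sum>i = 1..n. f i)"

definition D where "D = {g \<in> carrier G. snd g = id}"

lemma D_cases:
  assumes "g \<in> D"
  obtains f where "g = el f id" "good f"
  using assms unfolding D_def by (auto elim!: G_cases)

lemma phi_D: "\<phi> ` D = D"
proof (rule endo_inj_surj)
  show "finite D"
    using G_finite by (simp add: D_def)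
  show "\<phi> ` D \<subseteq> D"
  proof (rule image_subsetI)
    fix g assume "g \<in> D"
    then obtain f where f: "g = el f id" "good f" "g \<in> carrier G"
      by (metis (no_types, lifting) D_cases D_def mem_Collect_eq)
    then show "\<phi> g \<in> D"
      using diag[OF f(2)] phi_closed[OF f(3)] by (simp add: D_def)
  qed
  show "inj_on \<phi> D"
    using phi_inj by (intro inj_onI) (simp add: D_def)
qed

lemma diag_iff:
  assumes "g \<in> carrier G"
  shows "snd (\<phi> g) = id \<longleftrightarrow> snd g = id"
proof
  assume "snd (\<phi> g) = id"
  then have "\<phi> g \<in> \<phi> ` D"
    unfolding phi_D using phi_closed[OF assms] by (simp add: D_def)
  then obtain h where "h \<in> D" "\<phi> g = \<phi> h" by blast
  then show "snd g = id"
    using phi_inj[of g h] assms by (simp add: D_def)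
next
  assume "snd g = id"
  then show "snd (\<phi> g) = id"
    using phi_D assms by (auto simp: D_def)
qed

definition \<beta> where "\<beta> \<pi> = snd (\<phi> (el (\<lambda>_. 0) \<pi>))"

lemma snd_mult: "g \<in> carrier W \<Longrightarrow> h \<in> carrier W \<Longrightarrow> snd (g \<otimes>\<^bsub>W\<^esub> h) = snd g \<circ> snd h"
  by (elim el_cases) (simp add: el_mult)

lemma snd_phi_mult:
  "g \<in> carrier G \<Longrightarrow> h \<in> carrier G \<Longrightarrow> snd (\<phi> (g \<otimes>\<^bsub>W\<^esub> h)) = snd (\<phi> g) \<circ> snd (\<phi> h)"
  by (simp only: phi_mult snd_mult[OF subsetD[OF G_subset] subsetD[OF G_subset]] phi_closed)

lemma snd_phi:
  assumes "el f \<pi> \<in> carrier G"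
  shows "snd (\<phi> (el f \<pi>)) = \<beta> \<pi>"
proof -
  have \<pi>: "\<pi> permutes {1..n}" and f: "good f"
    using assms by simp_all
  have "el f \<pi> = el (\<lambda>_. 0) \<pi> \<otimes>\<^bsub>W\<^esub> el f id"
    using el_mult[OF \<pi> permutes_id] by (simp only: comp_id id_apply add_0)
  then have "snd (\<phi> (el f \<pi>)) = snd (\<phi> (el (\<lambda>_. 0) \<pi>)) \<circ> snd (\<phi> (el f id))"
    using snd_phi_mult[of "el (\<lambda>_. 0) \<pi>" "el f id"] \<pi> f by (simp add: permutes_id)
  then show ?thesis
    unfolding diag[OF f] by (simp only: comp_id \<beta>_def)
qed

lemma beta_endomorphism: "sym_endomorphism {1..n} \<beta>"
proof
  fix \<pi> \<sigma> assume \<pi>: "\<pi> permutes {1..n}"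
  then have el: "el (\<lambda>_. 0) \<pi> \<in> carrier G"
    by simp
  then show "\<beta> \<pi> permutes {1..n}"
    by (rule phi_el) (simp add: \<beta>_def)
  assume \<sigma>: "\<sigma> permutes {1..n}"
  then have el': "el (\<lambda>_. 0) \<sigma> \<in> carrier G"
    by simp
  show comp: "\<beta> (\<pi> \<circ> \<sigma>) = \<beta> \<pi> \<circ> \<beta> \<sigma>"
    using snd_phi_mult[OF el el'] el_mult[OF \<pi> \<sigma>] by (simp add: \<beta>_def)
  assume eq: "\<beta> \<pi> = \<beta> \<sigma>"
  let ?g = "el (\<lambda>_. 0) (inv' \<sigma>)"
  have "inv' \<sigma> permutes {1..n}" using \<sigma> by (rule permutes_inv)
  then have g: "?g \<in> carrier G" by simp
  have "snd (\<phi> (?g \<otimes>\<^bsub>W\<^esub> el (\<lambda>_. 0) \<pi>)) = snd (\<phi> (?g \<otimes>\<^bsub>W\<^esub> el (\<lambda>_. 0) \<sigma>))"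
    using snd_phi_mult[OF g el] snd_phi_mult[OF g el'] eq by (simp only: \<beta>_def)
  also have "?g \<otimes>\<^bsub>W\<^esub> el (\<lambda>_. 0) \<sigma> = el (\<lambda>_. 0) id"
    using el_mult[OF permutes_inv[OF \<sigma>] \<sigma>] permutes_inv_o(2)[OF \<sigma>] by simp
  also have "snd (\<phi> (el (\<lambda>_. 0) id)) = id"
    by (rule diag) simp
  finally have "snd (?g \<otimes>\<^bsub>W\<^esub> el (\<lambda>_. 0) \<pi>) = id"
    using diag_iff[of "?g \<otimes>\<^bsub>W\<^esub> el (\<lambda>_. 0) \<pi>"] g el G.m_closed by (simp del: el_G_iff)
  then have "inv' \<sigma> \<circ> \<pi> = id"
    using el_mult[OF permutes_inv[OF \<sigma>] \<pi>] by simp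
  then have "\<sigma> \<circ> (inv' \<sigma> \<circ> \<pi>) = \<sigma>"
    by (simp only: comp_id)
  then show "\<pi> = \<sigma>"
    using permutes_inv_o(1)[OF \<sigma>] by (simp only: o_assoc id_comp)
qed simp

lemma phi_equivariant:
  assumes f: "good f" and \<pi>: "\<pi> permutes {1..n}" and x: "\<phi> (el f id) = el x id"
  shows "\<phi> (el (\<lambda>i. f (\<pi> i)) id) = el (\<lambda>i. x (\<beta> \<pi> i)) id"
proof -
  let ?\<pi> = "el (\<lambda>_. 0) \<pi>"
  have f\<pi>: "good (\<lambda>i. f (\<pi> i))"
    using f \<pi> by (simp add: sum_perm)
  have G: "el f id \<in> carrier G" "el (\<lambda>i. f (\<pi> i)) id \<in> carrier G" "?\<pi> \<in> carrier G"
    using f f\<pi> \<pi> by (simp_all add: permutes_id)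
  obtain u where u: "\<phi> (el (\<lambda>i. f (\<pi> i)) id) = el u id"
    using phi_el[OF G(2)] diag[OF f\<pi>] by (metis snd_wr)
  obtain w where w: "\<phi> ?\<pi> = el w (\<beta> \<pi>)" "\<beta> \<pi> permutes {1..n}"
    using phi_el[OF G(3)] by (metis snd_wr \<beta>_def)
  have "el f id \<otimes>\<^bsub>W\<^esub> ?\<pi> = ?\<pi> \<otimes>\<^bsub>W\<^esub> el (\<lambda>i. f (\<pi> i)) id"
    using el_mult[OF permutes_id \<pi>] el_mult[OF \<pi> permutes_id]
    by (simp only: comp_id id_comp id_apply add_0 add_0_right)
  then have "el x id \<otimes>\<^bsub>W\<^esub> el w (\<beta> \<pi>) = el w (\<beta> \<pi>) \<otimes>\<^bsub>W\<^esub> el u id"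
    using phi_mult[OF G(1,3)] phi_mult[OF G(3,2)] by (simp only: x u w)
  then have *: "\<forall>i\<in>{1..n}. [x (\<beta> \<pi> i) + w i = w i + u i] (mod int r)"
    using el_mult[OF permutes_id w(2)] el_mult[OF w(2) permutes_id]
    by (simp only: comp_id id_comp id_apply wr_eq_iff simp_thms)
  have "[u i = x (\<beta> \<pi> i)] (mod int r)" if "i \<in> {1..n}" for i
    by (rule cong_lin2[OF bspec[OF * that] cong_refl, of _ _ "-1" 0]) simp
  then show ?thesis
    unfolding u by (intro wr_eqI) simp
qed

text \<open>If \<open>\<tau>\<close> and \<open>\<tau>'\<close> are the images in \<open>S\<^sub>6\<close> of two disjoint transpositions, then
  \<open>(1 - \<tau>) (1 - \<tau>')\<close> annihilates the diagonal subgroup. For distinct fixed point free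
  involutions this is only possible if \<open>r = 1\<close>.\<close>

lemma not_fixed_point_free:
  assumes n: "n = 6" and r: "r \<noteq> 1"
  shows "\<exists>a b x. a \<in> {1..n} \<and> b \<in> {1..n} \<and> a \<noteq> b \<and> x \<in> {1..n} \<and> \<beta> (transpose a b) x = x"
proof (rule ccontr)
  assume contr: "\<not> ?thesis"
  have fpf: "\<beta> (transpose a b) x \<noteq> x" if "a \<in> {1..n}" "b \<in> {1..n}" "a \<noteq> b" "x \<in> {1..n}" for a b x
    using contr that by blast
  interpret B: sym_endomorphism "{1..n}" \<beta>
    by (rule beta_endomorphism)
  let ?t = "transpose 1 2 :: nat \<Rightarrow> nat" and ?t' = "transpose 3 4 :: nat \<Rightarrow> nat"
  define \<tau> where "\<tau> = \<beta> ?t"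
  define \<tau>' where "\<tau>' = \<beta> ?t'"
  have t: "?t permutes {1..n}" "?t' permutes {1..n}" "?t \<circ> ?t' permutes {1..n}"
    using n by (intro permutes_swap_id permutes_compose; simp)+
  have "?t 1 \<noteq> ?t' 1" by simp
  then have "\<tau> \<noteq> \<tau>'"
    using B.inj[OF t(1,2)] unfolding \<tau>_def \<tau>'_def by metis
  then obtain i where neq: "\<tau> i \<noteq> \<tau>' i" by (auto simp: fun_eq_iff)
  have \<tau>: "\<tau> permutes {1..n}" "\<tau>' permutes {1..n}"
    using t B.permutes by (simp_all add: \<tau>_def \<tau>'_def)
  have i: "i \<in> {1..n}"
    using neq permutes_not_in[OF \<tau>(1)] permutes_not_in[OF \<tau>(2)] by metis
  have \<tau>fpf: "\<tau> x \<noteq> x" "\<tau>' x \<noteq> x" if "x \<in> {1..n}" for x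
    using fpf[of 1 2 x] fpf[of 3 4 x] that n by (simp_all add: \<tau>_def \<tau>'_def)
  \<comment> \<open>Six points leave room for a \<open>c\<close> outside these four, so that
    \<open>e_i - e_c\<close> takes the value 1 at \<open>i\<close> and 0 at the three images of
    \<open>i\<close>.\<close>
  have "\<not> {1..n} \<subseteq> {i, \<tau> i, \<tau>' i, \<tau> (\<tau>' i)}"
  proof
    assume "{1..n} \<subseteq> {i, \<tau> i, \<tau>' i, \<tau> (\<tau>' i)}"
    then have "card {1..n} \<le> card {i, \<tau> i, \<tau>' i, \<tau> (\<tau>' i)}"
      by (intro card_mono) simp_all
    also have "\<dots> \<le> 4"
      using card_length[of "[i, \<tau> i, \<tau>' i, \<tau> (\<tau>' i)]"] by simp
    finally show False using n by simp
  qed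
  then obtain c where c: "c \<in> {1..n}" "c \<noteq> i" "c \<noteq> \<tau> i" "c \<noteq> \<tau>' i" "c \<noteq> \<tau> (\<tau>' i)" by blast
  define x where "x k = unit i k - unit c k" for k
  have "good x"
    using i c by (simp add: x_def sum_subtractf)
  then have "el x id \<in> \<phi> ` D"
    unfolding phi_D by (simp add: D_def permutes_id)
  then obtain f where f: "\<phi> (el f id) = el x id" "good f"
    by (metis D_cases imageE)
  have ft: "good (\<lambda>i. f (?t i))" "good (\<lambda>i. f (?t' i))" "good (\<lambda>i. f ((?t \<circ> ?t') i))"
    using f(2) sum_perm[OF t(1)] sum_perm[OF t(2)] sum_perm[OF t(3)] by simp_all
  \<comment> \<open>This is \<open>(1 - t) (1 - t') f = 0\<close>: every point is fixed by one of
    two disjoint transpositions.\<close>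
  have "f i + f ((?t \<circ> ?t') i) = f (?t i) + f (?t' i)" for i
    by (cases "i = 1"; cases "i = 2"; cases "i = 3"; cases "i = 4") simp_all
  then have "el f id \<otimes>\<^bsub>W\<^esub> el (\<lambda>i. f ((?t \<circ> ?t') i)) id = el (\<lambda>i. f (?t i)) id \<otimes>\<^bsub>W\<^esub> el (\<lambda>i. f (?t' i)) id"
    by (simp only: el_mult_diag)
  then have "\<phi> (el f id) \<otimes>\<^bsub>W\<^esub> \<phi> (el (\<lambda>i. f ((?t \<circ> ?t') i)) id)
    = \<phi> (el (\<lambda>i. f (?t i)) id) \<otimes>\<^bsub>W\<^esub> \<phi> (el (\<lambda>i. f (?t' i)) id)"
    using f(2) ft by (simp only: phi_mult[symmetric] el_G_iff permutes_id simp_thms)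
  then have "el (\<lambda>i. x i + x (\<beta> (?t \<circ> ?t') i)) id = el (\<lambda>i. x (\<tau> i) + x (\<tau>' i)) id"
    by (simp only: phi_equivariant[OF f(2) t(1) f(1)] phi_equivariant[OF f(2) t(2) f(1)]
        phi_equivariant[OF f(2) t(3) f(1)] f(1) el_mult_diag \<tau>_def \<tau>'_def)
  then have "[x i + x (\<tau> (\<tau>' i)) = x (\<tau> i) + x (\<tau>' i)] (mod int r)"
    using i B.comp[OF t(1,2)] by (simp add: wr_eq_iff \<tau>_def \<tau>'_def)
  moreover have "\<tau>' i \<in> {1..n}"
    using permutes_in_image[OF \<tau>(2)] i by blast
  then have "\<tau> (\<tau>' i) \<noteq> \<tau>' i"
    using \<tau>fpf by blast
  moreover have "\<tau> (\<tau>' i) \<noteq> i"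
  proof
    assume "\<tau> (\<tau>' i) = i"
    moreover have "\<tau> (\<tau> i) = i"
      using B.transposition_involution[of 1 2] n by (simp add: \<tau>_def)
    ultimately have "\<tau>' i = \<tau> i"
      using permutes_inj[OF \<tau>(1)] by (metis injD)
    then show False using neq by simp
  qed
  ultimately have "[1 = 0] (mod int r)"
    using \<tau>fpf[OF i] c by (simp add: x_def)
  then show False
    using r by (simp add: cong_iff_dvd_diff)
qed

text \<open>Undoing the inner automorphism \<open>\<gamma>\<close> of the symmetric group makes
  \<open>endo_form\<close> applicable to \<open>\<psi>\<close>. The coboundary in its formula is a
  conjugation by \<open>v\<close>, and both conjugations merge into the one by
  \<open>el v \<gamma>\<close>.\<close>

lemma normal_form:
  assumes n: "n > 0"
    and not_fpf: "n = 6 \<Longrightarrow> \<exists>a b x. a \<in> {1..n} \<and> b \<in> {1..n} \<and> a \<noteq> b \<and> x \<in> {1..n} \<and> \<beta> (transpose a b) x = x"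
  shows "\<exists>g\<in>carrier (Grpn r 1 n). \<exists>j k. \<exists>z\<in>Crpn r p n.
    \<phi> = compose (carrier G) (Ad r p n g) (alpha r p n j k z)"
proof -
  interpret B: sym_endomorphism "{1..n}" \<beta>
    by (rule beta_endomorphism)
  have transp: "\<exists>c\<in>{1..n}. \<exists>d\<in>{1..n}. c \<noteq> d \<and> \<beta> (transpose a b) = transpose c d"
    if ab: "a \<in> {1..n}" "b \<in> {1..n}" "a \<noteq> b" for a b
  proof (rule B.transposition_image_cases)
    assume "card {1..n} = 6" and fpf: "\<And>a b x. a \<in> {1..n} \<Longrightarrow> b \<in> {1..n} \<Longrightarrow> a \<noteq> b \<Longrightarrow> x \<in> {1..n} \<Longrightarrow> \<beta> (transpose a b) x \<noteq> x"
    then have "n = 6" by simp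
    then show ?thesis
      using not_fpf fpf by blast
  qed (use ab in blast)
  obtain \<gamma> where \<gamma>: "\<gamma> permutes {1..n}" and \<beta>: "\<And>\<pi>. \<pi> permutes {1..n} \<Longrightarrow> \<beta> \<pi> = \<gamma> \<circ> \<pi> \<circ> inv' \<gamma>"
    using B.inner[OF transp] by metis
  let ?a = "el (\<lambda>_. 0) \<gamma>" and ?b = "el (\<lambda>_. 0) (inv' \<gamma>)"
  have ab: "?a \<in> carrier G" "?b \<in> carrier G"
    using \<gamma> permutes_inv[OF \<gamma>] by simp_all
  have one: "?a \<otimes>\<^bsub>W\<^esub> ?b = \<one>\<^bsub>W\<^esub>" "?b \<otimes>\<^bsub>W\<^esub> ?a = \<one>\<^bsub>W\<^esub>"
    using el_mult[OF \<gamma> permutes_inv[OF \<gamma>]] el_mult[OF permutes_inv[OF \<gamma>] \<gamma>] permutes_inv_o[OF \<gamma>]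
    by (simp_all add: el_one)
  have W: "x \<in> carrier W" if "x \<in> carrier G" for x
    using that G_subset by blast
  define \<psi> where "\<psi> g = ?b \<otimes>\<^bsub>W\<^esub> \<phi> g \<otimes>\<^bsub>W\<^esub> ?a" for g
  have \<psi>_closed: "\<psi> g \<in> carrier G" if "g \<in> carrier G" for g
    using G.m_closed[OF G.m_closed[OF ab(2) phi_closed[OF that]] ab(1)] by (simp add: \<psi>_def)
  have \<phi>\<psi>: "\<phi> g = ?a \<otimes>\<^bsub>W\<^esub> \<psi> g \<otimes>\<^bsub>W\<^esub> ?b" if "g \<in> carrier G" for g
  proof -
    have "?a \<otimes>\<^bsub>W\<^esub> \<psi> g \<otimes>\<^bsub>W\<^esub> ?b = (?a \<otimes>\<^bsub>W\<^esub> ?b) \<otimes>\<^bsub>W\<^esub> \<phi> g \<otimes>\<^bsub>W\<^esub> (?a \<otimes>\<^bsub>W\<^esub> ?b)"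
      using W[OF ab(1)] W[OF ab(2)] W[OF phi_closed[OF that]] by (simp only: \<psi>_def W.m_assoc W.m_closed)
    then show ?thesis
      using W[OF phi_closed[OF that]] by (simp add: one)
  qed
  have endo: "grpn_endo r n p \<psi>"
  proof (unfold_locales)
    show "\<psi> \<in> hom G G"
    proof (rule homI)
      fix x y assume xy: "x \<in> carrier G" "y \<in> carrier G"
      have "\<psi> x \<otimes>\<^bsub>W\<^esub> \<psi> y = ?b \<otimes>\<^bsub>W\<^esub> \<phi> x \<otimes>\<^bsub>W\<^esub> (?a \<otimes>\<^bsub>W\<^esub> ?b) \<otimes>\<^bsub>W\<^esub> \<phi> y \<otimes>\<^bsub>W\<^esub> ?a"
        using W[OF ab(1)] W[OF ab(2)] W[OF phi_closed[OF xy(1)]] W[OF phi_closed[OF xy(2)]]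
        by (simp only: \<psi>_def W.m_assoc W.m_closed)
      also have "\<dots> = \<psi> (x \<otimes>\<^bsub>W\<^esub> y)"
        using W[OF ab(1)] W[OF ab(2)] W[OF phi_closed[OF xy(1)]] W[OF phi_closed[OF xy(2)]]
        by (simp only: one \<psi>_def phi_mult[OF xy] W.m_assoc W.m_closed W.r_one W.l_one)
      finally show "\<psi> (x \<otimes>\<^bsub>G\<^esub> y) = \<psi> x \<otimes>\<^bsub>G\<^esub> \<psi> y"
        by simp
    qed (rule \<psi>_closed)
    fix f \<pi> assume f: "el f \<pi> \<in> carrier G"
    then have "snd (\<psi> (el f \<pi>)) = inv' \<gamma> \<circ> \<beta> \<pi> \<circ> \<gamma>"
      unfolding \<psi>_def using W ab phi_closed[OF f] snd_phi[OF f]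
      by (simp only: snd_mult W.m_closed snd_wr)
    also have "\<dots> = (inv' \<gamma> \<circ> \<gamma>) \<circ> \<pi> \<circ> (inv' \<gamma> \<circ> \<gamma>)"
      using f \<beta>[of \<pi>] by (simp only: comp_assoc el_G_iff)
    finally show "snd (\<psi> (el f \<pi>)) = \<pi>"
      by (simp only: permutes_inv_o[OF \<gamma>] comp_id id_comp)
  qed
  obtain v z j k where z: "int p dvd int n * z"
    and \<psi>: "\<And>f \<pi>. el f \<pi> \<in> carrier G \<Longrightarrow>
      \<psi> (el f \<pi>) = el (\<lambda>i. v (\<pi> i) - v i + int (inversions n \<pi>) * z + (\<Sum>i = 1..n. f i) * k + j * f i) \<pi>"
    using grpn_endo.endo_form[OF endo n] by blast
  interpret G1: grpn r n 1
    using r_pos by unfold_locales simp_all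
  have "el v \<gamma> \<in> carrier (Grpn r 1 n)"
    using \<gamma> by simp
  moreover have "\<phi> = compose (carrier G) (Ad r p n (el v \<gamma>)) (alpha r p n j k (el (\<lambda>_. z) id))"
  proof (rule extensionalityI[OF phi_ext compose_extensional])
    fix g assume g: "g \<in> carrier G"
    then obtain f \<pi> where f: "g = el f \<pi>" "\<pi> permutes {1..n}" "good f"
      by (rule G_cases)
    let ?h = "\<lambda>i. int (inversions n \<pi>) * z + (\<Sum>i = 1..n. f i) * k + j * f i"
    \<comment> \<open>\<open>Ad\<close> is restricted to G(r,p,n), so the value of
      \<open>alpha\<close> has to be placed there first.\<close>
    have "(\<Sum>i = 1..n. ?h i) = int (inversions n \<pi>) * (int n * z) + (\<Sum>i = 1..n. f i) * (int n * k + j)"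
      by (simp add: sum.distrib algebra_simps flip: sum_distrib_left)
    then have h: "el ?h \<pi> \<in> carrier G"
      using f z by simp
    have "\<phi> g = ?a \<otimes>\<^bsub>W\<^esub> el (\<lambda>i. v (\<pi> i) - v i + int (inversions n \<pi>) * z + (\<Sum>i = 1..n. f i) * k + j * f i) \<pi> \<otimes>\<^bsub>W\<^esub> ?b"
      using \<phi>\<psi>[OF g] \<psi>[of f \<pi>] g f(1) by simp
    also have "\<dots> = el (\<lambda>i. v (\<pi> (inv' \<gamma> i)) + ?h (inv' \<gamma> i) - v (inv' \<gamma> i)) (\<gamma> \<circ> \<pi> \<circ> inv' \<gamma>)"
      using \<gamma> f(2) by (simp add: el_mult permutes_inv permutes_compose algebra_simps)
    also have "\<dots> = Ad r p n (el v \<gamma>) (el ?h \<pi>)"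
      using Ad_el[OF h \<gamma>] by simp
    also have "el ?h \<pi> = alpha r p n j k (el (\<lambda>_. z) id) g"
      using alpha_el[of f \<pi> j k z] g f(1) by simp
    finally show "\<phi> g = compose (carrier G) (Ad r p n (el v \<gamma>)) (alpha r p n j k (el (\<lambda>_. z) id)) g"
      using g by (simp add: compose_eq)
  qed
  ultimately show ?thesis
    using const_in_Crpn[OF z] by blast
qed

end

section \<open>Automorphisms that move the diagonal subgroup\<close>

lemma ex_not_in_list:
  assumes "length xs < n"
  shows "\<exists>c\<in>{1..n}. c \<notin> set xs"
proof (rule ccontr)
  assume "\<not> ?thesis"
  then have "card {1..n} \<le> card (set xs)"
    by (intro card_mono) auto
  then show False using card_length[of xs] assms by simp
qed

context grpn_auto
begin

abbreviation good :: "(nat \<Rightarrow> int) \<Rightarrow> bool" where "good f \<equiv> int p dvd (\<Sum>i = 1..n. f i)"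

text \<open>The conjugating element is itself an image under \<open>\<phi>\<close>, and conjugating
  a diagonal element by its preimage only permutes coordinates. This is the normality of the image
  of the diagonal subgroup.\<close>

lemma conj_image:
  assumes u: "good u" and g: "el f \<pi> \<in> carrier G"
  obtains \<rho> where "\<rho> permutes {1..n}"
    "\<phi> (el (\<lambda>i. u (\<rho> i)) id) \<otimes>\<^bsub>W\<^esub> el f \<pi> = el f \<pi> \<otimes>\<^bsub>W\<^esub> \<phi> (el u id)"
proof -
  obtain h where h: "h \<in> carrier G" "\<phi> h = el f \<pi>"
    using phi_surj[OF g] ..
  then obtain f' \<rho> where \<rho>: "h = el f' \<rho>" "\<rho> permutes {1..n}"
    by (elim G_cases)
  have G: "el u id \<in> carrier G" "el (\<lambda>i. u (inv' \<rho> i)) id \<in> carrier G"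
    using u sum_perm[OF permutes_inv[OF \<rho>(2)]] by (simp_all add: permutes_id)
  have "el (\<lambda>i. u (inv' \<rho> i)) id \<otimes>\<^bsub>W\<^esub> h = h \<otimes>\<^bsub>W\<^esub> el u id"
    using el_mult[OF permutes_id \<rho>(2)] el_mult[OF \<rho>(2) permutes_id] permutes_inverses(2)[OF \<rho>(2)]
    by (simp only: \<rho>(1) comp_id id_comp id_apply add.commute)
  then have "\<phi> (el (\<lambda>i. u (inv' \<rho> i)) id) \<otimes>\<^bsub>W\<^esub> \<phi> h = \<phi> h \<otimes>\<^bsub>W\<^esub> \<phi> (el u id)"
    using phi_mult[OF G(2) h(1)] phi_mult[OF h(1) G(1)] by simp
  then show ?thesis
    using that[OF permutes_inv[OF \<rho>(2)]] h(2) by simp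
qed

lemma conj_perm_image:
  assumes u: "good u" and x: "\<phi> (el u id) = el x \<sigma>" and \<pi>: "\<pi> permutes {1..n}"
  obtains \<rho> where "\<rho> permutes {1..n}"
    "\<phi> (el (\<lambda>i. u (\<rho> i)) id) = el (\<lambda>i. x (inv' \<pi> i)) (\<pi> \<circ> \<sigma> \<circ> inv' \<pi>)"
proof -
  have G: "el (\<lambda>_. 0) \<pi> \<in> carrier G" "el u id \<in> carrier G"
    using \<pi> u by (simp_all add: permutes_id)
  have \<sigma>: "\<sigma> permutes {1..n}"
    using phi_closed[OF G(2)] x by simp
  obtain \<rho> where \<rho>: "\<rho> permutes {1..n}"
    "\<phi> (el (\<lambda>i. u (\<rho> i)) id) \<otimes>\<^bsub>W\<^esub> el (\<lambda>_. 0) \<pi> = el (\<lambda>_. 0) \<pi> \<otimes>\<^bsub>W\<^esub> \<phi> (el u id)"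
    using conj_image[OF u G(1)] .
  let ?y = "\<phi> (el (\<lambda>i. u (\<rho> i)) id)"
  have "el (\<lambda>i. u (\<rho> i)) id \<in> carrier G"
    using u \<rho>(1) by (simp add: permutes_id sum_perm)
  then have y: "?y \<in> carrier W"
    using phi_closed G_subset by blast
  have "el (\<lambda>i. x (inv' \<pi> i)) (\<pi> \<circ> \<sigma> \<circ> inv' \<pi>) \<otimes>\<^bsub>W\<^esub> el (\<lambda>_. 0) \<pi> = el x (\<pi> \<circ> \<sigma> \<circ> (inv' \<pi> \<circ> \<pi>))"
    using el_mult[of "\<pi> \<circ> \<sigma> \<circ> inv' \<pi>" \<pi>] \<pi> \<sigma>
    by (simp add: permutes_compose permutes_inv permutes_inverses(2) comp_assoc)
  also have "\<dots> = el (\<lambda>_. 0) \<pi> \<otimes>\<^bsub>W\<^esub> el x \<sigma>"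
    using el_mult[OF \<pi> \<sigma>] by (simp add: permutes_inv_o[OF \<pi>])
  finally have "el (\<lambda>i. x (inv' \<pi> i)) (\<pi> \<circ> \<sigma> \<circ> inv' \<pi>) \<otimes>\<^bsub>W\<^esub> el (\<lambda>_. 0) \<pi> = ?y \<otimes>\<^bsub>W\<^esub> el (\<lambda>_. 0) \<pi>"
    using \<rho>(2) x by simp
  then have "el (\<lambda>i. x (inv' \<pi> i)) (\<pi> \<circ> \<sigma> \<circ> inv' \<pi>) = ?y"
    using y \<pi> \<sigma> by (subst (asm) W.right_cancel) (simp_all add: permutes_compose permutes_inv)
  then show ?thesis using that[OF \<rho>(1)] by simp
qed

lemma diag_images_commute:
  assumes "good u" "good v"
  shows "\<phi> (el u id) \<otimes>\<^bsub>W\<^esub> \<phi> (el v id) = \<phi> (el v id) \<otimes>\<^bsub>W\<^esub> \<phi> (el u id)"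
proof -
  have "el u id \<in> carrier G" "el v id \<in> carrier G"
    using assms by (simp_all add: permutes_id)
  then show ?thesis
    by (simp only: phi_mult[symmetric] el_mult_diag add.commute)
qed

text \<open>Conjugates of one element of an abelian normal subgroup commute; this restricts the
  vector part of an image that is not diagonal.\<close>

lemma conj_perm_commute:
  assumes u: "good u" and x: "\<phi> (el u id) = el x \<sigma>"
    and \<pi>: "\<pi> permutes {1..n}" "\<pi>' permutes {1..n}"
  shows "el (\<lambda>i. x (inv' \<pi> i)) (\<pi> \<circ> \<sigma> \<circ> inv' \<pi>) \<otimes>\<^bsub>W\<^esub> el (\<lambda>i. x (inv' \<pi>' i)) (\<pi>' \<circ> \<sigma> \<circ> inv' \<pi>')
    = el (\<lambda>i. x (inv' \<pi>' i)) (\<pi>' \<circ> \<sigma> \<circ> inv' \<pi>') \<otimes>\<^bsub>W\<^esub> el (\<lambda>i. x (inv' \<pi> i)) (\<pi> \<circ> \<sigma> \<circ> inv' \<pi>)"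
proof -
  obtain \<rho> where \<rho>: "\<rho> permutes {1..n}"
    "\<phi> (el (\<lambda>i. u (\<rho> i)) id) = el (\<lambda>i. x (inv' \<pi> i)) (\<pi> \<circ> \<sigma> \<circ> inv' \<pi>)"
    using conj_perm_image[OF u x \<pi>(1)] .
  obtain \<rho>' where \<rho>': "\<rho>' permutes {1..n}"
    "\<phi> (el (\<lambda>i. u (\<rho>' i)) id) = el (\<lambda>i. x (inv' \<pi>' i)) (\<pi>' \<circ> \<sigma> \<circ> inv' \<pi>')"
    using conj_perm_image[OF u x \<pi>(2)] .
  show ?thesis
    using diag_images_commute[of "\<lambda>i. u (\<rho> i)" "\<lambda>i. u (\<rho>' i)"] u
    unfolding \<rho>(2) \<rho>'(2) by (simp add: sum_perm[OF \<rho>(1)] sum_perm[OF \<rho>'(1)])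
qed

text \<open>The image \<open>M\<close> of the diagonal subgroup is abelian and normal. If it contains \<open>(x, \<sigma>)\<close>,
  then it contains the commutator of \<open>(x, \<sigma>)\<close> with every diagonal \<open>v\<close>; being diagonal, this
  commutator is fixed by all conjugates of \<open>\<sigma>\<close>, which act transitively.\<close>

lemma commutator_constant:
  assumes u: "good u" and x: "\<phi> (el u id) = el x \<sigma>" and \<sigma>: "\<sigma> \<noteq> id"
    and v: "good v" and ij: "i \<in> {1..n}" "j \<in> {1..n}"
  shows "[v (\<sigma> i) - v i = v (\<sigma> j) - v j] (mod int r)"
proof (cases "i = j")
  case False
  have G: "el u id \<in> carrier G" "el v id \<in> carrier G"
    using u v by (simp_all add: permutes_id)
  have \<sigma>p: "\<sigma> permutes {1..n}"
    using phi_closed[OF G(1)] x by simp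
  obtain a where a: "\<sigma> a \<noteq> a"
    using \<sigma> by (auto simp: fun_eq_iff)
  have aA: "a \<in> {1..n}" "\<sigma> a \<in> {1..n}"
    using a permutes_not_in[OF \<sigma>p] permutes_in_image[OF \<sigma>p] by metis+
  obtain \<pi> where \<pi>: "\<pi> permutes {1..n}" "\<pi> a = i" "\<pi> (\<sigma> a) = j"
    using permutes_two_points[OF aA a[symmetric] ij False] .
  obtain \<rho> where \<rho>: "\<rho> permutes {1..n}"
    "\<phi> (el (\<lambda>i. u (\<rho> i)) id) \<otimes>\<^bsub>W\<^esub> el v id = el v id \<otimes>\<^bsub>W\<^esub> \<phi> (el u id)"
    using conj_image[OF u G(2)] .
  obtain \<rho>' where \<rho>': "\<rho>' permutes {1..n}"
    "\<phi> (el (\<lambda>i. u (\<rho>' i)) id) = el (\<lambda>i. x (inv' \<pi> i)) (\<pi> \<circ> \<sigma> \<circ> inv' \<pi>)"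
    using conj_perm_image[OF u x \<pi>(1)] .
  define \<sigma>' where "\<sigma>' = \<pi> \<circ> \<sigma> \<circ> inv' \<pi>"
  have \<sigma>': "\<sigma>' permutes {1..n}" "\<sigma>' i = j"
    using \<pi> \<sigma>p permutes_inverses(2)[OF \<pi>(1), of a]
    by (auto simp: \<sigma>'_def permutes_compose permutes_inv)
  \<comment> \<open>\<open>\<phi>\<close> maps \<open>?c\<close> to a commutator of
    \<open>(x, \<sigma>)\<close> with \<open>v\<close>, which turns out to be the diagonal vector
    \<open>v \<circ> \<sigma> - v\<close>.\<close>
  let ?c = "\<lambda>i. u (\<rho> i) - u i"
  have c: "good ?c" "good (\<lambda>i. u (\<rho>' i))"
    using u by (simp_all add: sum_subtractf sum_perm[OF \<rho>(1)] sum_perm[OF \<rho>'(1)])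
  have cG: "el ?c id \<in> carrier G"
    using c(1) by (simp add: permutes_id)
  obtain d \<tau> where d: "\<phi> (el ?c id) = el d \<tau>" "\<tau> permutes {1..n}"
    using phi_el[OF cG] .
  have "el (\<lambda>i. u (\<rho> i)) id = el u id \<otimes>\<^bsub>W\<^esub> el ?c id"
    by (simp add: el_mult_diag)
  then have "\<phi> (el u id) \<otimes>\<^bsub>W\<^esub> \<phi> (el ?c id) \<otimes>\<^bsub>W\<^esub> el v id = el v id \<otimes>\<^bsub>W\<^esub> \<phi> (el u id)"
    using \<rho>(2) phi_mult[OF G(1) cG] by simp
  then have "el (\<lambda>i. x (\<tau> i) + d i + v i) (\<sigma> \<circ> \<tau>) = el (\<lambda>i. v (\<sigma> i) + x i) \<sigma>"
    using el_mult[OF \<sigma>p d(2)] el_mult[OF permutes_compose[OF d(2) \<sigma>p] permutes_id] el_mult[OF permutes_id \<sigma>p]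
    by (simp only: x d(1) comp_id id_comp id_apply)
  then have *: "\<sigma> \<circ> \<tau> = \<sigma>" "\<forall>i\<in>{1..n}. [x (\<tau> i) + d i + v i = v (\<sigma> i) + x i] (mod int r)"
    by (simp_all add: wr_eq_iff)
  have \<tau>: "\<tau> = id"
    using fun_cong[OF *(1)] inj_eq[OF permutes_inj[OF \<sigma>p]] by (auto simp: fun_eq_iff)
  have dv: "[d i = v (\<sigma> i) - v i] (mod int r)" if "i \<in> {1..n}" for i
    by (rule cong_lin2[OF bspec[OF *(2) that] cong_refl, of _ _ 1 0]) (simp add: \<tau>)
  \<comment> \<open>Commuting with a conjugate of \<open>(x, \<sigma>)\<close> that sends
    \<open>i\<close> to \<open>j\<close> forces equal entries of \<open>d\<close> at
    \<open>i\<close> and \<open>j\<close>.\<close>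
  have "el d id \<otimes>\<^bsub>W\<^esub> el (\<lambda>i. x (inv' \<pi> i)) \<sigma>' = el (\<lambda>i. x (inv' \<pi> i)) \<sigma>' \<otimes>\<^bsub>W\<^esub> el d id"
    using diag_images_commute[OF c] by (simp only: d(1) \<tau> \<rho>'(2) \<sigma>'_def)
  then have "el (\<lambda>i. d (\<sigma>' i) + x (inv' \<pi> i)) \<sigma>' = el (\<lambda>i. x (inv' \<pi> i) + d i) \<sigma>'"
    using el_mult[OF permutes_id \<sigma>'(1)] el_mult[OF \<sigma>'(1) permutes_id]
    by (simp only: comp_id id_comp id_apply)
  then have "[d j + x (inv' \<pi> i) = x (inv' \<pi> i) + d i] (mod int r)"
    using ij \<sigma>'(2) by (auto simp: wr_eq_iff)
  from cong_lin3[OF this dv[OF ij(1)] dv[OF ij(2)], of _ _ "-1" "-1" 1] show ?thesis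
    by simp
qed simp

text \<open>Constancy of \<open>v \<circ> \<sigma> - v\<close> is tested on differences of unit
  vectors and on \<open>p e_a\<close>, for a point \<open>a\<close> moved by
  \<open>\<sigma>\<close>. The value at \<open>a\<close> is \<open>-1\<close>, \<open>-2\<close> or
  \<open>-p\<close>, and at a second point it is \<open>0\<close>, \<open>1\<close>,
  \<open>2\<close> or \<open>p\<close>; the congruences between them bound \<open>r\<close>. From
  three points on, \<open>p e_a\<close> forces \<open>p = r\<close>.\<close>

lemma exceptional_cases:
  assumes u: "good u" and x: "\<phi> (el u id) = el x \<sigma>" and \<sigma>: "\<sigma> \<noteq> id"
  shows "(r, p, n) \<in> {(2, 1, 2), (2, 2, 2), (4, 2, 2), (4, 4, 2), (3, 3, 3), (2, 2, 4)}"
proof -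
  have const: "[v (\<sigma> i) - v i = v (\<sigma> j) - v j] (mod int r)"
    if "good v" "i \<in> {1..n}" "j \<in> {1..n}" for v i j
    using commutator_constant[OF u x \<sigma> that] .
  have G: "el u id \<in> carrier G"
    using u by (simp add: permutes_id)
  have \<sigma>p: "\<sigma> permutes {1..n}"
    using phi_closed[OF G] x by simp
  have inj: "\<sigma> x = \<sigma> y \<longleftrightarrow> x = y" for x y
    using permutes_inj[OF \<sigma>p] by (rule inj_eq)
  obtain a where a: "\<sigma> a \<noteq> a"
    using \<sigma> by (auto simp: fun_eq_iff)
  define b where "b = \<sigma> a"
  have aA: "a \<in> {1..n}" "b \<in> {1..n}" "a \<noteq> b" "\<sigma> b \<noteq> b"
    using a permutes_not_in[OF \<sigma>p] permutes_in_image[OF \<sigma>p] inj unfolding b_def by metis+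
  define e where "e = inv' \<sigma> a"
  have e: "\<sigma> e = a" "e \<in> {1..n}" "e \<noteq> a"
    using permutes_inverses(1)[OF \<sigma>p] permutes_in_image[OF permutes_inv[OF \<sigma>p]] aA a
    unfolding e_def by metis+
  have r1: "r \<noteq> 1"
  proof
    assume "r = 1"
    then have "el u id = \<one>\<^bsub>W\<^esub>"
      unfolding el_one by (intro wr_eqI) simp
    then have "el x \<sigma> = \<one>\<^bsub>W\<^esub>"
      using hom_one[OF phi_hom G.is_group G.is_group] x by simp
    then show False using \<sigma> by (simp add: el_one wr_eq_iff)
  qed
  have not1: "\<not> int r dvd 1" "\<not> int r dvd - 1"
    using r1 by simp_all
  have diff: "good (\<lambda>i. unit c i - unit d i)" if "c \<in> {1..n}" "d \<in> {1..n}" for c d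
    using that by (simp add: sum_subtractf)
  have mult: "good (\<lambda>i. int p * unit c i)" if "c \<in> {1..n}" for c
    by (simp flip: sum_distrib_left)
  have "n \<noteq> 1"
    using aA by auto
  have pr: "p = r" if "n \<ge> 3"
  proof -
    have "length [a, e] < n"
      using that by simp
    from ex_not_in_list[OF this] obtain k where "k \<in> {1..n}" "k \<notin> set [a, e]" by blast
    then have "[- int p = 0] (mod int r)"
      using const[OF mult[OF aA(1)], of a k] e aA inj[of k e] by (simp add: b_def)
    then have "r dvd p"
      by (simp add: cong_iff_dvd_diff)
    then show ?thesis
      using p_dvd by (simp add: dvd_antisym)
  qed
  have four: "\<exists>k\<in>{1..n}. k \<noteq> a \<and> k \<noteq> b \<and> k \<noteq> e" if "n \<ge> 4"
    using ex_not_in_list[of "[a, b, e]" n] that by auto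
  consider "n = 2" | "n = 3" | "n = 4" | "n \<ge> 5"
    using \<open>n \<noteq> 1\<close> aA by fastforce
  then show ?thesis
  proof cases
    case 1
    have "e = b"
      using 1 e aA by auto
    then have "\<sigma> b = a"
      using e by simp
    then have r4: "[- 2 = 2] (mod int r)" "[- int p = int p] (mod int r)"
      using const[OF diff[OF aA(1,2)], of a b] const[OF mult[OF aA(1)], of a b] aA
      by (simp_all add: b_def[symmetric])
    have "int r dvd 4"
      using r4(1) by (simp add: cong_iff_dvd_diff)
    then have "r dvd 4" by presburger
    then have "r \<le> 4" by (rule dvd_imp_le) simp
    then have "r = 1 \<or> r = 2 \<or> r = 3 \<or> r = 4"
      using r_pos by linarith
    then have r: "r = 2 \<or> r = 4"
      using \<open>r dvd 4\<close> r1 by auto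
    have "int r dvd - int p - int p"
      using r4(2) by (simp only: cong_iff_dvd_diff)
    then have "int r dvd int (2 * p)"
      by (simp flip: dvd_minus_iff[of _ "- int p - int p"])
    then have "r dvd 2 * p" by (simp only: int_dvd_int_iff)
    moreover have "p \<le> r" using p_dvd r_pos by (rule dvd_imp_le)
    then have "p = 1 \<or> p = 2 \<or> p = 3 \<or> p = 4"
      using p_pos r by linarith
    ultimately have "r = 2 \<and> (p = 1 \<or> p = 2) \<or> r = 4 \<and> (p = 2 \<or> p = 4)"
      using r p_dvd by auto
    then show ?thesis using 1 by auto
  next
    case 2
    obtain c where c: "c \<in> {1..n}" "c \<noteq> a" "c \<noteq> b"
      using ex_not_in_list[of "[a, b]" n] 2 by auto
    have all: "i = a \<or> i = b \<or> i = c" if "i \<in> {1..n}" for i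
    proof (rule ccontr)
      assume "\<not> ?thesis"
      then have "card {a, b, c, i} = 4" using c aA by simp
      moreover have "card {a, b, c, i} \<le> card {1..n}"
        using c aA that by (intro card_mono) auto
      ultimately show False using 2 by simp
    qed
    have \<sigma>b: "\<sigma> b = a \<or> \<sigma> b = c"
      using all[of "\<sigma> b"] aA permutes_in_image[OF \<sigma>p] by blast
    have \<sigma>c: "\<sigma> c \<noteq> b" "\<sigma> c = a \<or> \<sigma> c = c"
      using all[of "\<sigma> c"] c permutes_in_image[OF \<sigma>p] inj[of c a] by (auto simp: b_def)
    have "\<sigma> b = c"
    proof (rule ccontr)
      assume "\<sigma> b \<noteq> c"
      then have s: "\<sigma> b = a" "\<sigma> c = c"
        using \<sigma>b \<sigma>c inj[of b c] c by auto
      then have "[- 1 = 0] (mod int r)"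
        using const[OF diff[OF aA(1) c(1)], of a c] aA c by (simp add: b_def[symmetric])
      then show False using not1 by (simp only: cong_0_iff)
    qed
    then have "\<sigma> c = a"
      using \<sigma>c inj[of b c] c by auto
    then have "[- 2 = 1] (mod int r)"
      using const[OF diff[OF aA(1,2)], of a b] aA c \<open>\<sigma> b = c\<close> by (simp add: b_def[symmetric])
    then have "int r dvd 3"
      by (simp add: cong_iff_dvd_diff)
    then have "r dvd 3" by presburger
    then have "r \<le> 3" by (rule dvd_imp_le) simp
    then have "r = 1 \<or> r = 2 \<or> r = 3"
      using r_pos by linarith
    then have "r = 3"
      using \<open>r dvd 3\<close> r1 by auto
    then show ?thesis using 2 pr by simp
  next
    case 3
    then obtain k where k: "k \<in> {1..n}" "k \<noteq> a" "k \<noteq> b" "k \<noteq> e"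
      using four by auto
    then have ka: "\<sigma> k \<noteq> a"
      using inj[of k e] e by simp
    have "[- 1 = (if \<sigma> k = k then 0 else 1)] (mod int r)"
      using const[OF diff[OF aA(1) k(1)], of a k] aA k ka by (auto simp: b_def[symmetric])
    then have "int r dvd 2"
      using not1 by (auto simp: cong_iff_dvd_diff split: if_splits)
    then have "r dvd 2" by presburger
    then have "r \<le> 2" by (rule dvd_imp_le) simp
    then have "r = 2"
      using r1 r_pos by linarith
    then show ?thesis using 3 pr by simp
  next
    case 4
    then obtain k where k: "k \<in> {1..n}" "k \<noteq> a" "k \<noteq> b" "k \<noteq> e"
      using four by auto
    define l where "l = inv' \<sigma> k"
    have l: "\<sigma> l = k"
      using permutes_inverses(1)[OF \<sigma>p] by (simp add: l_def)
    \<comment> \<open>At a point outside \<open>a\<close>, \<open>k\<close> and their preimages,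
      \<open>e_a - e_k\<close> vanishes before and after \<open>\<sigma>\<close>, whereas the change
      at \<open>a\<close> is \<open>-1\<close>.\<close>
    obtain m where m: "m \<in> {1..n}" "m \<notin> set [a, k, e, l]"
      using ex_not_in_list[of "[a, k, e, l]" n] 4 by auto
    then have "\<sigma> m \<noteq> a" "\<sigma> m \<noteq> k"
      using inj[of m e] inj[of m l] e l by auto
    then have "[- 1 = 0] (mod int r)"
      using const[OF diff[OF aA(1) k(1)], of a m] aA k m by (simp add: b_def[symmetric])
    then show ?thesis using not1 by (simp only: cong_0_iff)
  qed
qed

text \<open>Permuting \<open>u\<close> is conjugation by \<open>\<pi>\<close>, and the diagonal
  subgroup is normal.\<close>

lemma diag_perm:
  assumes u: "good u" "snd (\<phi> (el u id)) = id" and \<pi>: "\<pi> permutes {1..n}"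
  shows "snd (\<phi> (el (\<lambda>i. u (\<pi> i)) id)) = id"
proof -
  let ?\<pi> = "el (\<lambda>_. 0) \<pi>"
  have G: "el u id \<in> carrier G" "el (\<lambda>i. u (\<pi> i)) id \<in> carrier G" "?\<pi> \<in> carrier G"
    using u(1) \<pi> by (simp_all add: permutes_id sum_perm)
  obtain x where x: "\<phi> (el u id) = el x id"
    using phi_el[OF G(1)] u(2) by (metis snd_wr)
  obtain w \<sigma> where w: "\<phi> ?\<pi> = el w \<sigma>" "\<sigma> permutes {1..n}"
    using phi_el[OF G(3)] .
  obtain y \<tau> where y: "\<phi> (el (\<lambda>i. u (\<pi> i)) id) = el y \<tau>" "\<tau> permutes {1..n}"
    using phi_el[OF G(2)] .
  have "el u id \<otimes>\<^bsub>W\<^esub> ?\<pi> = ?\<pi> \<otimes>\<^bsub>W\<^esub> el (\<lambda>i. u (\<pi> i)) id"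
    using el_mult[OF permutes_id \<pi>] el_mult[OF \<pi> permutes_id]
    by (simp only: comp_id id_comp id_apply add_0 add_0_right)
  then have "el x id \<otimes>\<^bsub>W\<^esub> el w \<sigma> = el w \<sigma> \<otimes>\<^bsub>W\<^esub> el y \<tau>"
    using phi_mult[OF G(1,3)] phi_mult[OF G(3,2)] by (simp only: x y w)
  then have "\<sigma> \<circ> \<tau> = \<sigma>"
    using el_mult[OF permutes_id w(2)] el_mult[OF w(2) y(2)] by (simp add: wr_eq_iff)
  then have "\<tau> = id"
    using fun_cong[of "\<sigma> \<circ> \<tau>" \<sigma>] inj_eq[OF permutes_inj[OF w(2)]] by (auto simp: fun_eq_iff)
  then show ?thesis using y by simp
qed

lemma diag_subgroup: "subgroup {g \<in> carrier G. snd g = id \<and> snd (\<phi> g) = id} W"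
proof (rule W.subgroupI)
  interpret group_hom G G \<phi>
    using phi_hom by unfold_locales
  have snd_inv: "snd (inv\<^bsub>W\<^esub> g) = id" if g: "g \<in> carrier W" "snd g = id" for g
  proof -
    from g(1) obtain f \<pi> where "g = el f \<pi>" "\<pi> permutes {1..n}" by (rule el_cases)
    then show ?thesis using g(2) by (simp add: el_inv inv_id)
  qed
  have snd_mult: "snd (g \<otimes>\<^bsub>W\<^esub> h) = id" if "g \<in> carrier W" "snd g = id" "h \<in> carrier W" "snd h = id" for g h
  proof -
    from that(1) obtain f \<pi> where f: "g = el f \<pi>" "\<pi> permutes {1..n}" by (rule el_cases)
    from that(3) obtain f' \<pi>' where f': "h = el f' \<pi>'" "\<pi>' permutes {1..n}" by (rule el_cases)
    show ?thesis using f f' that by (simp add: el_mult)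
  qed
  let ?H = "{g \<in> carrier G. snd g = id \<and> snd (\<phi> g) = id}"
  show "?H \<subseteq> carrier W"
    using G_subset by auto
  have "\<one>\<^bsub>W\<^esub> \<in> ?H"
    using hom_one G.one_closed by (simp add: el_one del: el_G_iff)
  then show "?H \<noteq> {}" by blast
  show "inv\<^bsub>W\<^esub> g \<in> ?H" if g: "g \<in> ?H" for g
  proof -
    have "\<phi> (inv\<^bsub>W\<^esub> g) = inv\<^bsub>W\<^esub> (\<phi> g)" "inv\<^bsub>W\<^esub> g \<in> carrier G"
      using g hom_inv[of g] G_inv[of g] G_inv[of "\<phi> g"] phi_closed G.inv_closed[of g] by simp_all
    then show ?thesis
      using g snd_inv[of g] snd_inv[of "\<phi> g"] subsetD[OF G_subset, of g]
        subsetD[OF G_subset, of "\<phi> g"] phi_closed[of g] by simp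
  qed
  show "g \<otimes>\<^bsub>W\<^esub> h \<in> ?H" if g: "g \<in> ?H" and h: "h \<in> ?H" for g h
    using g h snd_mult[of g h] snd_mult[of "\<phi> g" "\<phi> h"] phi_closed[of g] phi_closed[of h]
      subsetD[OF G_subset, of g] subsetD[OF G_subset, of h] subsetD[OF G_subset, of "\<phi> g"]
      subsetD[OF G_subset, of "\<phi> h"] phi_mult[of g h] G.m_closed[of g h] by simp
qed

lemma diag_autoI:
  assumes n: "n > 0"
    and root: "\<And>b. 2 \<le> b \<Longrightarrow> b \<le> n \<Longrightarrow> snd (\<phi> (el (\<lambda>i. unit b i - unit 1 i) id)) = id"
    and t: "snd (\<phi> (el (\<lambda>i. int p * unit 1 i) id)) = id"
  shows "grpn_diag_auto r n p \<phi>"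
proof unfold_locales
  fix f :: "nat \<Rightarrow> int" assume f: "good f"
  have "el f id \<in> {g \<in> carrier G. snd g = id \<and> snd (\<phi> g) = id}"
  proof (rule diag_generated[OF n diag_subgroup _ _ f])
    show "el (\<lambda>i. unit b i - unit 1 i) id \<in> {g \<in> carrier G. snd g = id \<and> snd (\<phi> g) = id}"
      if "2 \<le> b" "b \<le> n" for b
      using that root n by (simp add: permutes_id sum_subtractf)
    show "el (\<lambda>i. int p * unit 1 i) id \<in> {g \<in> carrier G. snd g = id \<and> snd (\<phi> g) = id}"
      using t n by (simp add: permutes_id flip: sum_distrib_left)
  qed
  then show "snd (\<phi> (el f id)) = id" by simp
qed

text \<open>For \<open>p = r\<close> the generator \<open>p e_1\<close> is trivial, and the
  remaining generators are permuted copies of a single root.\<close>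

lemma diag_autoI_root:
  assumes n: "n > 1" and p: "p = r"
    and ab: "a \<in> {1..n}" "b \<in> {1..n}" "a \<noteq> b" "snd (\<phi> (el (\<lambda>i. unit a i - unit b i) id)) = id"
  shows "grpn_diag_auto r n p \<phi>"
proof (rule diag_autoI)
  show "snd (\<phi> (el (\<lambda>i. unit c i - unit 1 i) id)) = id" if c: "2 \<le> c" "c \<le> n" for c
  proof -
    obtain \<pi> where \<pi>: "\<pi> permutes {1..n}" "\<pi> c = a" "\<pi> 1 = b"
      using permutes_two_points[of c "{1..n}" 1 a b] ab c by auto
    have inj: "\<pi> x = \<pi> y \<longleftrightarrow> x = y" for x y
      using permutes_inj[OF \<pi>(1)] by (rule inj_eq)
    have "(\<lambda>i. unit a (\<pi> i) - unit b (\<pi> i)) = (\<lambda>i. unit c i - unit 1 i)"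
      using inj[of _ c] inj[of _ 1] \<pi> by (intro ext) simp
    then show ?thesis
      using diag_perm[OF _ ab(4) \<pi>(1)] ab(1,2) by (simp add: sum_subtractf)
  qed
  interpret group_hom G G \<phi>
    using phi_hom by unfold_locales
  have "el (\<lambda>i. int p * unit 1 i) id = \<one>\<^bsub>W\<^esub>"
    using p by (simp add: el_one wr_eq_iff cong_0_iff)
  then show "snd (\<phi> (el (\<lambda>i. int p * unit 1 i) id)) = id"
    using hom_one by (simp add: el_one)
qed (use n in simp)

end

section \<open>Automorphisms given by generators\<close>

text \<open>The elements on which two homomorphisms agree form a subgroup; off the carrier
  extensionality settles equality.\<close>

lemma aut_of_eqI:
  assumes "group G"
    and gen: "\<And>H. subgroup H G \<Longrightarrow> fst ` set ps \<subseteq> H \<Longrightarrow> carrier G \<subseteq> H"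
    and closed: "fst ` set ps \<subseteq> carrier G"
    and \<phi>: "\<phi> \<in> auto G" "\<And>a b. (a, b) \<in> set ps \<Longrightarrow> \<phi> a = b"
  shows "aut_of G ps = \<phi>"
  unfolding aut_of_def
proof (rule the_equality)
  interpret group G by fact
  fix \<psi> assume \<psi>: "\<psi> \<in> auto G \<and> (\<forall>(a, b)\<in>set ps. \<psi> a = b)"
  interpret f: group_hom G G \<phi>
    using \<phi>(1) by unfold_locales (simp add: auto_def)
  interpret g: group_hom G G \<psi>
    using \<psi> by unfold_locales (simp add: auto_def)
  have "carrier G \<subseteq> {x \<in> carrier G. \<phi> x = \<psi> x}"
  proof (rule gen)
    show "subgroup {x \<in> carrier G. \<phi> x = \<psi> x} G"
      by (rule subgroupI) auto
    show "fst ` set ps \<subseteq> {x \<in> carrier G. \<phi> x = \<psi> x}"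
      using closed \<phi>(2) \<psi> by force
  qed
  then show "\<psi> = \<phi>"
    using \<phi>(1) \<psi> by (intro extensionalityI[of _ "carrier G"]) (auto simp: auto_def Bij_def)
qed (use \<phi> in auto)

text \<open>\<open>Q\<close> acts as a subgroup of G x G containing the prescribed pairs.
  \<open>Q_one_left\<close> makes it single-valued, \<open>gen_fst\<close> defined everywhere and
  \<open>gen_snd\<close> onto, so that it is the graph of an automorphism.\<close>

locale generator_relation = group G for G (structure) +
  fixes Q :: "'a \<Rightarrow> 'a \<Rightarrow> bool" and ps :: "('a \<times> 'a) list"
  assumes finite: "finite (carrier G)"
    and Q_closed: "\<And>g h. Q g h \<Longrightarrow> g \<in> carrier G \<and> h \<in> carrier G"
    and Q_one: "Q \<one> \<one>"
    and Q_mult: "\<And>g h g' h'. Q g h \<Longrightarrow> Q g' h' \<Longrightarrow> Q (g \<otimes> g') (h \<otimes> h')"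
    and Q_one_left: "\<And>h. Q \<one> h \<Longrightarrow> h = \<one>"
    and Q_gens: "\<And>a b. (a, b) \<in> set ps \<Longrightarrow> Q a b"
    and gen_fst: "\<And>H. subgroup H G \<Longrightarrow> fst ` set ps \<subseteq> H \<Longrightarrow> carrier G \<subseteq> H"
    and gen_snd: "\<And>H. subgroup H G \<Longrightarrow> snd ` set ps \<subseteq> H \<Longrightarrow> carrier G \<subseteq> H"
begin

text \<open>In a finite group inverses are powers, so closure under products suffices.\<close>

lemma Q_inv:
  assumes "Q g h"
  shows "Q (inv g) (inv h)"
proof -
  have pow: "Q (g [^] k) (h [^] k)" for k :: nat
    by (induction k) (use Q_one Q_mult assms in auto)
  have inv: "inv x = x [^] (order G - 1)" if "x \<in> carrier G" for x
  proof (rule inv_equality)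
    have "x [^] (order G - 1) \<otimes> x = x [^] order G"
      using finite order_gt_0_iff_finite by (simp flip: nat_pow_Suc)
    then show "x [^] (order G - 1) \<otimes> x = \<one>"
      using that pow_order_eq_1 by simp
  qed (use that in simp_all)
  show ?thesis
    using pow[of "order G - 1"] Q_closed[OF assms] inv by simp
qed

lemma Q_ex1:
  assumes "g \<in> carrier G"
  shows "\<exists>!h. Q g h"
proof -
  have "carrier G \<subseteq> {g \<in> carrier G. \<exists>h. Q g h}"
  proof (rule gen_fst)
    show "subgroup {g \<in> carrier G. \<exists>h. Q g h} G"
      by (rule subgroupI) (use Q_one Q_mult Q_inv in \<open>auto, blast+\<close>)
    show "fst ` set ps \<subseteq> {g \<in> carrier G. \<exists>h. Q g h}"
      using Q_gens Q_closed by fastforce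
  qed
  then obtain h where h: "Q g h"
    using assms by auto
  have "h' = h" if "Q g h'" for h'
  proof -
    have "Q (inv g \<otimes> g) (inv h \<otimes> h')"
      using Q_mult[OF Q_inv[OF h] that] .
    then have "inv h \<otimes> h' = \<one>"
      using Q_one_left assms by simp
    then show ?thesis
      using Q_closed[OF h] Q_closed[OF that] by (metis inv_closed inv_equality inv_inv inv_comm)
  qed
  then show ?thesis using h by blast
qed

lemma aut_of_correct: "aut_of G ps \<in> auto G \<and> (\<forall>(a, b)\<in>set ps. aut_of G ps a = b)"
proof -
  define \<phi> where "\<phi> = (\<lambda>g\<in>carrier G. THE h. Q g h)"
  have Q\<phi>: "Q g (\<phi> g)" if "g \<in> carrier G" for g
    using theI'[OF Q_ex1[OF that]] that by (simp add: \<phi>_def)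
  have \<phi>_eq: "\<phi> g = h" if "Q g h" for g h
    using Q_ex1[of g] Q\<phi>[of g] Q_closed[OF that] that by blast
  have hom: "\<phi> \<in> hom G G"
    using Q\<phi> Q_closed by (intro homI \<phi>_eq Q_mult) blast+
  interpret h: group_hom G G \<phi>
    using hom by unfold_locales
  have "carrier G \<subseteq> \<phi> ` carrier G"
  proof (rule gen_snd)
    show "subgroup (\<phi> ` carrier G) G"
      by (rule h.img_is_subgroup)
    show "snd ` set ps \<subseteq> \<phi> ` carrier G"
      using Q_gens Q_closed \<phi>_eq by force
  qed
  then have surj: "\<phi> ` carrier G = carrier G"
    using h.hom_closed by blast
  then have "\<phi> \<in> auto G"
    using hom finite eq_card_imp_inj_on[of "carrier G" \<phi>]
    by (auto simp: auto_def Bij_def bij_betw_def \<phi>_def)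
  moreover have "\<phi> a = b" if "(a, b) \<in> set ps" for a b
    using \<phi>_eq Q_gens that by blast
  moreover have "aut_of G ps = \<phi>"
  proof (rule aut_of_eqI[OF is_group gen_fst])
    show "fst ` set ps \<subseteq> carrier G"
      using Q_gens Q_closed by force
  qed (use calculation in simp_all)
  ultimately show ?thesis by auto
qed

end

context grpn
begin

lemma W_subgroup: "subgroup H G \<Longrightarrow> subgroup H W"
  using W.incl_subgroup[OF G_subgroup] G_eq by metis

lemma el_perm_generated:
  assumes H: "subgroup H W" and s: "\<And>i. 1 \<le> i \<Longrightarrow> i < n \<Longrightarrow> el (\<lambda>_. 0) (transpose i (i + 1)) \<in> H"
    and \<pi>: "\<pi> permutes {1..n}"
  shows "el (\<lambda>_. 0) \<pi> \<in> H"
  using \<pi>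
proof (induction rule: permutes_adjacent_induct)
  case id
  then show ?case
    using subgroup.one_closed[OF H] by (simp only: el_one)
next
  case (adj i \<pi>)
  have "transpose i (i + 1) permutes {1..n}"
    using adj by (intro permutes_swap_id) auto
  then have "el (\<lambda>_. 0) (\<pi> \<circ> transpose i (i + 1)) = el (\<lambda>_. 0) \<pi> \<otimes>\<^bsub>W\<^esub> el (\<lambda>_. 0) (transpose i (i + 1))"
    using adj(3) by (simp add: el_mult)
  also have "\<dots> \<in> H"
    using adj s by (intro subgroup.m_closed[OF H])
  finally show ?case .
qed

text \<open>Conjugating one root by permutations gives all roots, hence with \<open>p e_1\<close>
  the whole diagonal subgroup.\<close>

lemma generated:
  assumes H: "subgroup H W" and n: "n > 0"
    and s: "\<And>i. 1 \<le> i \<Longrightarrow> i < n \<Longrightarrow> el (\<lambda>_. 0) (transpose i (i + 1)) \<in> H"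
    and root: "n \<ge> 2 \<Longrightarrow> \<exists>a\<in>{1..n}. \<exists>b\<in>{1..n}. a \<noteq> b \<and> el (\<lambda>i. unit a i - unit b i) id \<in> H"
    and t: "el (\<lambda>i. int p * unit 1 i) id \<in> H"
  shows "carrier G \<subseteq> H"
proof
  fix g assume "g \<in> carrier G"
  then obtain f \<pi> where g: "g = el f \<pi>" "\<pi> permutes {1..n}" and f: "int p dvd (\<Sum>i = 1..n. f i)"
    by (rule G_cases)
  have perm: "el (\<lambda>_. 0) \<rho> \<in> H" if "\<rho> permutes {1..n}" for \<rho>
    using el_perm_generated[OF H _ that] s by blast
  have "el (\<lambda>i. unit d i - unit 1 i) id \<in> H" if d: "2 \<le> d" "d \<le> n" for d
  proof -
    have "n \<ge> 2" using d by simp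
    then obtain a b where ab: "a \<in> {1..n}" "b \<in> {1..n}" "a \<noteq> b" "el (\<lambda>i. unit a i - unit b i) id \<in> H"
      using root by blast
    obtain \<rho> where \<rho>: "\<rho> permutes {1..n}" "\<rho> d = a" "\<rho> 1 = b"
      using permutes_two_points[of d "{1..n}" 1 a b] d ab by auto
    have inj: "\<rho> x = \<rho> y \<longleftrightarrow> x = y" for x y
      using permutes_inj[OF \<rho>(1)] by (rule inj_eq)
    have eq: "(\<lambda>i. unit a (\<rho> i) - unit b (\<rho> i)) = (\<lambda>i. unit d i - unit 1 i)"
      using inj[of _ d] inj[of _ 1] \<rho> by (intro ext) simp
    have "el (\<lambda>_. 0) (inv' \<rho>) \<otimes>\<^bsub>W\<^esub> (el (\<lambda>i. unit a i - unit b i) id \<otimes>\<^bsub>W\<^esub> el (\<lambda>_. 0) \<rho>)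
      = el (\<lambda>i. unit a (\<rho> i) - unit b (\<rho> i)) (inv' \<rho> \<circ> \<rho>)"
      using el_mult[OF permutes_id \<rho>(1)] el_mult[OF permutes_inv[OF \<rho>(1)] \<rho>(1)]
      by (simp only: id_comp id_apply add_0 add_0_right)
    also have "\<dots> = el (\<lambda>i. unit d i - unit 1 i) id"
      by (simp only: eq permutes_inv_o[OF \<rho>(1)])
    finally show ?thesis
      using subgroup.m_closed[OF H perm[OF permutes_inv[OF \<rho>(1)]] subgroup.m_closed[OF H ab(4) perm[OF \<rho>(1)]]]
      by simp
  qed
  then have "el f id \<in> H"
    using diag_generated[OF n H _ t f] by blast
  then have "el (\<lambda>_. 0) \<pi> \<otimes>\<^bsub>W\<^esub> el f id \<in> H"
    using perm[OF g(2)] by (intro subgroup.m_closed[OF H])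
  then show "g \<in> H"
    using el_mult[OF g(2) permutes_id] g(1) by (simp only: comp_id id_apply add_0)
qed

end

text \<open>The monomial representation: \<open>G(r,p,n)\<close> acts from the right on functions \<open>v\<close> by
  \<open>(v \<cdot> (x, \<pi>)) i = \<omega>\<^bsup>x i\<^esup> v (\<pi> i)\<close>, where \<open>\<omega>\<close> is a primitive \<open>r\<close>-th root of unity. An
  automorphism of \<open>G(r,p,n)\<close> that becomes inner in this representation is conjugation by \<open>T\<close>.\<close>

locale monomial = grpn +
  fixes \<omega> :: complex and T T' :: "(nat \<Rightarrow> complex) \<Rightarrow> nat \<Rightarrow> complex" and c :: complex
    and ps :: "(((nat \<Rightarrow> int) \<times> (nat \<Rightarrow> nat)) \<times> (nat \<Rightarrow> int) \<times> (nat \<Rightarrow> nat)) list"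
  assumes \<omega>: "\<omega> \<noteq> 0" "\<And>k. \<omega> powi k = 1 \<longleftrightarrow> int r dvd k"
    and T_cong: "\<And>v w i. (\<And>i. i \<in> {1..n} \<Longrightarrow> v i = w i) \<Longrightarrow> i \<in> {1..n} \<Longrightarrow> T v i = T w i"
    and TT': "\<And>v i. i \<in> {1..n} \<Longrightarrow> T (T' v) i = c * v i" and c: "c \<noteq> 0"
begin

definition act where "act g v i = \<omega> powi (fst g i) * v (snd g i)" for g :: "(nat \<Rightarrow> int) \<times> (nat \<Rightarrow> nat)" and v :: "nat \<Rightarrow> complex" and i :: nat

lemma powi_cong: "[a = b] (mod int r) \<Longrightarrow> \<omega> powi a = \<omega> powi b"
  using \<omega>(2)[of "a - b"] \<omega>(1) by (simp add: power_int_diff cong_iff_dvd_diff)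

lemma act_el: "i \<in> {1..n} \<Longrightarrow> act (el f \<pi>) v i = \<omega> powi (f i) * v (\<pi> i)"
  using powi_cong[of "f i mod int r" "f i"] by (simp add: act_def wr_def)

lemma act_mult:
  assumes "g \<in> carrier G" "h \<in> carrier G" "i \<in> {1..n}"
  shows "act (g \<otimes>\<^bsub>W\<^esub> h) v i = act h (act g v) i"
proof -
  obtain f \<pi> where g: "g = el f \<pi>" "\<pi> permutes {1..n}" using assms(1) by (rule G_cases)
  obtain f' \<sigma> where h: "h = el f' \<sigma>" "\<sigma> permutes {1..n}" using assms(2) by (rule G_cases)
  have "\<sigma> i \<in> {1..n}"
    using permutes_in_image[OF h(2)] assms(3) by simp
  then show ?thesis
    unfolding g(1) h(1) el_mult[OF g(2) h(2)] act_el[OF assms(3)]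
    using \<omega>(1) by (simp add: act_el power_int_add)
qed

definition Q where "Q g h \<longleftrightarrow> g \<in> carrier G \<and> h \<in> carrier G \<and> (\<forall>v. \<forall>i\<in>{1..n}. T (act g v) i = act h (T v) i)"

lemma aut_of_correct:
  assumes Q_gens: "\<And>a b. (a, b) \<in> set ps \<Longrightarrow> Q a b"
    and gen_fst: "\<And>H. subgroup H W \<Longrightarrow> fst ` set ps \<subseteq> H \<Longrightarrow> carrier G \<subseteq> H"
    and gen_snd: "\<And>H. subgroup H W \<Longrightarrow> snd ` set ps \<subseteq> H \<Longrightarrow> carrier G \<subseteq> H"
  shows "aut_of G ps \<in> auto G \<and> (\<forall>(a, b)\<in>set ps. aut_of G ps a = b)"
proof -
  have snd_in: "snd g i \<in> {1..n}" if "g \<in> carrier G" "i \<in> {1..n}" for g i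
  proof -
    from that(1) obtain f \<pi> where "g = el f \<pi>" "\<pi> permutes {1..n}" by (rule G_cases)
    then show ?thesis using permutes_in_image[of \<pi> "{1..n}"] that(2) by simp
  qed
  have act_cong: "act g v i = act g w i" if "g \<in> carrier G" "i \<in> {1..n}" "\<And>i. i \<in> {1..n} \<Longrightarrow> v i = w i" for g v w i
    using that snd_in[of g i] by (simp add: act_def)
  have act_one: "act \<one>\<^bsub>W\<^esub> v i = v i" if "i \<in> {1..n}" for v i
    using act_el[OF that, of "\<lambda>_. 0" id v] by (simp only: el_one power_int_0_right mult_1 id_apply)
  have "generator_relation G Q ps"
  proof (unfold_locales, goal_cases)
    case 1
    show ?case by (rule G_finite)
  next
    case (2 g h)
    then show ?case by (simp add: Q_def)
  next
    case 3
    show ?case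
      unfolding Q_def G_one using act_one T_cong[of "act \<one>\<^bsub>W\<^esub> _"] G.one_closed by simp
  next
    case (4 g h g' h')
    then have G: "g \<in> carrier G" "h \<in> carrier G" "g' \<in> carrier G" "h' \<in> carrier G"
      by (simp_all add: Q_def)
    have "T (act (g \<otimes>\<^bsub>W\<^esub> g') v) i = act (h \<otimes>\<^bsub>W\<^esub> h') (T v) i" if i: "i \<in> {1..n}" for v i
    proof -
      have "T (act (g \<otimes>\<^bsub>W\<^esub> g') v) i = T (act g' (act g v)) i"
        using act_mult[OF G(1,3)] i by (intro T_cong)
      also have "\<dots> = act h' (T (act g v)) i"
        using 4(2) i by (simp add: Q_def)
      also have "\<dots> = act h' (act h (T v)) i"
        using 4(1) by (intro act_cong G i) (simp add: Q_def)
      also have "\<dots> = act (h \<otimes>\<^bsub>W\<^esub> h') (T v) i"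
        using act_mult[OF G(2,4) i] by simp
      finally show ?thesis .
    qed
    then show ?case
      using G G.m_closed by (simp add: Q_def)
  next
    case (5 h)
    then have h: "h \<in> carrier G" and *: "\<And>v i. i \<in> {1..n} \<Longrightarrow> T (act \<one>\<^bsub>W\<^esub> v) i = act h (T v) i"
      by (simp_all add: Q_def)
    obtain f \<pi> where f: "h = el f \<pi>" "\<pi> permutes {1..n}"
      using h by (rule G_cases)
    \<comment> \<open>\<open>T\<close> is onto on \<open>{1..n}\<close> because \<open>T T'\<close>
      is a nonzero scalar, so \<open>h\<close> fixes every function. Indicator functions then show
      that \<open>\<pi>\<close> is trivial, and constants that the powers of \<open>\<omega>\<close>
      are.\<close>
    have fixed: "\<omega> powi (f i) * v (\<pi> i) = v i" if i: "i \<in> {1..n}" for v i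
    proof -
      have "T (T' v) i = act h (T (T' v)) i"
        using *[OF i] T_cong[OF act_one i] by simp
      also have "\<dots> = act h (\<lambda>i. c * v i) i"
        using TT' by (intro act_cong h i)
      finally have "c * v i = c * (\<omega> powi (f i) * v (\<pi> i))"
        using act_el[OF i] TT'[OF i] f by simp
      then show ?thesis using c by simp
    qed
    have "\<pi> i = i \<and> int r dvd f i" if i: "i \<in> {1..n}" for i
    proof -
      have "\<pi> i = i"
        using fixed[OF i, of "\<lambda>j. if j = i then 1 else 0"] by (auto split: if_splits)
      then have "\<omega> powi (f i) = 1"
        using fixed[OF i, of "\<lambda>_. 1"] by simp
      then show ?thesis
        using \<omega>(2) \<open>\<pi> i = i\<close> by simp
    qed
    moreover from this have "\<pi> = id"
      using permutes_not_in[OF f(2)] by (intro ext) (metis id_apply)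
    ultimately show ?case
      by (simp add: f(1) el_one wr_eq_iff cong_0_iff)
  next
    case (6 a b)
    then show ?case by (rule Q_gens)
  next
    case (7 H)
    then show ?case using gen_fst W_subgroup by blast
  next
    case (8 H)
    then show ?case using gen_snd W_subgroup by blast
  qed
  then show ?thesis
    by (rule generator_relation.aut_of_correct)
qed

end

section \<open>Existence of the exceptional automorphisms\<close>

lemma atLeastAtMost_numerals:
  "{1..2} = {1, 2 :: nat}" "{1..3} = {1, 2, 3 :: nat}" "{1..4} = {1, 2, 3, 4 :: nat}"
  by auto

lemma primitive_root_powi:
  fixes \<omega> :: complex
  assumes "r > 0" "\<omega> ^ r = 1" "\<And>k. 0 < k \<Longrightarrow> k < r \<Longrightarrow> \<omega> ^ k \<noteq> 1"
  shows "\<omega> \<noteq> 0" "\<omega> powi k = 1 \<longleftrightarrow> int r dvd k"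
proof -
  show \<omega>: "\<omega> \<noteq> 0"
    using assms(1,2) by (auto simp: zero_power)
  have "\<omega> powi k = \<omega> powi (int r * (k div int r) + k mod int r)"
    by simp
  also have "\<dots> = (\<omega> powi int r) powi (k div int r) * \<omega> powi (k mod int r)"
    using \<omega> by (subst power_int_add) (simp_all only: power_int_mult simp_thms)
  also have "\<dots> = \<omega> ^ nat (k mod int r)"
    using assms(1,2) by (simp add: power_int_def)
  finally have eq: "\<omega> powi k = \<omega> ^ nat (k mod int r)" .
  have "0 \<le> k mod int r" "k mod int r < int r"
    using assms(1) by simp_all
  then show "\<omega> powi k = 1 \<longleftrightarrow> int r dvd k"
    unfolding eq using assms(3)[of "nat (k mod int r)"]
    by (cases "k mod int r = 0") (auto simp: dvd_eq_mod_eq_0 nat_less_iff)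
qed

context grpn
begin

lemma gen_s'_el: "gen_s' r n i = el (\<lambda>m. unit i m - unit (i + 1) m) (transpose i (i + 1))"
  unfolding gen_s'_def by (rule root_vec_el)

lemma elt_s_el: "elt_s r n = el (\<lambda>m. unit 1 m - unit 2 m) id"
  unfolding elt_s_def by (simp only: root_vec_el one_add_one)

lemma gen_s_mult_gen_s':
  assumes "1 \<le> i" "i < n"
  shows "gen_s r n i \<otimes>\<^bsub>W\<^esub> gen_s' r n i = el (\<lambda>m. unit i m - unit (i + 1) m) id"
proof -
  have "transpose i (i + 1) permutes {1..n}"
    using assms by (intro permutes_swap_id) auto
  then show ?thesis
    unfolding gen_s_el gen_s'_el by (simp only: el_mult transpose_comp_involutory add_0)
qed

lemma generated_reflections:
  assumes pr: "p = r" and H: "subgroup H W" and n: "n > 0" and i: "1 \<le> i" "i < n"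
    and s: "\<And>i. 1 \<le> i \<Longrightarrow> i < n \<Longrightarrow> gen_s r n i \<in> H" and s': "gen_s' r n i \<in> H"
  shows "carrier G \<subseteq> H"
proof (rule generated[OF H n])
  show "\<exists>a\<in>{1..n}. \<exists>b\<in>{1..n}. a \<noteq> b \<and> el (\<lambda>i. unit a i - unit b i) id \<in> H"
    using subgroup.m_closed[OF H s[OF i] s'] gen_s_mult_gen_s'[OF i] i
    by (intro bexI[of _ i] bexI[of _ "i + 1"]) auto
  have "el (\<lambda>i. int p * unit 1 i) id = \<one>\<^bsub>W\<^esub>"
    unfolding el_one by (intro wr_eqI) (simp add: pr cong_0_iff)
  then show "el (\<lambda>i. int p * unit 1 i) id \<in> H"
    using subgroup.one_closed[OF H] by simp
qed (use s in \<open>simp add: gen_s_el\<close>)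

end

text \<open>The rows of \<open>T\<close> are eigenvectors of the coordinate swap, so
  \<open>T\<close> exchanges the swap with the sign change of the first coordinate. Its square is 2,
  whence it is also \<open>T'\<close>.\<close>

lemma eta_2_1_2:
  "eta 2 1 2 \<in> auto (Grpn 2 1 2)"
  "eta 2 1 2 (gen_s 2 2 1) = elt_t 2 2" "eta 2 1 2 (elt_t 2 2) = gen_s 2 2 1"
proof -
  define ps where "ps = [(gen_s 2 2 1, elt_t 2 2), (elt_t 2 2, gen_s 2 2 1)]"
  define T :: "(nat \<Rightarrow> complex) \<Rightarrow> nat \<Rightarrow> complex"
    where "T v i = (if i = 1 then v 1 - v 2 else - v 1 - v 2)" for v i
  interpret monomial 2 2 1 "- 1" T T 2 ps
  proof unfold_locales
    show "(- 1 :: complex) powi k = 1 \<longleftrightarrow> int 2 dvd k" for k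
      by (rule primitive_root_powi) (auto simp: less_Suc_eq numeral_2_eq_2)
  qed (auto simp: T_def atLeastAtMost_numerals)
  have t: "transpose 1 2 permutes {1..2::nat}"
    by (intro permutes_swap_id) auto
  have gens: "carrier G \<subseteq> H" if H: "subgroup H W" "gen_s 2 2 1 \<in> H" "elt_t 2 2 \<in> H" for H
  proof (rule generated[OF H(1)])
    have "el (\<lambda>m. unit 1 m - unit 2 m) id = elt_t 2 2 \<otimes>\<^bsub>W\<^esub> (gen_s 2 2 1 \<otimes>\<^bsub>W\<^esub> (elt_t 2 2 \<otimes>\<^bsub>W\<^esub> gen_s 2 2 1))"
      using t by (auto simp: elt_t_el gen_s_el el_mult permutes_id wr_eq_iff atLeastAtMost_numerals cong_def)
    then have "el (\<lambda>m. unit 1 m - unit 2 m) id \<in> H"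
      using H by (simp add: subgroup.m_closed)
    then show "\<exists>a\<in>{1..2}. \<exists>b\<in>{1..2}. a \<noteq> b \<and> el (\<lambda>i. unit a i - unit b i) id \<in> H"
      by (intro bexI[of _ 1] bexI[of _ 2]) auto
    show "el (\<lambda>_. 0) (transpose i (i + 1)) \<in> H" if "1 \<le> i" "i < 2" for i
    proof -
      have "i = 1" using that by simp
      then show ?thesis using H(2) by (simp only: gen_s_el)
    qed
  qed (use H(3) in \<open>simp_all add: elt_t_el\<close>)
  have "aut_of G ps \<in> auto G \<and> (\<forall>(a, b)\<in>set ps. aut_of G ps a = b)"
  proof (rule aut_of_correct)
    show "Q a b" if "(a, b) \<in> set ps" for a b
      using that t by (auto simp: ps_def Q_def gen_s_el elt_t_el act_el T_def atLeastAtMost_numerals permutes_id)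
  qed (use gens in \<open>simp_all add: ps_def\<close>)
  moreover have "eta 2 1 2 = aut_of G ps"
    by (simp add: eta_def ps_def Let_def)
  ultimately show "eta 2 1 2 \<in> auto G"
    "eta 2 1 2 (gen_s 2 2 1) = elt_t 2 2" "eta 2 1 2 (elt_t 2 2) = gen_s 2 2 1"
    by (simp_all add: ps_def)
qed

text \<open>In the monomial representation \<open>s_1\<close>, \<open>s_1'\<close> and
  \<open>t^2\<close> are the three Pauli matrices up to sign, and \<open>T\<close> permutes them
  cyclically.\<close>

lemma eta_4_2_2:
  "eta 4 2 2 \<in> auto (Grpn 4 2 2)"
  "eta 4 2 2 (gen_s 4 2 1) = elt_t 4 2 [^]\<^bsub>wreath 4 2\<^esub> (2::nat)"
  "eta 4 2 2 (gen_s' 4 2 1) = gen_s 4 2 1"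
  "eta 4 2 2 (elt_t 4 2 [^]\<^bsub>wreath 4 2\<^esub> (2::nat)) = gen_s' 4 2 1"
proof -
  let ?t = "elt_t 4 2 [^]\<^bsub>wreath 4 2\<^esub> (2::nat)"
  define ps where "ps = [(gen_s 4 2 1, ?t), (gen_s' 4 2 1, gen_s 4 2 1), (?t, gen_s' 4 2 1)]"
  define T :: "(nat \<Rightarrow> complex) \<Rightarrow> nat \<Rightarrow> complex"
    where "T v i = (if i = 1 then \<i> * (v 2 - v 1) else v 1 + v 2)" for v i
  define T' :: "(nat \<Rightarrow> complex) \<Rightarrow> nat \<Rightarrow> complex"
    where "T' v i = (if i = 1 then \<i> * v 1 + v 2 else v 2 - \<i> * v 1)" for v i
  interpret monomial 4 2 2 \<i> T T' 2 ps
  proof unfold_locales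
    show "\<i> powi k = 1 \<longleftrightarrow> int 4 dvd k" for k
    proof (rule primitive_root_powi)
      fix k :: nat assume "0 < k" "k < 4"
      then have "k = 1 \<or> k = 2 \<or> k = 3" by linarith
      then show "\<i> ^ k \<noteq> 1" by (auto simp: power3_eq_cube complex_eq_iff)
    qed simp_all
  qed (auto simp: T_def T'_def atLeastAtMost_numerals algebra_simps)
  have t: "transpose 1 2 permutes {1..2::nat}"
    by (intro permutes_swap_id) auto
  have t_el: "?t = el (\<lambda>i. 2 * unit 1 i) id"
    by (simp only: elt_t_el el_nat_pow of_nat_numeral)
  have gens: "carrier G \<subseteq> H" if H: "subgroup H W" "gen_s 4 2 1 \<in> H" "gen_s' 4 2 1 \<in> H" "?t \<in> H" for H
  proof (rule generated[OF H(1)])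
    show "\<exists>a\<in>{1..2}. \<exists>b\<in>{1..2}. a \<noteq> b \<and> el (\<lambda>i. unit a i - unit b i) id \<in> H"
      using subgroup.m_closed[OF H(1-3)] gen_s_mult_gen_s'[of 1] by (intro bexI[of _ 1] bexI[of _ 2]) auto
    show "el (\<lambda>_. 0) (transpose i (i + 1)) \<in> H" if "1 \<le> i" "i < 2" for i
    proof -
      have "i = 1" using that by simp
      then show ?thesis using H(2) by (simp only: gen_s_el)
    qed
  qed (use H(4) in \<open>simp_all add: t_el\<close>)
  have "aut_of G ps \<in> auto G \<and> (\<forall>(a, b)\<in>set ps. aut_of G ps a = b)"
  proof (rule aut_of_correct)
    show "Q a b" if "(a, b) \<in> set ps" for a b
      using that t by (auto simp: ps_def Q_def gen_s_el gen_s'_el t_el act_el T_def atLeastAtMost_numerals permutes_id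
          power_int_minus algebra_simps)
  qed (use gens in \<open>simp_all add: ps_def\<close>)
  moreover have "eta 4 2 2 = aut_of G ps"
    by (simp add: eta_def ps_def Let_def)
  ultimately show "eta 4 2 2 \<in> auto G"
    "eta 4 2 2 (gen_s 4 2 1) = ?t" "eta 4 2 2 (gen_s' 4 2 1) = gen_s 4 2 1" "eta 4 2 2 ?t = gen_s' 4 2 1"
    by (simp_all add: ps_def)
qed

text \<open>The quadratic relation is oriented so as to lower the degree in \<open>\<omega>\<close>;
  with it the simplifier decides the matrix identities.\<close>

lemma cube_root_of_unity:
  obtains \<omega> :: complex where "\<omega> * \<omega> = - 1 - \<omega>" "\<And>k. \<omega> powi k = 1 \<longleftrightarrow> int 3 dvd k" "inverse \<omega> = - 1 - \<omega>" "\<omega> \<noteq> 0"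
proof
  let ?w = "Complex (- 1 / 2) (sqrt 3 / 2)"
  show sq: "?w * ?w = - 1 - ?w"
    by (simp add: complex_eq_iff field_simps)
  then have cube: "?w * (?w * ?w) = 1"
    by (simp add: complex_eq_iff field_simps)
  have ne: "?w \<noteq> 1"
    by (simp add: complex_eq_iff)
  show "?w powi k = 1 \<longleftrightarrow> int 3 dvd k" for k
  proof (rule primitive_root_powi)
    fix k :: nat assume "0 < k" "k < 3"
    then have "k = 1 \<or> k = 2" by linarith
    then show "?w ^ k \<noteq> 1"
      using ne cube by (auto simp: power2_eq_square simp del: Complex_eq_1)
  qed (use cube in \<open>simp_all add: power3_eq_cube mult.assoc\<close>)
  show nz: "?w \<noteq> 0"
    by (simp add: complex_eq_iff)
  show "inverse ?w = - 1 - ?w"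
    using cube unfolding sq by (rule inverse_unique)
qed

text \<open>The entries of \<open>T\<close> are cube roots of unity, \<open>-1 - \<omega>\<close>
  being the square of \<open>\<omega>\<close>. Its rows are orthogonal, and \<open>T'\<close> is its
  conjugate transpose. It normalizes the Heisenberg group of order 27 formed by the elements over
  even permutations.\<close>

lemma eta_3_3_3:
  "eta 3 3 3 \<in> auto (Grpn 3 3 3)"
  "eta 3 3 3 (gen_s 3 3 1) = gen_s 3 3 2" "eta 3 3 3 (gen_s 3 3 2) = gen_s' 3 3 1"
  "eta 3 3 3 (gen_s' 3 3 1) = gen_s 3 3 1"
proof -
  obtain \<omega> :: complex where root: "\<omega> * \<omega> = - 1 - \<omega>" "\<And>k. \<omega> powi k = 1 \<longleftrightarrow> int 3 dvd k"
    "inverse \<omega> = - 1 - \<omega>" "\<omega> \<noteq> 0"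
    using cube_root_of_unity by blast
  have \<omega>': "\<omega> * (\<omega> * x) = - x - \<omega> * x" for x
    by (simp add: root(1) algebra_simps flip: mult.assoc)
  define ps where "ps = [(gen_s 3 3 1, gen_s 3 3 2), (gen_s 3 3 2, gen_s' 3 3 1), (gen_s' 3 3 1, gen_s 3 3 1)]"
  define T :: "(nat \<Rightarrow> complex) \<Rightarrow> nat \<Rightarrow> complex"
    where "T v i = (if i = 1 then \<omega> * v 1 + \<omega> * v 2 + v 3
      else if i = 2 then v 1 + (- 1 - \<omega>) * v 2 + v 3 else (- 1 - \<omega>) * v 1 + v 2 + v 3)" for v i
  define T' :: "(nat \<Rightarrow> complex) \<Rightarrow> nat \<Rightarrow> complex"
    where "T' v i = (if i = 1 then (- 1 - \<omega>) * v 1 + v 2 + \<omega> * v 3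
      else if i = 2 then (- 1 - \<omega>) * v 1 + \<omega> * v 2 + v 3 else v 1 + v 2 + v 3)" for v i
  interpret monomial 3 3 3 \<omega> T T' 3 ps
  proof unfold_locales
    show "T (T' v) i = 3 * v i" if "i \<in> {1..3}" for v i
      using that by (auto simp: atLeastAtMost_numerals T_def T'_def algebra_simps root(1) \<omega>')
  qed (use root in \<open>auto simp: T_def\<close>)
  have t: "transpose 1 2 permutes {1..3::nat}" "transpose 2 3 permutes {1..3::nat}"
    by (intro permutes_swap_id; simp)+
  have gens: "carrier G \<subseteq> H" if H: "subgroup H W" "gen_s 3 3 1 \<in> H" "gen_s 3 3 2 \<in> H" "gen_s' 3 3 1 \<in> H" for H
  proof (rule generated_reflections[OF refl H(1), of 1])
    show "gen_s 3 3 i \<in> H" if "1 \<le> i" "i < 3" for i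
    proof -
      have "i = 1 \<or> i = 2" using that by auto
      then show ?thesis using H by auto
    qed
  qed (use H in simp_all)
  have "aut_of G ps \<in> auto G \<and> (\<forall>(a, b)\<in>set ps. aut_of G ps a = b)"
  proof (rule aut_of_correct)
    show "Q a b" if "(a, b) \<in> set ps" for a b
      using that t by (auto simp: ps_def Q_def gen_s_el gen_s'_el act_el T_def atLeastAtMost_numerals
          algebra_simps root(1,3) \<omega>')
  qed (use gens in \<open>simp_all add: ps_def\<close>)
  moreover have "eta 3 3 3 = aut_of G ps"
    by (simp add: eta_def ps_def Let_def)
  ultimately show "eta 3 3 3 \<in> auto G"
    "eta 3 3 3 (gen_s 3 3 1) = gen_s 3 3 2" "eta 3 3 3 (gen_s 3 3 2) = gen_s' 3 3 1"
    "eta 3 3 3 (gen_s' 3 3 1) = gen_s 3 3 1"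
    by (simp_all add: ps_def)
qed

text \<open>\<open>T\<close> has equal diagonal entries and equal off-diagonal entries, so it
  commutes with permutation matrices and fixes \<open>s_1\<close> and \<open>s_2\<close>. Again
  \<open>T'\<close> is the conjugate transpose.\<close>

lemma eta'_3_3_3:
  "eta' 3 3 3 \<in> auto (Grpn 3 3 3)"
  "eta' 3 3 3 (gen_s 3 3 1) = gen_s 3 3 1" "eta' 3 3 3 (gen_s 3 3 2) = gen_s 3 3 2"
  "eta' 3 3 3 (gen_s' 3 3 1) = gen_s' 3 3 2"
proof -
  obtain \<omega> :: complex where root: "\<omega> * \<omega> = - 1 - \<omega>" "\<And>k. \<omega> powi k = 1 \<longleftrightarrow> int 3 dvd k"
    "inverse \<omega> = - 1 - \<omega>" "\<omega> \<noteq> 0"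
    using cube_root_of_unity by blast
  have \<omega>': "\<omega> * (\<omega> * x) = - x - \<omega> * x" for x
    by (simp add: root(1) algebra_simps flip: mult.assoc)
  define ps where "ps = [(gen_s 3 3 1, gen_s 3 3 1), (gen_s 3 3 2, gen_s 3 3 2), (gen_s' 3 3 1, gen_s' 3 3 2)]"
  define T :: "(nat \<Rightarrow> complex) \<Rightarrow> nat \<Rightarrow> complex"
    where "T v i = (if i = 1 then v 1 + \<omega> * v 2 + \<omega> * v 3
      else if i = 2 then \<omega> * v 1 + v 2 + \<omega> * v 3 else \<omega> * v 1 + \<omega> * v 2 + v 3)" for v i
  define T' :: "(nat \<Rightarrow> complex) \<Rightarrow> nat \<Rightarrow> complex"
    where "T' v i = (if i = 1 then v 1 + (- 1 - \<omega>) * (v 2 + v 3)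
      else if i = 2 then v 2 + (- 1 - \<omega>) * (v 1 + v 3) else v 3 + (- 1 - \<omega>) * (v 1 + v 2))" for v i
  interpret monomial 3 3 3 \<omega> T T' 3 ps
  proof unfold_locales
    show "T (T' v) i = 3 * v i" if "i \<in> {1..3}" for v i
      using that by (auto simp: atLeastAtMost_numerals T_def T'_def algebra_simps root(1) \<omega>')
  qed (use root in \<open>auto simp: T_def\<close>)
  have t: "transpose 1 2 permutes {1..3::nat}" "transpose 2 3 permutes {1..3::nat}"
    by (intro permutes_swap_id; simp)+
  have gens: "carrier G \<subseteq> H" if H: "subgroup H W" "gen_s 3 3 1 \<in> H" "gen_s 3 3 2 \<in> H"
    and i: "gen_s' 3 3 i \<in> H" "1 \<le> i" "i < 3" for H i
  proof (rule generated_reflections[OF refl H(1) _ i(2,3)])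
    show "gen_s 3 3 i \<in> H" if "1 \<le> i" "i < 3" for i
    proof -
      have "i = 1 \<or> i = 2" using that by auto
      then show ?thesis using H by auto
    qed
  qed (use i in simp_all)
  have "aut_of G ps \<in> auto G \<and> (\<forall>(a, b)\<in>set ps. aut_of G ps a = b)"
  proof (rule aut_of_correct)
    show "Q a b" if "(a, b) \<in> set ps" for a b
      using that t by (auto simp: ps_def Q_def gen_s_el gen_s'_el act_el T_def atLeastAtMost_numerals
          algebra_simps root(1,3) \<omega>')
  qed (use gens[of _ 1] gens[of _ 2] in \<open>simp_all add: ps_def\<close>)
  moreover have "eta' 3 3 3 = aut_of G ps"
    by (simp add: eta'_def ps_def Let_def)
  ultimately show "eta' 3 3 3 \<in> auto G"
    "eta' 3 3 3 (gen_s 3 3 1) = gen_s 3 3 1" "eta' 3 3 3 (gen_s 3 3 2) = gen_s 3 3 2"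
    "eta' 3 3 3 (gen_s' 3 3 1) = gen_s' 3 3 2"
    by (simp_all add: ps_def)
qed

text \<open>This is triality: the group is the Weyl group of type D4, \<open>s_2\<close> is the
  central node of the diagram, and the outer nodes are rotated. \<open>T\<close> is a Hadamard
  matrix of order 4 and \<open>T'\<close> its transpose.\<close>

lemma eta_2_2_4:
  "eta 2 2 4 \<in> auto (Grpn 2 2 4)"
  "eta 2 2 4 (gen_s 2 4 1) = gen_s' 2 4 1" "eta 2 2 4 (gen_s 2 4 2) = gen_s 2 4 2"
  "eta 2 2 4 (gen_s 2 4 3) = gen_s 2 4 1" "eta 2 2 4 (gen_s' 2 4 1) = gen_s 2 4 3"
proof -
  define ps where "ps = [(gen_s 2 4 1, gen_s' 2 4 1), (gen_s 2 4 2, gen_s 2 4 2),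
    (gen_s 2 4 3, gen_s 2 4 1), (gen_s' 2 4 1, gen_s 2 4 3)]"
  define T :: "(nat \<Rightarrow> complex) \<Rightarrow> nat \<Rightarrow> complex"
    where "T v i = (if i = 1 then - v 1 + v 2 + v 3 - v 4 else if i = 2 then - v 1 + v 2 - v 3 + v 4
      else if i = 3 then - v 1 - v 2 + v 3 + v 4 else v 1 + v 2 + v 3 + v 4)" for v i
  define T' :: "(nat \<Rightarrow> complex) \<Rightarrow> nat \<Rightarrow> complex"
    where "T' v i = (if i = 1 then - v 1 - v 2 - v 3 + v 4 else if i = 2 then v 1 + v 2 - v 3 + v 4
      else if i = 3 then v 1 - v 2 + v 3 + v 4 else - v 1 + v 2 + v 3 + v 4)" for v i
  interpret monomial 2 4 2 "- 1" T T' 4 ps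
  proof unfold_locales
    show "(- 1 :: complex) powi k = 1 \<longleftrightarrow> int 2 dvd k" for k
      by (rule primitive_root_powi) (auto simp: less_Suc_eq numeral_2_eq_2)
  qed (auto simp: T_def T'_def atLeastAtMost_numerals)
  have t: "transpose 1 2 permutes {1..4::nat}" "transpose 2 3 permutes {1..4::nat}" "transpose 3 4 permutes {1..4::nat}"
    by (intro permutes_swap_id; simp)+
  have gens: "carrier G \<subseteq> H" if H: "subgroup H W" "gen_s 2 4 1 \<in> H" "gen_s 2 4 2 \<in> H" "gen_s 2 4 3 \<in> H"
    "gen_s' 2 4 1 \<in> H" for H
  proof (rule generated_reflections[OF refl H(1), of 1])
    show "gen_s 2 4 i \<in> H" if "1 \<le> i" "i < 4" for i
    proof -
      have "i = 1 \<or> i = 2 \<or> i = 3" using that by auto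
      then show ?thesis using H by auto
    qed
  qed (use H in simp_all)
  have "aut_of G ps \<in> auto G \<and> (\<forall>(a, b)\<in>set ps. aut_of G ps a = b)"
  proof (rule aut_of_correct)
    show "Q a b" if "(a, b) \<in> set ps" for a b
      using that t by (auto simp: ps_def Q_def gen_s_el gen_s'_el act_el T_def atLeastAtMost_numerals)
  qed (use gens in \<open>simp_all add: ps_def\<close>)
  moreover have "eta 2 2 4 = aut_of G ps"
    by (simp add: eta_def ps_def Let_def)
  ultimately show "eta 2 2 4 \<in> auto G"
    "eta 2 2 4 (gen_s 2 4 1) = gen_s' 2 4 1" "eta 2 2 4 (gen_s 2 4 2) = gen_s 2 4 2"
    "eta 2 2 4 (gen_s 2 4 3) = gen_s 2 4 1" "eta 2 2 4 (gen_s' 2 4 1) = gen_s 2 4 3"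
    by (simp_all add: ps_def)
qed

text \<open>The monomial representation is of no help: \<open>elt_s\<close> acts as the scalar -1
  and \<open>gen_s 2 2 1\<close> does not, so nothing intertwines them. The group is the Klein
  four-group, and the graph of the automorphism is listed in full.\<close>

lemma eta_2_2_2:
  "eta 2 2 2 \<in> auto (Grpn 2 2 2)"
  "eta 2 2 2 (gen_s 2 2 1) = elt_s 2 2" "eta 2 2 2 (gen_s' 2 2 1) = gen_s 2 2 1"
  "eta 2 2 2 (elt_s 2 2) = gen_s' 2 2 1"
proof -
  interpret grpn 2 2 2
    by unfold_locales simp_all
  let ?a = "gen_s 2 2 1" and ?b = "gen_s' 2 2 1" and ?c = "elt_s 2 2"
  define ps where "ps = [(?a, ?c), (?b, ?a), (?c, ?b)]"
  define Q where "Q g h \<longleftrightarrow> (g, h) \<in> insert (\<one>\<^bsub>W\<^esub>, \<one>\<^bsub>W\<^esub>) (set ps)" for g h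
  have t: "transpose 1 2 permutes {1..2::nat}"
    by (intro permutes_swap_id) auto
  have tn: "transpose 1 2 \<noteq> (id :: nat \<Rightarrow> nat)"
    by (simp add: transpose_eq_id_iff)
  have mem: "\<one>\<^bsub>W\<^esub> \<in> carrier G" "?a \<in> carrier G" "?b \<in> carrier G" "?c \<in> carrier G"
    using t by (auto simp: el_one gen_s_el gen_s'_el elt_s_el permutes_id sum_subtractf)
  have memW: "?a \<in> carrier W" "?b \<in> carrier W" "?c \<in> carrier W"
    using mem G_subset by blast+
  have mult: "?a \<otimes>\<^bsub>W\<^esub> ?b = ?c" "?b \<otimes>\<^bsub>W\<^esub> ?a = ?c" "?b \<otimes>\<^bsub>W\<^esub> ?c = ?a" "?c \<otimes>\<^bsub>W\<^esub> ?b = ?a"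
    "?a \<otimes>\<^bsub>W\<^esub> ?c = ?b" "?c \<otimes>\<^bsub>W\<^esub> ?a = ?b"
    "?a \<otimes>\<^bsub>W\<^esub> ?a = \<one>\<^bsub>W\<^esub>" "?b \<otimes>\<^bsub>W\<^esub> ?b = \<one>\<^bsub>W\<^esub>" "?c \<otimes>\<^bsub>W\<^esub> ?c = \<one>\<^bsub>W\<^esub>"
    using t by (auto simp: el_one gen_s_el gen_s'_el elt_s_el el_mult permutes_id wr_eq_iff atLeastAtMost_numerals cong_def)
  have ne: "?a \<noteq> \<one>\<^bsub>W\<^esub>" "?b \<noteq> \<one>\<^bsub>W\<^esub>" "?c \<noteq> \<one>\<^bsub>W\<^esub>"
    using tn by (auto simp: el_one gen_s_el gen_s'_el elt_s_el wr_eq_iff atLeastAtMost_numerals cong_def)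
  have gens: "carrier G \<subseteq> H" if H: "subgroup H G" "?a \<in> H" "?b \<in> H" for H
  proof (rule generated_reflections[OF refl W_subgroup[OF H(1)], of 1])
    show "gen_s 2 2 i \<in> H" if "1 \<le> i" "i < 2" for i
    proof -
      have "i = 1" using that by auto
      then show ?thesis using H by simp
    qed
  qed (use H in simp_all)
  interpret generator_relation G Q ps
  proof (unfold_locales, goal_cases)
    case 1
    show ?case by (rule G_finite)
  next
    case (2 g h)
    then show ?case using mem by (auto simp: Q_def ps_def)
  next
    case 3
    show ?case by (simp add: Q_def)
  next
    case (4 g h g' h')
    then show ?case
      using mult memW unfolding Q_def ps_def by auto
  next
    case (5 h)
    then show ?case using ne by (auto simp: Q_def ps_def)
  next
    case (6 a b)
    then show ?case by (simp add: Q_def)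
  qed (use gens in \<open>simp_all add: ps_def\<close>)
  have "eta 2 2 2 = aut_of G ps"
    by (simp add: eta_def ps_def Let_def)
  with aut_of_correct show "eta 2 2 2 \<in> auto G"
    "eta 2 2 2 ?a = ?c" "eta 2 2 2 ?b = ?a" "eta 2 2 2 ?c = ?b"
    by (simp_all add: ps_def)
qed

text \<open>\<open>S\<^sub>6\<close> permutes the six synthematic totals, i.e. the partitions of the fifteen
  two-element subsets of \<open>{1..6}\<close> into five perfect matchings. The outer automorphism is this
  action; the totals are numbered so that it takes the prescribed values on the generators.\<close>

definition total :: "nat \<Rightarrow> nat set set set" where
  "total i = (
    if i = 1 then {{{1,2},{3,4},{5,6}}, {{1,3},{2,5},{4,6}}, {{1,4},{2,6},{3,5}}, {{1,5},{2,4},{3,6}}, {{1,6},{2,3},{4,5}}}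
    else if i = 2 then {{{1,2},{3,4},{5,6}}, {{1,3},{2,6},{4,5}}, {{1,4},{2,5},{3,6}}, {{1,5},{2,3},{4,6}}, {{1,6},{2,4},{3,5}}}
    else if i = 3 then {{{1,2},{3,6},{4,5}}, {{1,3},{2,4},{5,6}}, {{1,4},{2,6},{3,5}}, {{1,5},{2,3},{4,6}}, {{1,6},{2,5},{3,4}}}
    else if i = 4 then {{{1,2},{3,6},{4,5}}, {{1,3},{2,5},{4,6}}, {{1,4},{2,3},{5,6}}, {{1,5},{2,6},{3,4}}, {{1,6},{2,4},{3,5}}}
    else if i = 5 then {{{1,2},{3,5},{4,6}}, {{1,3},{2,4},{5,6}}, {{1,4},{2,5},{3,6}}, {{1,5},{2,6},{3,4}}, {{1,6},{2,3},{4,5}}}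
    else {{{1,2},{3,5},{4,6}}, {{1,3},{2,6},{4,5}}, {{1,4},{2,3},{5,6}}, {{1,5},{2,4},{3,6}}, {{1,6},{2,5},{3,4}}})"

abbreviation image_total :: "(nat \<Rightarrow> nat) \<Rightarrow> nat set set set \<Rightarrow> nat set set set" where
  "image_total \<pi> \<equiv> (`) ((`) ((`) \<pi>))"

abbreviation triple_transpose :: "nat \<Rightarrow> nat \<Rightarrow> nat \<Rightarrow> nat \<Rightarrow> nat \<Rightarrow> nat \<Rightarrow> nat \<Rightarrow> nat" where
  "triple_transpose a b c d e f \<equiv> transpose a b \<circ> transpose c d \<circ> transpose e f"

lemma atLeastAtMost_6: "{1..6} = {1, 2, 3, 4, 5, 6 :: nat}"
  by auto

text \<open>Instead of comparing nested sets, four yes/no questions are asked, each whether two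
  given pairs lie in a common matching of the total. The answers separate the six totals.\<close>

lemma total_inj:
  assumes "total i = total j" "i \<in> {1..6}" "j \<in> {1..6}"
  shows "i = j"
proof -
  define P where "P X a b c d \<longleftrightarrow> (\<exists>s\<in>X. {a, b} \<in> s \<and> {c, d} \<in> s)" for X :: "nat set set set" and a b c d
  define key where "key X = (P X 1 2 3 4, P X 1 2 3 6, P X 1 3 2 5, P X 1 3 2 4)" for X
  have "key (total 1) = (True, False, True, False)" "key (total 2) = (True, False, False, False)"
    "key (total 3) = (False, True, False, True)" "key (total 4) = (False, True, True, False)"
    "key (total 5) = (False, False, False, True)" "key (total 6) = (False, False, False, False)"
    by (simp_all add: key_def P_def total_def doubleton_eq_iff)
  moreover have "key (total i) = key (total j)"
    using assms(1) by simp
  ultimately show ?thesis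
    using assms(2,3) unfolding atLeastAtMost_6 by auto
qed

lemma image_total_gens:
  assumes "i \<in> {1..6}"
  shows "image_total (transpose 1 2) (total i) = total (triple_transpose 1 2 3 4 5 6 i)"
    "image_total (transpose 2 3) (total i) = total (triple_transpose 1 5 2 3 4 6 i)"
    "image_total (transpose 3 4) (total i) = total (triple_transpose 1 2 3 6 4 5 i)"
    "image_total (transpose 4 5) (total i) = total (triple_transpose 1 5 2 6 3 4 i)"
    "image_total (transpose 5 6) (total i) = total (triple_transpose 1 2 3 5 4 6 i)"
  using assms unfolding atLeastAtMost_6
  by (elim insertE emptyE; simp add: total_def insert_commute)+

lemma fun_eq_on_6I:
  fixes f g :: "nat \<Rightarrow> nat"
  assumes "f permutes {1..6}" "g permutes {1..6}"
    "f 1 = g 1" "f 2 = g 2" "f 3 = g 3" "f 4 = g 4" "f 5 = g 5" "f 6 = g 6"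
  shows "f = g"
proof
  fix x show "f x = g x"
    using assms(3-8) permutes_not_in[OF assms(1), of x] permutes_not_in[OF assms(2), of x]
    unfolding atLeastAtMost_6 by (cases "x \<in> {1, 2, 3, 4, 5, 6}") auto
qed

text \<open>The left side is the product of the values prescribed for \<open>(1 2)\<close>,
  \<open>(3 4)\<close> and \<open>(5 6)\<close>. So the prescribed values generate a transposition,
  and \<open>eta\<close> sends a product of three disjoint transpositions to a single one.\<close>

lemma triple_transpose_mult:
  "triple_transpose 1 2 3 4 5 6 \<circ> triple_transpose 1 2 3 6 4 5 \<circ> triple_transpose 1 2 3 5 4 6 = transpose 1 2"
  by (rule fun_eq_on_6I) (auto intro!: permutes_compose permutes_swap_id)

context
begin

interpretation S6: grpn 1 6 1
  by unfold_locales simp_all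

lemma S6_el_eq: "S6.el f \<pi> = S6.el (\<lambda>_. 0) \<pi>"
  by (rule wr_eqI) simp

text \<open>Starting from \<open>(1 2)\<close>, provided by \<open>triple_transpose_mult\<close>,
  conjugation by the given involutions and by transpositions already obtained reaches all adjacent
  transpositions.\<close>

lemma S6_generated_snd:
  assumes H: "subgroup H S6.W"
    and b: "S6.el (\<lambda>_. 0) (triple_transpose 1 2 3 4 5 6) \<in> H" "S6.el (\<lambda>_. 0) (triple_transpose 1 5 2 3 4 6) \<in> H"
      "S6.el (\<lambda>_. 0) (triple_transpose 1 2 3 6 4 5) \<in> H" "S6.el (\<lambda>_. 0) (triple_transpose 1 5 2 6 3 4) \<in> H"
      "S6.el (\<lambda>_. 0) (triple_transpose 1 2 3 5 4 6) \<in> H"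
  shows "carrier S6.G \<subseteq> H"
proof -
  define P where "P \<pi> \<longleftrightarrow> \<pi> permutes {1..6} \<and> S6.el (\<lambda>_. 0) \<pi> \<in> H" for \<pi>
  have comp: "P (\<pi> \<circ> \<sigma>)" if "P \<pi>" "P \<sigma>" for \<pi> \<sigma>
    using that subgroup.m_closed[OF H, of "S6.el (\<lambda>_. 0) \<pi>" "S6.el (\<lambda>_. 0) \<sigma>"]
    by (simp add: P_def S6.el_mult permutes_compose)
  have conj: "P (transpose (\<pi> a) (\<pi> c))" if "P \<pi>" "\<forall>x\<in>{1..6}. \<pi> (\<pi> x) = x" "P (transpose a c)" for \<pi> a c
  proof -
    have \<pi>: "\<pi> permutes {1..6}" using that(1) by (simp add: P_def)
    have "\<pi> (\<pi> x) = x" for x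
      using that(2) permutes_not_in[OF \<pi>, of x] by (cases "x \<in> {1..6}") auto
    then have "inv' \<pi> = \<pi>"
      by (intro inv_unique_comp) (simp_all add: fun_eq_iff)
    then show ?thesis
      using comp[OF comp[OF that(1,3)] that(1)] conj_transpose[OF permutes_bij[OF \<pi>], of a c] by simp
  qed
  have P: "P (triple_transpose 1 2 3 4 5 6)" "P (triple_transpose 1 5 2 3 4 6)" "P (triple_transpose 1 2 3 6 4 5)"
    "P (triple_transpose 1 5 2 6 3 4)" "P (triple_transpose 1 2 3 5 4 6)"
    using b by (auto simp: P_def intro!: permutes_compose permutes_swap_id)
  have invol: "\<forall>x\<in>{1..6}. triple_transpose 1 2 3 4 5 6 (triple_transpose 1 2 3 4 5 6 x) = x"
    "\<forall>x\<in>{1..6}. triple_transpose 1 5 2 3 4 6 (triple_transpose 1 5 2 3 4 6 x) = x"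
    "\<forall>x\<in>{1..6}. triple_transpose 1 2 3 6 4 5 (triple_transpose 1 2 3 6 4 5 x) = x"
    "\<forall>x\<in>{1..6}. triple_transpose 1 5 2 6 3 4 (triple_transpose 1 5 2 6 3 4 x) = x"
    "\<And>a b. \<forall>x\<in>{1..6}. transpose a b (transpose a b x) = (x :: nat)"
    unfolding atLeastAtMost_6 by simp_all
  have 12: "P (transpose 1 2)"
    using comp[OF comp[OF P(1,3)] P(5)] by (simp only: triple_transpose_mult)
  have 53: "P (transpose 5 3)"
    using conj[OF P(2) invol(2) 12] by simp
  have 56: "P (transpose 5 6)"
    using conj[OF P(4) invol(4) 12] by simp
  have 64: "P (transpose 6 4)"
    using conj[OF P(1) invol(1) 53] by simp
  have 34: "P (transpose 3 4)"
    using conj[OF P(3) invol(3) 56] by (simp add: transpose_commute)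
  have 26: "P (transpose 2 6)"
    using conj[OF P(2) invol(2) 34] by simp
  have 25: "P (transpose 2 5)"
    using conj[OF 56 invol(5) 26] by simp
  have 23: "P (transpose 2 3)"
    using conj[OF 53 invol(5) 25] by simp
  have 45: "P (transpose 4 5)"
    using conj[OF 56 invol(5) 64] by (simp add: transpose_commute)
  show ?thesis
  proof (rule S6.generated[OF H])
    show "S6.el (\<lambda>_. 0) (transpose i (i + 1)) \<in> H" if "1 \<le> i" "i < 6" for i
    proof -
      have "i = 1 \<or> i = 2 \<or> i = 3 \<or> i = 4 \<or> i = 5" using that by auto
      then show ?thesis using 12 23 34 45 56 by (auto simp: P_def)
    qed
    have one: "S6.el f id \<in> H" for f
      using subgroup.one_closed[OF H] S6_el_eq[of f id] by (simp only: S6.el_one)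
    show "\<exists>a\<in>{1..6}. \<exists>b\<in>{1..6}. a \<noteq> b \<and> S6.el (\<lambda>i. unit a i - unit b i) id \<in> H"
      using one by (intro bexI[of _ 1] bexI[of _ 2]) auto
    show "S6.el (\<lambda>i. int 1 * unit 1 i) id \<in> H" by (rule one)
  qed simp
qed

lemma eta_1_1_6:
  "eta 1 1 6 \<in> auto (Grpn 1 1 6)"
  "eta 1 1 6 (gen_s 1 6 1) = wr 1 6 (\<lambda>_. 0) (triple_transpose 1 2 3 4 5 6)"
  "eta 1 1 6 (gen_s 1 6 3) = wr 1 6 (\<lambda>_. 0) (triple_transpose 1 2 3 6 4 5)"
  "eta 1 1 6 (gen_s 1 6 5) = wr 1 6 (\<lambda>_. 0) (triple_transpose 1 2 3 5 4 6)"
proof -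
  have tau: "(\<one>\<^bsub>Zvec 1 6\<^esub>, \<pi>) = S6.el (\<lambda>_. 0) \<pi>" for \<pi>
    by (auto simp: wr_def Zvec_def)
  define ps where "ps = [(gen_s 1 6 1, S6.el (\<lambda>_. 0) (triple_transpose 1 2 3 4 5 6)),
    (gen_s 1 6 2, S6.el (\<lambda>_. 0) (triple_transpose 1 5 2 3 4 6)),
    (gen_s 1 6 3, S6.el (\<lambda>_. 0) (triple_transpose 1 2 3 6 4 5)),
    (gen_s 1 6 4, S6.el (\<lambda>_. 0) (triple_transpose 1 5 2 6 3 4)),
    (gen_s 1 6 5, S6.el (\<lambda>_. 0) (triple_transpose 1 2 3 5 4 6))]"
  define Q where "Q g h \<longleftrightarrow> g \<in> carrier S6.G \<and> h \<in> carrier S6.G \<and>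
    (\<forall>i\<in>{1..6}. image_total (snd g) (total i) = total (snd h i))" for g h
  have perm: "snd g permutes {1..6}" if "g \<in> carrier S6.G" for g
    using that by (rule S6.G_cases) simp
  have snd_mult: "snd (g \<otimes>\<^bsub>S6.W\<^esub> h) = snd g \<circ> snd h" if "g \<in> carrier S6.G" "h \<in> carrier S6.G" for g h
  proof -
    from that(1) obtain f \<pi> where f: "g = S6.el f \<pi>" "\<pi> permutes {1..6}" by (rule S6.G_cases)
    from that(2) obtain f' \<pi>' where f': "h = S6.el f' \<pi>'" "\<pi>' permutes {1..6}" by (rule S6.G_cases)
    show ?thesis using f f' by (simp add: S6.el_mult)
  qed
  interpret R: generator_relation S6.G Q ps
  proof (unfold_locales, goal_cases)
    case 1
    show ?case by (rule S6.G_finite)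
  next
    case (2 g h)
    then show ?case by (simp add: Q_def)
  next
    case 3
    then show ?case using S6.G.one_closed by (simp add: Q_def S6.el_one)
  next
    case (4 g h g' h')
    then have G: "g \<in> carrier S6.G" "h \<in> carrier S6.G" "g' \<in> carrier S6.G" "h' \<in> carrier S6.G"
      by (simp_all add: Q_def)
    have "image_total (snd g \<circ> snd g') (total i) = total (snd h (snd h' i))" if i: "i \<in> {1..6}" for i
    proof -
      have "snd h' i \<in> {1..6}"
        using permutes_in_image[OF perm[OF G(4)]] i by simp
      then have "image_total (snd g) (image_total (snd g') (total i)) = total (snd h (snd h' i))"
        using 4 i by (simp add: Q_def)
      then show ?thesis by (simp add: image_image image_comp)
    qed
    then show ?case
      using G S6.G.m_closed by (simp add: Q_def snd_mult)
  next
    case (5 h)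
    then have h: "h \<in> carrier S6.G" and eq: "\<And>i. i \<in> {1..6} \<Longrightarrow> total i = total (snd h i)"
      by (simp_all add: Q_def S6.el_one)
    have "snd h i = i" for i
      using total_inj[OF eq[of i]] permutes_in_image[OF perm[OF h]] permutes_not_in[OF perm[OF h], of i]
      by (cases "i \<in> {1..6}") auto
    then have "snd h = id" by (simp add: fun_eq_iff)
    moreover from h obtain f \<pi> where f: "h = S6.el f \<pi>" by (rule S6.G_cases)
    ultimately show ?case
      using S6_el_eq[of f id] by (simp add: S6.el_one)
  next
    case (6 a b)
    have Q_el: "Q (S6.el (\<lambda>_. 0) \<pi>) (S6.el (\<lambda>_. 0) \<sigma>)"
      if "\<pi> permutes {1..6}" "\<sigma> permutes {1..6}" "\<And>i. i \<in> {1..6} \<Longrightarrow> image_total \<pi> (total i) = total (\<sigma> i)" for \<pi> \<sigma>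
      using that(1,2) unfolding Q_def by (simp del: atLeastAtMost_iff add: that(3))
    have "Q (gen_s 1 6 1) (S6.el (\<lambda>_. 0) (triple_transpose 1 2 3 4 5 6))"
      "Q (gen_s 1 6 2) (S6.el (\<lambda>_. 0) (triple_transpose 1 5 2 3 4 6))"
      "Q (gen_s 1 6 3) (S6.el (\<lambda>_. 0) (triple_transpose 1 2 3 6 4 5))"
      "Q (gen_s 1 6 4) (S6.el (\<lambda>_. 0) (triple_transpose 1 5 2 6 3 4))"
      "Q (gen_s 1 6 5) (S6.el (\<lambda>_. 0) (triple_transpose 1 2 3 5 4 6))"
      unfolding S6.gen_s_el using image_total_gens
      by (intro Q_el permutes_compose permutes_swap_id; simp del: comp_apply)+
    then show ?case
      using 6 by (auto simp: ps_def simp del: comp_apply)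
  next
    case (7 H)
    show ?case
    proof (rule S6.generated[OF S6.W_subgroup[OF 7(1)]])
      show "S6.el (\<lambda>_. 0) (transpose i (i + 1)) \<in> H" if "1 \<le> i" "i < 6" for i
      proof -
        have "i = 1 \<or> i = 2 \<or> i = 3 \<or> i = 4 \<or> i = 5" using that by auto
        then show ?thesis using 7(2) by (auto simp: ps_def S6.gen_s_el)
      qed
      have one: "S6.el f id \<in> H" for f
        using subgroup.one_closed[OF 7(1)] S6_el_eq[of f id] by (simp only: S6.el_one S6.G_one)
      show "\<exists>a\<in>{1..6}. \<exists>b\<in>{1..6}. a \<noteq> b \<and> S6.el (\<lambda>i. unit a i - unit b i) id \<in> H"
        using one by (intro bexI[of _ 1] bexI[of _ 2]) auto
      show "S6.el (\<lambda>i. int 1 * unit 1 i) id \<in> H" by (rule one)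
    qed simp
  next
    case (8 H)
    then show ?case
      by (intro S6_generated_snd S6.W_subgroup) (simp_all add: ps_def)
  qed
  have "eta 1 1 6 = aut_of S6.G ps"
    by (simp add: eta_def ps_def Let_def tau)
  with R.aut_of_correct show "eta 1 1 6 \<in> auto S6.G"
    "eta 1 1 6 (gen_s 1 6 1) = S6.el (\<lambda>_. 0) (triple_transpose 1 2 3 4 5 6)"
    "eta 1 1 6 (gen_s 1 6 3) = S6.el (\<lambda>_. 0) (triple_transpose 1 2 3 6 4 5)"
    "eta 1 1 6 (gen_s 1 6 5) = S6.el (\<lambda>_. 0) (triple_transpose 1 2 3 5 4 6)"
    by (simp_all add: ps_def)
qed

end

section \<open>The classification\<close>

lemma carrier_AutoGroup [simp]: "carrier (AutoGroup G) = auto G"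
  by (simp add: AutoGroup_def)

lemma mult_AutoGroup: "f \<in> auto G \<Longrightarrow> g \<in> auto G \<Longrightarrow> f \<otimes>\<^bsub>AutoGroup G\<^esub> g = compose (carrier G) f g"
  by (simp add: AutoGroup_def BijGroup_def auto_def)

lemma one_AutoGroup: "\<one>\<^bsub>AutoGroup G\<^esub> = (\<lambda>x\<in>carrier G. x)"
  by (simp add: AutoGroup_def BijGroup_def)

definition has_form :: "nat \<Rightarrow> nat \<Rightarrow> nat \<Rightarrow> ((nat \<Rightarrow> int) \<times> (nat \<Rightarrow> nat) \<Rightarrow> (nat \<Rightarrow> int) \<times> (nat \<Rightarrow> nat)) \<Rightarrow> bool" where
  "has_form r p n \<phi> \<longleftrightarrow> (\<exists>g \<in> carrier (Grpn r 1 n). \<exists>(i1::int) (i2::int) (j::int) (k::int). \<exists>z \<in> Crpn r p n.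
    \<phi> = compose (carrier (Grpn r p n)) (eta r p n [^]\<^bsub>AutoGroup (Grpn r p n)\<^esub> i1)
          (compose (carrier (Grpn r p n)) (eta' r p n [^]\<^bsub>AutoGroup (Grpn r p n)\<^esub> i2)
            (compose (carrier (Grpn r p n)) (Ad r p n g) (alpha r p n j k z))))"

lemma (in wreath_group) el_eqI:
  assumes "\<pi> permutes {1..n}" "\<sigma> permutes {1..n}" "\<forall>i\<in>{1..n}. \<pi> i = \<sigma> i \<and> [f i = g i] (mod int r)"
  shows "el f \<pi> = el g \<sigma>"
proof -
  have "\<pi> = \<sigma>"
    using assms permutes_not_in[OF assms(1)] permutes_not_in[OF assms(2)] by (intro ext) metis
  then show ?thesis
    using assms(3) by (auto simp: wr_eq_iff)
qed

context grpn
begin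

lemma eta_auto: "eta r p n \<in> auto G"
proof (cases "(r, p, n) \<in> {(2, 1, 2), (2, 2, 2), (4, 2, 2), (3, 3, 3), (2, 2, 4), (1, 1, 6)}")
  case True
  then show ?thesis
    using eta_2_1_2(1) eta_2_2_2(1) eta_4_2_2(1) eta_3_3_3(1) eta_2_2_4(1) eta_1_1_6(1) by auto
next
  case False
  then have "eta r p n = \<one>\<^bsub>AutoGroup G\<^esub>"
    by (auto simp: eta_def Let_def)
  then show ?thesis
    using group.is_monoid[OF G.AutoGroup] monoid.one_closed by fastforce
qed

lemma eta'_auto: "eta' r p n \<in> auto G"
proof (cases "(r, p, n) = (3, 3, 3)")
  case True
  then show ?thesis
    using eta'_3_3_3(1) by auto
next
  case False
  then have "eta' r p n = \<one>\<^bsub>AutoGroup G\<^esub>"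
    by (auto simp: eta'_def Let_def)
  then show ?thesis
    using group.is_monoid[OF G.AutoGroup] monoid.one_closed by fastforce
qed

abbreviation eta_pow where "eta_pow i \<equiv> eta r p n [^]\<^bsub>AutoGroup G\<^esub> (i :: int)"
abbreviation eta'_pow where "eta'_pow i \<equiv> eta' r p n [^]\<^bsub>AutoGroup G\<^esub> (i :: int)"

lemma pow_auto: "f \<in> auto G \<Longrightarrow> f [^]\<^bsub>AutoGroup G\<^esub> (i :: int) \<in> auto G"
  using group.int_pow_closed[OF G.AutoGroup, of f i] by simp

lemma pow_apply:
  assumes f: "f \<in> auto G" and g: "g \<in> carrier G"
  shows "(f [^]\<^bsub>AutoGroup G\<^esub> (0 :: int)) g = g" "(f [^]\<^bsub>AutoGroup G\<^esub> (1 :: int)) g = f g"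
    "(f [^]\<^bsub>AutoGroup G\<^esub> (2 :: int)) g = f (f g)"
proof -
  interpret A: group "AutoGroup G" by (rule G.AutoGroup)
  have f': "f \<in> carrier (AutoGroup G)" using f by simp
  show "(f [^]\<^bsub>AutoGroup G\<^esub> (0 :: int)) g = g"
    using g by (simp add: one_AutoGroup)
  show "(f [^]\<^bsub>AutoGroup G\<^esub> (1 :: int)) g = f g"
    using A.int_pow_1[OF f'] by simp
  have "f [^]\<^bsub>AutoGroup G\<^esub> (2 :: int) = f \<otimes>\<^bsub>AutoGroup G\<^esub> f"
    using A.int_pow_mult[OF f', of 1 1] A.int_pow_1[OF f'] by simp
  then show "(f [^]\<^bsub>AutoGroup G\<^esub> (2 :: int)) g = f (f g)"
    using g by (simp add: mult_AutoGroup[OF f f] compose_eq)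
qed

end

context grpn_auto
begin

text \<open>Guessed powers of \<open>eta\<close> and \<open>eta'\<close> are cancelled on the left
  of \<open>\<phi>\<close>; it is left to the caller to choose them so that the remaining
  \<open>\<psi>\<close> preserves the diagonal subgroup and is of the generic form.\<close>

lemma conclude:
  assumes "\<And>\<psi>. \<psi> \<in> auto G \<Longrightarrow> (\<And>g. g \<in> carrier G \<Longrightarrow> \<phi> g = eta_pow i1 (eta'_pow i2 (\<psi> g))) \<Longrightarrow>
    \<exists>g\<in>carrier (Grpn r 1 n). \<exists>j k. \<exists>z\<in>Crpn r p n. \<psi> = compose (carrier G) (Ad r p n g) (alpha r p n j k z)"
  shows "has_form r p n \<phi>"
proof -
  interpret A: group "AutoGroup G" by (rule G.AutoGroup)
  have E: "eta_pow i1 \<in> carrier (AutoGroup G)" "eta'_pow i2 \<in> carrier (AutoGroup G)" "\<phi> \<in> carrier (AutoGroup G)"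
    using pow_auto eta_auto eta'_auto aut by simp_all
  define \<psi> where "\<psi> = inv\<^bsub>AutoGroup G\<^esub> (eta'_pow i2) \<otimes>\<^bsub>AutoGroup G\<^esub> (inv\<^bsub>AutoGroup G\<^esub> (eta_pow i1) \<otimes>\<^bsub>AutoGroup G\<^esub> \<phi>)"
  have \<psi>A: "\<psi> \<in> carrier (AutoGroup G)"
    unfolding \<psi>_def using E by (simp del: carrier_AutoGroup)
  then have \<psi>: "\<psi> \<in> auto G" by simp
  have "\<phi> = eta_pow i1 \<otimes>\<^bsub>AutoGroup G\<^esub> (eta'_pow i2 \<otimes>\<^bsub>AutoGroup G\<^esub> \<psi>)"
    unfolding \<psi>_def using E by (simp add: A.inv_solve_left A.m_assoc[symmetric] del: carrier_AutoGroup)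
  then have eq: "\<phi> = compose (carrier G) (eta_pow i1) (compose (carrier G) (eta'_pow i2) \<psi>)"
    using E \<psi> \<psi>A A.m_closed[OF E(2) \<psi>A] by (simp add: mult_AutoGroup)
  have pw: "\<phi> g = eta_pow i1 (eta'_pow i2 (\<psi> g))" if "g \<in> carrier G" for g
    by (subst eq) (simp add: compose_eq that)
  obtain g j k z where "g \<in> carrier (Grpn r 1 n)" "z \<in> Crpn r p n"
    "\<psi> = compose (carrier G) (Ad r p n g) (alpha r p n j k z)"
    using assms[OF \<psi> pw] by blast
  then show ?thesis
    unfolding has_form_def using eq by blast
qed

lemma conclude_diag:
  assumes n: "n > 0" "n \<noteq> 6"
    and diag: "\<And>\<psi>. \<psi> \<in> auto G \<Longrightarrow> (\<And>g. g \<in> carrier G \<Longrightarrow> \<phi> g = eta_pow i1 (eta'_pow i2 (\<psi> g))) \<Longrightarrow>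
      grpn_diag_auto r n p \<psi>"
  shows "has_form r p n \<phi>"
proof (rule conclude)
  fix \<psi> assume "\<psi> \<in> auto G" "\<And>g. g \<in> carrier G \<Longrightarrow> \<phi> g = eta_pow i1 (eta'_pow i2 (\<psi> g))"
  then have "grpn_diag_auto r n p \<psi>" by (rule diag)
  then show "\<exists>g\<in>carrier (Grpn r 1 n). \<exists>j k. \<exists>z\<in>Crpn r p n. \<psi> = compose (carrier G) (Ad r p n g) (alpha r p n j k z)"
    using n by (intro grpn_diag_auto.normal_form) auto
qed

text \<open>The powers are injective and can be cancelled, so their inverses need not be
  evaluated.\<close>

lemma pull_back:
  assumes \<psi>: "\<psi> \<in> auto G" "\<And>g. g \<in> carrier G \<Longrightarrow> \<phi> g = eta_pow i1 (eta'_pow i2 (\<psi> g))"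
    and gd: "g \<in> carrier G" "d \<in> carrier G" "\<phi> g = eta_pow i1 (eta'_pow i2 d)"
  shows "\<psi> g = d"
proof -
  interpret p: grpn_auto r n p \<psi>
    by unfold_locales (rule \<psi>(1))
  interpret e: grpn_auto r n p "eta_pow i1"
    by unfold_locales (intro pow_auto eta_auto)
  interpret e': grpn_auto r n p "eta'_pow i2"
    by unfold_locales (intro pow_auto eta'_auto)
  have "eta_pow i1 (eta'_pow i2 (\<psi> g)) = eta_pow i1 (eta'_pow i2 d)"
    using \<psi>(2)[OF gd(1)] gd(3) by simp
  then have "eta'_pow i2 (\<psi> g) = eta'_pow i2 d"
    by (rule e.phi_inj[rotated 2]) (intro e'.phi_closed p.phi_closed gd)+
  then show ?thesis
    by (rule e'.phi_inj[rotated 2]) (intro p.phi_closed gd)+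
qed

text \<open>One root decides when \<open>p = r\<close>, so the search for exponents reduces to
  matching a single value of \<open>\<phi>\<close>.\<close>

lemma conclude_root:
  assumes n: "n > 1" "n \<noteq> 6" and p: "p = r"
    and ab: "a \<in> {1..n}" "b \<in> {1..n}" "a \<noteq> b"
    and d: "good f" "\<phi> (el (\<lambda>i. unit a i - unit b i) id) = eta_pow i1 (eta'_pow i2 (el f id))"
  shows "has_form r p n \<phi>"
proof (rule conclude_diag)
  fix \<psi> assume \<psi>: "\<psi> \<in> auto G" "\<And>g. g \<in> carrier G \<Longrightarrow> \<phi> g = eta_pow i1 (eta'_pow i2 (\<psi> g))"
  interpret p: grpn_auto r n p \<psi>
    by unfold_locales (rule \<psi>(1))
  have "\<psi> (el (\<lambda>i. unit a i - unit b i) id) = el f id"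
    using ab d by (intro pull_back[OF \<psi>]) (simp_all add: permutes_id sum_subtractf)
  then show "grpn_diag_auto r n p \<psi>"
    using n p ab by (intro p.diag_autoI_root[of a b]) simp_all
qed (use n in simp_all)

lemma phi_const:
  assumes "good (\<lambda>_. 1)" "\<phi> (el (\<lambda>_. 1) id) = el (\<lambda>_. 1) id"
  shows "\<phi> (el (\<lambda>_. int m) id) = el (\<lambda>_. int m) id"
proof (induction m)
  case 0
  interpret group_hom G G \<phi>
    using phi_hom by unfold_locales
  have "\<phi> (el (\<lambda>_. 0) id) = el (\<lambda>_. 0) id"
    using hom_one by (simp add: el_one)
  then show ?case
    by (simp only: of_nat_0)
next
  case (Suc m)
  have eq: "el (\<lambda>_. int (Suc m)) id = el (\<lambda>_. int m) id \<otimes>\<^bsub>W\<^esub> el (\<lambda>_. 1) id"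
    by (simp only: el_mult_diag of_nat_Suc add.commute)
  have "\<phi> (el (\<lambda>_. int m) id \<otimes>\<^bsub>W\<^esub> el (\<lambda>_. 1) id) = \<phi> (el (\<lambda>_. int m) id) \<otimes>\<^bsub>W\<^esub> \<phi> (el (\<lambda>_. 1) id)"
    using assms(1) by (intro phi_mult) (simp_all add: permutes_id)
  then show ?case
    unfolding eq Suc.IH assms(2) .
qed

end

section \<open>The exceptional triples\<close>

lemma permutes_2:
  assumes "\<pi> permutes {1..2::nat}"
  shows "\<pi> = id \<or> \<pi> = transpose 1 2"
  using assms unfolding atLeastAtMost_numerals permutes_doubleton_iff .

text \<open>The involution \<open>elt_s\<close> generates the diagonal subgroup, and
  \<open>eta\<close> cycles the three involutions: its first power takes \<open>elt_s\<close> to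
  \<open>s_1'\<close>, its second to \<open>s_1\<close>.\<close>

lemma case_2_2_2:
  assumes "grpn_auto 2 2 2 \<phi>"
  shows "has_form 2 2 2 \<phi>"
proof -
  interpret grpn_auto 2 2 2 \<phi> by fact
  let ?u = "elt_s 2 2"
  have t: "transpose 1 2 permutes {1..2::nat}"
    by (intro permutes_swap_id) auto
  have G: "?u \<in> carrier G" "gen_s' 2 2 1 \<in> carrier G" "gen_s 2 2 1 \<in> carrier G"
    using t by (simp_all add: elt_s_el gen_s'_el gen_s_el permutes_id sum_subtractf)
  obtain x \<sigma> where x: "\<phi> ?u = el x \<sigma>" "\<sigma> permutes {1..2}" "good x"
    using phi_el[OF G(1)] .
  have "\<exists>f i. good f \<and> \<phi> ?u = eta_pow i (eta'_pow 0 (el f id))"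
  proof (cases "\<sigma> = id")
    case True
    have "\<phi> ?u = eta_pow 0 (eta'_pow 0 (el x id))"
      using x True by (simp add: pow_apply[OF eta_auto] pow_apply[OF eta'_auto] one_AutoGroup permutes_id)
    then show ?thesis using x(3) by blast
  next
    case False
    then have \<sigma>: "\<sigma> = transpose 1 2"
      using permutes_2[OF x(2)] by blast
    have sum: "2 dvd x 1 + x 2"
      using x(3) by (simp add: atLeastAtMost_numerals)
    have "good (\<lambda>i. unit 1 i - unit 2 i)" by (simp add: sum_subtractf)
    moreover have "\<phi> ?u = eta_pow (if even (x 1) then 2 else 1) (eta'_pow 0 ?u)"
    proof (cases "even (x 1)")
      case True
      then have "\<phi> ?u = gen_s 2 2 1"
        using sum unfolding x \<sigma> gen_s_el one_add_one
          by (auto simp: wr_eq_iff atLeastAtMost_numerals cong_iff_dvd_diff)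
      then show ?thesis
        using G True by (simp add: pow_apply[OF eta_auto] pow_apply[OF eta'_auto] one_AutoGroup eta_2_2_2)
    next
      case False
      have "even (x 2 + 1)" using sum False by simp
      then have "\<phi> ?u = gen_s' 2 2 1"
        using False unfolding x \<sigma> gen_s'_el one_add_one
          by (auto simp: wr_eq_iff atLeastAtMost_numerals cong_iff_dvd_diff)
      then show ?thesis
        using G False by (simp add: pow_apply[OF eta_auto] pow_apply[OF eta'_auto] one_AutoGroup eta_2_2_2)
    qed
    ultimately show ?thesis unfolding elt_s_el by blast
  qed
  then obtain f i where f: "good f" "\<phi> (el (\<lambda>i. unit 1 i - unit 2 i) id) = eta_pow i (eta'_pow 0 (el f id))"
    unfolding elt_s_el by blast
  show ?thesis
    by (rule conclude_root[OF _ _ _ _ _ _ f]) simp_all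
qed

text \<open>An involution over the swap is \<open>s_1\<close> or its product with the central vector
  \<open>(1, 1)\<close>. As \<open>eta\<close> fixes this vector, both are values of
  \<open>eta\<close> at diagonal elements.\<close>

lemma case_2_1_2:
  assumes "grpn_auto 2 2 1 \<phi>"
  shows "has_form 2 1 2 \<phi>"
proof -
  interpret grpn_auto 2 2 1 \<phi> by fact
  interpret E: grpn_auto 2 2 1 "eta 2 1 2"
    by unfold_locales (rule eta_auto)
  let ?t = "elt_t 2 2" and ?z = "el (\<lambda>_. 1) id" and ?s = "gen_s 2 2 1"
  have t: "transpose 1 2 permutes {1..2::nat}"
    by (intro permutes_swap_id) auto
  have G: "?t \<in> carrier G" "?s \<in> carrier G" "?z \<in> carrier G"
    using t by (simp_all add: elt_t_el gen_s_el permutes_id)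
  \<comment> \<open>Two words for the central vector, of which \<open>eta\<close> carries the first
    to the second.\<close>
  have z: "?z = ?t \<otimes>\<^bsub>W\<^esub> (?s \<otimes>\<^bsub>W\<^esub> (?t \<otimes>\<^bsub>W\<^esub> ?s))" "?z = ?s \<otimes>\<^bsub>W\<^esub> (?t \<otimes>\<^bsub>W\<^esub> (?s \<otimes>\<^bsub>W\<^esub> ?t))"
    using t by (auto simp: elt_t_el gen_s_el el_mult permutes_id wr_eq_iff atLeastAtMost_numerals cong_def)
  have closed: "g \<otimes>\<^bsub>W\<^esub> h \<in> carrier G" if "g \<in> carrier G" "h \<in> carrier G" for g h
    using G.m_closed[OF that] by simp
  have "eta 2 1 2 (?t \<otimes>\<^bsub>W\<^esub> (?s \<otimes>\<^bsub>W\<^esub> (?t \<otimes>\<^bsub>W\<^esub> ?s))) = ?s \<otimes>\<^bsub>W\<^esub> (?t \<otimes>\<^bsub>W\<^esub> (?s \<otimes>\<^bsub>W\<^esub> ?t))"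
    using G by (simp only: E.phi_mult closed eta_2_1_2)
  then have eta_z: "eta 2 1 2 ?z = ?z"
    by (simp only: z(1)[symmetric] z(2)[symmetric])
  obtain x \<sigma> where x: "\<phi> ?t = el x \<sigma>" "\<sigma> permutes {1..2}" "good x"
    using phi_el[OF G(1)] .
  have "\<exists>f i. \<phi> ?t = eta_pow i (eta'_pow 0 (el f id))"
  proof (cases "\<sigma> = id")
    case True
    have "\<phi> ?t = eta_pow 0 (eta'_pow 0 (el x id))"
      using x True by (simp add: pow_apply[OF eta_auto] pow_apply[OF eta'_auto] one_AutoGroup permutes_id)
    then show ?thesis by blast
  next
    case False
    then have \<sigma>: "\<sigma> = transpose 1 2"
      using permutes_2[OF x(2)] by blast
    have "?t \<otimes>\<^bsub>W\<^esub> ?t = \<one>\<^bsub>W\<^esub>"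
      unfolding elt_t_el el_mult_diag el_one by (intro wr_eqI) (simp add: cong_def)
    then have "el x \<sigma> \<otimes>\<^bsub>W\<^esub> el x \<sigma> = \<one>\<^bsub>W\<^esub>"
      using phi_mult[OF G(1,1)] x(1) hom_one[OF phi_hom G.is_group G.is_group] by simp
    then have "\<forall>i\<in>{1..2}. [x (\<sigma> i) + x i = 0] (mod int 2)"
      unfolding el_mult[OF x(2) x(2)] el_one wr_eq_iff by (rule conjunct2)
    from bspec[OF this, of 1] have sum: "even (x 2 + x 1)"
      by (simp add: \<sigma> cong_0_iff)
    show ?thesis
    proof (cases "even (x 1)")
      case True
      then have "\<phi> ?t = gen_s 2 2 1"
        using sum unfolding x \<sigma> gen_s_el one_add_one
          by (auto simp: wr_eq_iff atLeastAtMost_numerals cong_iff_dvd_diff)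
      then have "\<phi> ?t = eta_pow 1 (eta'_pow 0 ?t)"
        using G by (simp add: pow_apply[OF eta_auto] pow_apply[OF eta'_auto] one_AutoGroup eta_2_1_2)
      then show ?thesis unfolding elt_t_el by blast
    next
      case False
      have "even (x 2 - 1)" using sum False by simp
      then have "\<phi> ?t = el (\<lambda>_. 1) (transpose 1 2)"
        using False unfolding x \<sigma>
        by (auto simp: wr_eq_iff atLeastAtMost_numerals cong_iff_dvd_diff)
      also have "\<dots> = ?s \<otimes>\<^bsub>W\<^esub> ?z"
        using t by (simp add: gen_s_el el_mult permutes_id)
      also have "\<dots> = eta_pow 1 (eta'_pow 0 (?t \<otimes>\<^bsub>W\<^esub> ?z))"
        using G closed[OF G(1,3)] by (simp add: pow_apply[OF eta_auto] pow_apply[OF eta'_auto] one_AutoGroup eta_2_1_2 E.phi_mult eta_z)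
      finally show ?thesis
        unfolding elt_t_el el_mult_diag by blast
    qed
  qed
  then obtain f i where f: "\<phi> ?t = eta_pow i (eta'_pow 0 (el f id))" by blast
  show ?thesis
  proof (rule conclude_diag)
    fix \<psi> assume \<psi>: "\<psi> \<in> auto G" "\<And>g. g \<in> carrier G \<Longrightarrow> \<phi> g = eta_pow i (eta'_pow 0 (\<psi> g))"
    interpret p: grpn_auto 2 2 1 \<psi>
      by unfold_locales (rule \<psi>(1))
    have "\<psi> ?t = el f id"
      using f G by (intro pull_back[OF \<psi>]) (simp_all add: permutes_id)
    then have t1: "snd (\<psi> (el (unit 1) id)) = id"
      by (simp add: elt_t_el)
    have t2: "snd (\<psi> (el (unit 2) id)) = id"
      using p.diag_perm[OF _ t1 t] by (simp only: unit_transpose) simp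
    \<comment> \<open>Modulo 2 the root \<open>e_2 - e_1\<close> is \<open>e_2 + e_1\<close>, the
      product of \<open>t\<close> and its conjugate by the swap.\<close>
    have "el (unit 2) id \<otimes>\<^bsub>W\<^esub> el (unit 1) id \<in> {g \<in> carrier G. snd g = id \<and> snd (\<psi> g) = id}"
      using t1 t2 by (intro subgroup.m_closed[OF p.diag_subgroup]) (simp_all add: permutes_id)
    also have "el (unit 2) id \<otimes>\<^bsub>W\<^esub> el (unit 1) id = el (\<lambda>i. unit 2 i - unit 1 i) id"
      unfolding el_mult_diag by (intro wr_eqI) (simp add: cong_def)
    finally have root: "snd (\<psi> (el (\<lambda>i. unit 2 i - unit 1 i) id)) = id" by simp
    show "grpn_diag_auto 2 2 1 \<psi>"
    proof (rule p.diag_autoI)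
      show "snd (\<psi> (el (\<lambda>i. unit b i - unit 1 i) id)) = id" if "2 \<le> b" "b \<le> 2" for b
      proof -
        have "b = 2" using that by simp
        then show ?thesis using root by simp
      qed
    qed (use t1 in simp_all)
  qed simp_all
qed

text \<open>As an involution, the image of \<open>t^2\<close>, if it lies over the swap, is
  \<open>s_1\<close>, \<open>s_1'\<close> or the product of one of them with the central
  \<open>(2, 2)\<close>; powers of \<open>eta\<close> reach all four. The second diagonal generator
  is then controlled through the centre.\<close>

lemma case_4_2_2:
  assumes "grpn_auto 4 2 2 \<phi>"
  shows "has_form 4 2 2 \<phi>"
proof -
  interpret grpn_auto 4 2 2 \<phi> by fact
  interpret E: grpn_auto 4 2 2 "eta 4 2 2"
    by unfold_locales (rule eta_auto)
  let ?t = "elt_t 4 2 [^]\<^bsub>W\<^esub> (2::nat)" and ?z = "el (\<lambda>_. 2) id" and ?s = "gen_s 4 2 1" and ?s' = "gen_s' 4 2 1"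
  have t: "transpose 1 2 permutes {1..2::nat}"
    by (intro permutes_swap_id) auto
  have t_el: "?t = el (\<lambda>i. 2 * unit 1 i) id"
    by (simp only: elt_t_el el_nat_pow of_nat_numeral)
  have G: "?t \<in> carrier G" "?s \<in> carrier G" "?z \<in> carrier G" "?s' \<in> carrier G"
    using t by (simp_all add: t_el gen_s_el gen_s'_el permutes_id sum_subtractf atLeastAtMost_numerals)
  have z: "?z = ?t \<otimes>\<^bsub>W\<^esub> (?s \<otimes>\<^bsub>W\<^esub> (?t \<otimes>\<^bsub>W\<^esub> ?s))" "?z = ?s' \<otimes>\<^bsub>W\<^esub> (?t \<otimes>\<^bsub>W\<^esub> (?s' \<otimes>\<^bsub>W\<^esub> ?t))"
    using t by (auto simp: t_el gen_s_el gen_s'_el el_mult permutes_id wr_eq_iff atLeastAtMost_numerals cong_def)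
  have closed: "g \<otimes>\<^bsub>W\<^esub> h \<in> carrier G" if "g \<in> carrier G" "h \<in> carrier G" for g h
    using G.m_closed[OF that] by simp
  have "eta 4 2 2 (?t \<otimes>\<^bsub>W\<^esub> (?s \<otimes>\<^bsub>W\<^esub> (?t \<otimes>\<^bsub>W\<^esub> ?s))) = ?s' \<otimes>\<^bsub>W\<^esub> (?t \<otimes>\<^bsub>W\<^esub> (?s' \<otimes>\<^bsub>W\<^esub> ?t))"
    using G by (simp only: E.phi_mult closed eta_4_2_2)
  then have eta_z: "eta 4 2 2 ?z = ?z"
    by (simp only: z(1)[symmetric] z(2)[symmetric])
  have eta_tz: "eta 4 2 2 (?t \<otimes>\<^bsub>W\<^esub> ?z) = ?s' \<otimes>\<^bsub>W\<^esub> ?z" "eta 4 2 2 (?s' \<otimes>\<^bsub>W\<^esub> ?z) = ?s \<otimes>\<^bsub>W\<^esub> ?z"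
    using G by (simp_all only: E.phi_mult eta_4_2_2 eta_z)
  note pow = pow_apply[OF eta_auto] pow_apply[OF eta'_auto] one_AutoGroup
  obtain x \<sigma> where x: "\<phi> ?t = el x \<sigma>" "\<sigma> permutes {1..2}" "good x"
    using phi_el[OF G(1)] .
  have "\<exists>f i. good f \<and> \<phi> ?t = eta_pow i (eta'_pow 0 (el f id))"
  proof (cases "\<sigma> = id")
    case True
    have "\<phi> ?t = eta_pow 0 (eta'_pow 0 (el x id))"
      using x True by (simp add: pow permutes_id)
    then show ?thesis using x(3) by blast
  next
    case False
    then have \<sigma>: "\<sigma> = transpose 1 2"
      using permutes_2[OF x(2)] by blast
    have "?t \<otimes>\<^bsub>W\<^esub> ?t = \<one>\<^bsub>W\<^esub>"
      unfolding t_el el_mult_diag el_one by (intro wr_eqI) (simp add: cong_def)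
    then have "el x \<sigma> \<otimes>\<^bsub>W\<^esub> el x \<sigma> = \<one>\<^bsub>W\<^esub>"
      using phi_mult[OF G(1,1)] x(1) hom_one[OF phi_hom G.is_group G.is_group] by simp
    then have "\<forall>i\<in>{1..2}. [x (\<sigma> i) + x i = 0] (mod int 4)"
      unfolding el_mult[OF x(2) x(2)] el_one wr_eq_iff by (rule conjunct2)
    from bspec[OF this, of 1] have sum: "4 dvd x 2 + x 1"
      by (simp add: \<sigma> cong_0_iff)
    have tG: "good (\<lambda>i. 2 * unit 1 i)" "good (\<lambda>i. 2 * unit 1 i + 2)"
      by (simp_all add: atLeastAtMost_numerals)
    have eqI: "\<phi> ?t = el f (transpose 1 2)" if "[x 1 = f 1] (mod 4)" "[x 2 = f 2] (mod 4)" for f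
      unfolding x \<sigma> using that by (simp add: wr_eq_iff atLeastAtMost_numerals)
    have "x 1 mod 4 = 0 \<or> x 1 mod 4 = 1 \<or> x 1 mod 4 = 2 \<or> x 1 mod 4 = 3" by presburger
    then consider "[x 1 = 0] (mod 4)" | "[x 1 = 1] (mod 4)" | "[x 1 = 2] (mod 4)" | "[x 1 = 3] (mod 4)"
      by (auto simp: cong_def)
    then show ?thesis
    proof cases
      case 1
      then have "[x 2 = 0] (mod 4)" using sum by (simp add: cong_def) presburger
      then have "\<phi> ?t = ?s" using eqI[of "\<lambda>_. 0"] 1 by (simp add: gen_s_el)
      then have "\<phi> ?t = eta_pow 2 (eta'_pow 0 ?t)"
        using G by (simp add: pow eta_4_2_2)
      then show ?thesis unfolding t_el using tG by blast
    next
      case 2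
      then have "[x 2 = - 1] (mod 4)" using sum by (simp add: cong_def) presburger
      then have "\<phi> ?t = ?s'" using eqI[of "\<lambda>i. unit 1 i - unit 2 i"] 2 by (simp add: gen_s'_el)
      then have "\<phi> ?t = eta_pow 1 (eta'_pow 0 ?t)"
        using G by (simp add: pow eta_4_2_2)
      then show ?thesis unfolding t_el using tG by blast
    next
      case 3
      then have "[x 2 = 2] (mod 4)" using sum by (simp add: cong_def) presburger
      then have "\<phi> ?t = ?s \<otimes>\<^bsub>W\<^esub> ?z" using eqI[of "\<lambda>_. 2"] 3 t by (simp add: gen_s_el el_mult permutes_id)
      also have "\<dots> = eta_pow 2 (eta'_pow 0 (?t \<otimes>\<^bsub>W\<^esub> ?z))"
        using G closed by (simp add: pow eta_tz)
      finally show ?thesis unfolding t_el el_mult_diag using tG by blast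
    next
      case 4
      then have "[x 2 = 1] (mod 4)" using sum by (simp add: cong_def) presburger
      then have "\<phi> ?t = ?s' \<otimes>\<^bsub>W\<^esub> ?z" using eqI[of "\<lambda>i. unit 1 i - unit 2 i + 2"] 4 t by (simp add: gen_s'_el el_mult permutes_id)
      also have "\<dots> = eta_pow 1 (eta'_pow 0 (?t \<otimes>\<^bsub>W\<^esub> ?z))"
        using G closed by (simp add: pow eta_tz)
      finally show ?thesis unfolding t_el el_mult_diag using tG by blast
    qed
  qed
  then obtain f i where f: "good f" "\<phi> ?t = eta_pow i (eta'_pow 0 (el f id))" by blast
  show ?thesis
  proof (rule conclude_diag)
    fix \<psi> assume \<psi>: "\<psi> \<in> auto G" "\<And>g. g \<in> carrier G \<Longrightarrow> \<phi> g = eta_pow i (eta'_pow 0 (\<psi> g))"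
    interpret p: grpn_auto 4 2 2 \<psi>
      by unfold_locales (rule \<psi>(1))
    have "\<psi> ?t = el f id"
      using f G by (intro pull_back[OF \<psi>]) (simp_all add: permutes_id)
    then have t1: "snd (\<psi> ?t) = id" by simp
    \<comment> \<open>The vector \<open>(1, 1)\<close> is central, so its image commutes with
      \<open>t^2\<close>, which no element over the swap does. Hence this image is diagonal, and
      \<open>(1, 1) + 2 e_1\<close> is \<open>e_2 - e_1\<close> modulo 4.\<close>
    let ?c = "el (\<lambda>_. 1) id"
    have c: "?c \<in> carrier G" by (simp add: permutes_id)
    obtain h where h: "h \<in> carrier G" "\<psi> h = ?t"
      using p.phi_surj[OF G(1)] ..
    from h(1) obtain f' \<pi> where "h = el f' \<pi>" "\<pi> permutes {1..2}" by (rule G_cases)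
    then have "?c \<otimes>\<^bsub>W\<^esub> h = h \<otimes>\<^bsub>W\<^esub> ?c"
      by (simp add: el_mult permutes_id add.commute)
    then have comm: "\<psi> ?c \<otimes>\<^bsub>W\<^esub> ?t = ?t \<otimes>\<^bsub>W\<^esub> \<psi> ?c"
      using p.phi_mult[OF c h(1)] p.phi_mult[OF h(1) c] h(2) by simp
    obtain y \<tau> where y: "\<psi> ?c = el y \<tau>" "\<tau> permutes {1..2}"
      using p.phi_el[OF c] .
    have "\<tau> = id"
    proof (rule ccontr)
      assume "\<tau> \<noteq> id"
      then have "\<tau> = transpose 1 2" using permutes_2[OF y(2)] by blast
      then have "[y 1 + 2 = y 1] (mod 4)"
        using comm t unfolding y(1) t_el by (simp add: el_mult permutes_id wr_eq_iff atLeastAtMost_numerals)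
      then show False by (simp add: cong_iff_dvd_diff)
    qed
    then have "?c \<otimes>\<^bsub>W\<^esub> ?t \<in> {g \<in> carrier G. snd g = id \<and> snd (\<psi> g) = id}"
      using t1 y c G(1) t_el by (intro subgroup.m_closed[OF p.diag_subgroup]) simp_all
    also have "?c \<otimes>\<^bsub>W\<^esub> ?t = el (\<lambda>i. unit 2 i - unit 1 i) id"
      unfolding t_el el_mult_diag by (simp add: wr_eq_iff atLeastAtMost_numerals cong_def)
    finally have root: "snd (\<psi> (el (\<lambda>i. unit 2 i - unit 1 i) id)) = id" by simp
    show "grpn_diag_auto 4 2 2 \<psi>"
    proof (rule p.diag_autoI)
      show "snd (\<psi> (el (\<lambda>i. unit b i - unit 1 i) id)) = id" if "2 \<le> b" "b \<le> 2" for b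
      proof -
        have "b = 2" using that by simp
        then show ?thesis using root by simp
      qed
    qed (use t1 t_el in simp_all)
  qed simp_all
qed

text \<open>Elements over the swap are involutions, since both entries of their square are
  \<open>x 1 + x 2\<close>, a multiple of 4. The root \<open>e_1 - e_2\<close> has order 4, so its
  image stays diagonal.\<close>

lemma case_4_4_2:
  assumes "grpn_auto 4 2 4 \<phi>"
  shows "grpn_diag_auto 4 2 4 \<phi>"
proof -
  interpret grpn_auto 4 2 4 \<phi> by fact
  let ?u = "el (\<lambda>i. unit 1 i - unit 2 i) id"
  have G: "?u \<in> carrier G" by (simp add: permutes_id sum_subtractf)
  obtain x \<sigma> where x: "\<phi> ?u = el x \<sigma>" "\<sigma> permutes {1..2}" "good x"
    using phi_el[OF G] .
  have "\<sigma> = id"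
  proof (rule ccontr)
    assume "\<sigma> \<noteq> id"
    then have \<sigma>: "\<sigma> = transpose 1 2"
      using permutes_2[OF x(2)] by blast
    have "4 dvd x 1 + x 2"
      using x(3) by (simp add: atLeastAtMost_numerals)
    then have "el x \<sigma> \<otimes>\<^bsub>W\<^esub> el x \<sigma> = \<one>\<^bsub>W\<^esub>"
      unfolding el_mult[OF x(2) x(2)] unfolding el_one wr_eq_iff \<sigma>
      by (simp add: atLeastAtMost_numerals cong_0_iff add.commute)
    then have "\<phi> (?u \<otimes>\<^bsub>W\<^esub> ?u) = \<phi> \<one>\<^bsub>W\<^esub>"
      using phi_mult[OF G G] x(1) hom_one[OF phi_hom G.is_group G.is_group] by simp
    then have "?u \<otimes>\<^bsub>W\<^esub> ?u = \<one>\<^bsub>W\<^esub>"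
      by (rule phi_inj[rotated 2]) (use G.m_closed[OF G G] G.one_closed in simp_all)
    then show False
      by (simp add: el_mult_diag el_one wr_eq_iff atLeastAtMost_numerals cong_0_iff)
  qed
  then show ?thesis
    using x(1) by (intro diag_autoI_root[of 1 2]) simp_all
qed

text \<open>Modulo constant vectors the elements over even permutations form a plane over the field
  with three elements. The diagonal subgroup is one of its four lines; \<open>eta\<close>, the
  square of \<open>eta\<close>, and \<open>eta'\<close> carry it to the other three.\<close>

lemma case_3_3_3:
  assumes "grpn_auto 3 3 3 \<phi>"
  shows "has_form 3 3 3 \<phi>"
proof -
  interpret grpn_auto 3 3 3 \<phi> by fact
  interpret E: grpn_auto 3 3 3 "eta 3 3 3"
    by unfold_locales (rule eta_auto)
  interpret E': grpn_auto 3 3 3 "eta' 3 3 3"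
    by unfold_locales (rule eta'_auto)
  note pow = pow_apply[OF eta_auto] pow_apply[OF eta'_auto] one_AutoGroup
  let ?s1 = "gen_s 3 3 1" and ?s2 = "gen_s 3 3 2" and ?s1' = "gen_s' 3 3 1" and ?s2' = "gen_s' 3 3 2"
  let ?U = "\<lambda>b m. el (\<lambda>i. b * (unit 1 i - unit 2 i) + m) id"
  define \<rho> where "\<rho> = transpose 2 3 \<circ> transpose 1 (2 :: nat)"
  define \<rho>' where "\<rho>' = transpose 1 2 \<circ> transpose 2 (3 :: nat)"
  have t: "transpose 1 2 permutes {1..3::nat}" "transpose 2 3 permutes {1..3::nat}"
    by (intro permutes_swap_id; simp)+
  have \<rho>: "\<rho> permutes {1..3}" "\<rho>' permutes {1..3}" "\<rho> 1 = 3" "\<rho> 2 = 1" "\<rho> 3 = 2" "\<rho>' 1 = 2" "\<rho>' 2 = 3" "\<rho>' 3 = 1"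
    using t by (simp_all add: \<rho>_def \<rho>'_def permutes_compose)
  have \<rho>\<rho>': "\<rho> (\<rho>' i) = i" "\<rho>' (\<rho> i) = i" for i
    by (simp_all add: \<rho>_def \<rho>'_def)
  have gens_el: "?s1 = el (\<lambda>_. 0) (transpose 1 2)" "?s2 = el (\<lambda>_. 0) (transpose 2 3)"
    "?s1' = el (\<lambda>i. unit 1 i - unit 2 i) (transpose 1 2)" "?s2' = el (\<lambda>i. unit 2 i - unit 3 i) (transpose 2 3)"
    by (simp_all add: gen_s_el gen_s'_el)
  have G: "?s1 \<in> carrier G" "?s2 \<in> carrier G" "?s1' \<in> carrier G" "?s2' \<in> carrier G"
    using t by (simp_all add: gens_el sum_subtractf)
  have closed: "g \<otimes>\<^bsub>W\<^esub> h \<in> carrier G" if "g \<in> carrier G" "h \<in> carrier G" for g h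
    using G.m_closed[OF that] by simp
  have U: "?U b m \<in> carrier G" for b m
    by (simp add: permutes_id sum.distrib sum_subtractf flip: sum_distrib_left)
  have good_U: "good (\<lambda>i. b * (unit 1 i - unit 2 i) + m)" for b m
    by (simp add: sum.distrib sum_subtractf flip: sum_distrib_left)
  have w: "?s2 \<otimes>\<^bsub>W\<^esub> ?s1 = el (\<lambda>_. 0) \<rho>" "?s1 \<otimes>\<^bsub>W\<^esub> ?s2 = el (\<lambda>_. 0) \<rho>'"
    "?s1' \<otimes>\<^bsub>W\<^esub> ?s2 = el (\<lambda>i. unit 1 i - unit 3 i) \<rho>'" "?s1 \<otimes>\<^bsub>W\<^esub> ?s2' = el (\<lambda>i. unit 2 i - unit 3 i) \<rho>'"
    "?s2 \<otimes>\<^bsub>W\<^esub> ?s1' = el (\<lambda>i. unit 1 i - unit 2 i) \<rho>" "?s2' \<otimes>\<^bsub>W\<^esub> ?s1 = el (\<lambda>i. unit 1 i - unit 3 i) \<rho>"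
    unfolding \<rho>_def \<rho>'_def gens_el
    by (subst el_mult[OF t(2,1)] el_mult[OF t(1,2)]; intro wr_cong; simp add: transpose_def; fail)+
  have u: "?s1 \<otimes>\<^bsub>W\<^esub> ?s1' = ?U 1 0" "?s1' \<otimes>\<^bsub>W\<^esub> ?s1 = ?U (- 1) 0"
    unfolding gens_el el_mult[OF t(1,1)] transpose_comp_involutory by (intro wr_cong; simp add: transpose_def)+
  \<comment> \<open>The vector \<open>(1, 1, 1)\<close> is the commutator of
    \<open>e_1 - e_2\<close> and a three-cycle. The second and third words are the images of the
    first under \<open>eta\<close> and \<open>eta'\<close>, so both maps fix it.\<close>
  have c_word: "?U 0 1 = (?s1 \<otimes>\<^bsub>W\<^esub> ?s1') \<otimes>\<^bsub>W\<^esub> ((?s1 \<otimes>\<^bsub>W\<^esub> ?s2) \<otimes>\<^bsub>W\<^esub> ((?s1' \<otimes>\<^bsub>W\<^esub> ?s1) \<otimes>\<^bsub>W\<^esub> (?s2 \<otimes>\<^bsub>W\<^esub> ?s1)))"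
    "?U 0 1 = (?s2 \<otimes>\<^bsub>W\<^esub> ?s1) \<otimes>\<^bsub>W\<^esub> ((?s2 \<otimes>\<^bsub>W\<^esub> ?s1') \<otimes>\<^bsub>W\<^esub> ((?s1 \<otimes>\<^bsub>W\<^esub> ?s2) \<otimes>\<^bsub>W\<^esub> (?s1' \<otimes>\<^bsub>W\<^esub> ?s2)))"
    "?U 0 1 = (?s1 \<otimes>\<^bsub>W\<^esub> ?s2') \<otimes>\<^bsub>W\<^esub> ((?s1 \<otimes>\<^bsub>W\<^esub> ?s2) \<otimes>\<^bsub>W\<^esub> ((?s2' \<otimes>\<^bsub>W\<^esub> ?s1) \<otimes>\<^bsub>W\<^esub> (?s2 \<otimes>\<^bsub>W\<^esub> ?s1)))"
    unfolding w u
    by (simp_all add: el_mult \<rho>(1,2) permutes_id permutes_compose)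
      (simp_all add: wr_eq_iff fun_eq_iff \<rho>\<rho>' \<rho> atLeastAtMost_numerals cong_def)
  have "eta 3 3 3 ((?s1 \<otimes>\<^bsub>W\<^esub> ?s1') \<otimes>\<^bsub>W\<^esub> ((?s1 \<otimes>\<^bsub>W\<^esub> ?s2) \<otimes>\<^bsub>W\<^esub> ((?s1' \<otimes>\<^bsub>W\<^esub> ?s1) \<otimes>\<^bsub>W\<^esub> (?s2 \<otimes>\<^bsub>W\<^esub> ?s1))))
    = (?s2 \<otimes>\<^bsub>W\<^esub> ?s1) \<otimes>\<^bsub>W\<^esub> ((?s2 \<otimes>\<^bsub>W\<^esub> ?s1') \<otimes>\<^bsub>W\<^esub> ((?s1 \<otimes>\<^bsub>W\<^esub> ?s2) \<otimes>\<^bsub>W\<^esub> (?s1' \<otimes>\<^bsub>W\<^esub> ?s2)))"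
    using G by (simp only: E.phi_mult closed eta_3_3_3)
  then have "eta 3 3 3 (?U 0 1) = ?U 0 1"
    by (simp only: c_word(1,2)[symmetric])
  then have eta_c: "eta 3 3 3 (?U 0 (int m)) = ?U 0 (int m)" for m
    using E.phi_const[of m] by simp
  have "eta' 3 3 3 ((?s1 \<otimes>\<^bsub>W\<^esub> ?s1') \<otimes>\<^bsub>W\<^esub> ((?s1 \<otimes>\<^bsub>W\<^esub> ?s2) \<otimes>\<^bsub>W\<^esub> ((?s1' \<otimes>\<^bsub>W\<^esub> ?s1) \<otimes>\<^bsub>W\<^esub> (?s2 \<otimes>\<^bsub>W\<^esub> ?s1))))
    = (?s1 \<otimes>\<^bsub>W\<^esub> ?s2') \<otimes>\<^bsub>W\<^esub> ((?s1 \<otimes>\<^bsub>W\<^esub> ?s2) \<otimes>\<^bsub>W\<^esub> ((?s2' \<otimes>\<^bsub>W\<^esub> ?s1) \<otimes>\<^bsub>W\<^esub> (?s2 \<otimes>\<^bsub>W\<^esub> ?s1)))"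
    using G by (simp only: E'.phi_mult closed eta'_3_3_3)
  then have "eta' 3 3 3 (?U 0 1) = ?U 0 1"
    by (simp only: c_word(1,3)[symmetric])
  then have eta'_c: "eta' 3 3 3 (?U 0 (int m)) = ?U 0 (int m)" for m
    using E'.phi_const[of m] by simp
  have U_split: "?U b m = ?U b 0 \<otimes>\<^bsub>W\<^esub> ?U 0 m" for b m
    by (simp add: el_mult_diag)
  have images:
    "eta 3 3 3 (?U 1 (int m)) = (?s2 \<otimes>\<^bsub>W\<^esub> ?s1) \<otimes>\<^bsub>W\<^esub> ?U 0 (int m)"
    "eta 3 3 3 (?U (- 1) (int m)) = (?s1 \<otimes>\<^bsub>W\<^esub> ?s2) \<otimes>\<^bsub>W\<^esub> ?U 0 (int m)"
    "eta 3 3 3 (eta 3 3 3 (?U 1 (int m))) = (?s1' \<otimes>\<^bsub>W\<^esub> ?s2) \<otimes>\<^bsub>W\<^esub> ?U 0 (int m)"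
    "eta 3 3 3 (eta 3 3 3 (?U (- 1) (int m))) = (?s2 \<otimes>\<^bsub>W\<^esub> ?s1') \<otimes>\<^bsub>W\<^esub> ?U 0 (int m)"
    "eta' 3 3 3 (?U 1 (int m)) = (?s1 \<otimes>\<^bsub>W\<^esub> ?s2') \<otimes>\<^bsub>W\<^esub> ?U 0 (int m)"
    "eta' 3 3 3 (?U (- 1) (int m)) = (?s2' \<otimes>\<^bsub>W\<^esub> ?s1) \<otimes>\<^bsub>W\<^esub> ?U 0 (int m)" for m
    unfolding U_split[of 1 "int m"] U_split[of "- 1" "int m"] u[symmetric] using G U
    by (simp_all only: E.phi_mult E'.phi_mult closed eta_3_3_3 eta'_3_3_3 eta_c eta'_c)
  have pow_U: "eta_pow 1 (eta'_pow 0 (?U b m)) = eta 3 3 3 (?U b m)"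
    "eta_pow 2 (eta'_pow 0 (?U b m)) = eta 3 3 3 (eta 3 3 3 (?U b m))"
    "eta_pow 0 (eta'_pow 1 (?U b m)) = eta' 3 3 3 (?U b m)" for b m
    by (simp_all only: pow_apply[OF eta_auto U] pow_apply[OF eta'_auto U] pow_apply[OF eta_auto E'.phi_closed[OF U]])
  obtain x \<sigma> where x: "\<phi> (?U 1 0) = el x \<sigma>" "\<sigma> permutes {1..3}" "good x"
    using phi_el[OF U] .
  have "\<exists>f i i'. good f \<and> \<phi> (?U 1 0) = eta_pow i (eta'_pow i' (el f id))"
  proof (cases "\<sigma> = id")
    case True
    have "\<phi> (?U 1 0) = eta_pow 0 (eta'_pow 0 (el x id))"
      using x True by (simp add: pow permutes_id)
    then show ?thesis using x(3) by blast
  next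
    case False
    \<comment> \<open>The root has order 3, hence \<open>\<sigma>\<close> is one of the two
      three-cycles.\<close>
    have "?U 1 0 \<otimes>\<^bsub>W\<^esub> ?U 1 0 \<otimes>\<^bsub>W\<^esub> ?U 1 0 = \<one>\<^bsub>W\<^esub>"
      unfolding el_mult_diag el_one by (intro wr_eqI) (simp add: cong_def)
    then have "el x \<sigma> \<otimes>\<^bsub>W\<^esub> el x \<sigma> \<otimes>\<^bsub>W\<^esub> el x \<sigma> = \<one>\<^bsub>W\<^esub>"
      using phi_mult[OF U U, of 1 0 1 0] phi_mult[OF closed[OF U U] U, of 1 0 1 0 1 0] x(1)
        hom_one[OF phi_hom G.is_group G.is_group] by simp
    then have cube: "\<sigma> (\<sigma> (\<sigma> i)) = i" for i
      unfolding el_mult[OF x(2) x(2)] el_mult[OF permutes_compose[OF x(2) x(2)] x(2)] unfolding el_one wr_eq_iff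
      by (metis comp_apply id_apply)
    have range: "\<sigma> i = 1 \<or> \<sigma> i = 2 \<or> \<sigma> i = 3" if "i \<in> {1..3}" for i
      using permutes_in_image[OF x(2), of i] that unfolding atLeastAtMost_numerals by auto
    have inj: "\<sigma> i = \<sigma> j \<longleftrightarrow> i = j" for i j
      using permutes_inj[OF x(2)] by (rule inj_eq)
    have "\<sigma> 1 \<noteq> 1"
    proof
      assume 1: "\<sigma> 1 = 1"
      have "\<sigma> 2 \<noteq> 2 \<or> \<sigma> 3 \<noteq> 3"
      proof (rule ccontr)
        assume "\<not> ?thesis"
        then have "\<sigma> i = i" for i
          using 1 permutes_not_in[OF x(2), of i] unfolding atLeastAtMost_numerals by auto
        then show False using False by (simp add: fun_eq_iff)
      qed
      then have "\<sigma> 2 = 3" "\<sigma> 3 = 2"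
        using 1 range[of 2] range[of 3] inj[of 2 1] inj[of 3 1] inj[of 2 3] by auto
      then show False using cube[of 2] by simp
    qed
    have "\<sigma> 1 = 2 \<or> \<sigma> 1 = 3"
      using range[of 1] \<open>\<sigma> 1 \<noteq> 1\<close> by simp
    then have \<sigma>: "\<sigma> = \<rho>' \<or> \<sigma> = \<rho>"
    proof
      assume 2: "\<sigma> 1 = 2"
      have "\<sigma> 2 \<noteq> 1" using cube[of 1] 2 by auto
      then have 3: "\<sigma> 2 = 3" using range[of 2] inj[of 2 1] 2 by auto
      then have "\<sigma> 3 = 1" using cube[of 1] 2 by simp
      then have "\<sigma> = \<rho>'"
        using 2 3 \<rho> permutes_not_in[OF x(2)] permutes_not_in[OF \<rho>(2)]
        by (intro ext, rename_tac i, case_tac "i \<in> {1..3}") (auto simp: atLeastAtMost_numerals)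
      then show ?thesis ..
    next
      assume 2: "\<sigma> 1 = 3"
      have "\<sigma> 3 \<noteq> 1" using cube[of 1] 2 by auto
      then have 3: "\<sigma> 3 = 2" using range[of 3] inj[of 3 1] 2 by auto
      then have "\<sigma> 2 = 1" using cube[of 1] 2 by simp
      then have "\<sigma> = \<rho>"
        using 2 3 \<rho> permutes_not_in[OF x(2)] permutes_not_in[OF \<rho>(1)]
        by (intro ext, rename_tac i, case_tac "i \<in> {1..3}") (auto simp: atLeastAtMost_numerals)
      then show ?thesis ..
    qed
    have sum: "3 dvd x 1 + x 2 + x 3"
      using x(3) by (simp add: atLeastAtMost_numerals add.assoc)
    define b where "b = x 1 - x 3"
    \<comment> \<open>Vectors with the same coordinate differences differ by a constant vector,
      which both automorphisms fix.\<close>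
    have *: "\<exists>m. el x \<sigma> = el f \<sigma> \<otimes>\<^bsub>W\<^esub> ?U 0 (int m)" if "[x 1 - x 3 = f 1 - f 3] (mod 3)" "[x 2 - x 3 = f 2 - f 3] (mod 3)" for f
    proof -
      define m where "m = nat ((x 3 - f 3) mod 3)"
      have 3: "[x 3 = f 3 + int m] (mod 3)"
        by (simp add: m_def cong_def mod_simps)
      have "el x \<sigma> = el (\<lambda>i. f i + int m) \<sigma>"
      proof (rule el_eqI[OF x(2) x(2)])
        have 1: "[x 1 = f 1 + int m] (mod 3)"
          by (rule cong_lin2[OF that(1) 3, of _ _ 1 1]) simp
        have 2: "[x 2 = f 2 + int m] (mod 3)"
          by (rule cong_lin2[OF that(2) 3, of _ _ 1 1]) simp
        show "\<forall>i\<in>{1..3}. \<sigma> i = \<sigma> i \<and> [x i = f i + int m] (mod int 3)"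
          unfolding atLeastAtMost_numerals using 1 2 3 by simp
      qed
      also have "\<dots> = el f \<sigma> \<otimes>\<^bsub>W\<^esub> ?U 0 (int m)"
        using el_mult[OF x(2) permutes_id] by simp
      finally show ?thesis by blast
    qed
    define d where "d = x 2 - x 3"
    \<comment> \<open>The coordinate sum is \<open>b + d + 3 x_3\<close>, so \<open>b\<close> alone
      determines the vector up to constants: three classes over each three-cycle.\<close>
    have "[d = - b] (mod 3)"
      using sum unfolding b_def d_def cong_iff_dvd_diff by presburger
    then have d: "d mod 3 = (- (b mod 3)) mod 3"
      by (simp add: cong_def mod_minus_eq)
    have "b mod 3 = 0 \<or> b mod 3 = 1 \<or> b mod 3 = 2" by presburger
    then have "b mod 3 = 0 \<and> d mod 3 = 0 \<or> b mod 3 = 1 \<and> d mod 3 = - 1 mod 3 \<or> b mod 3 = 2 \<and> d mod 3 = 1"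
      using d by (elim disjE) simp_all
    then consider "[b = 0] (mod 3)" "[x 2 - x 3 = 0] (mod 3)" | "[b = 1] (mod 3)" "[x 2 - x 3 = - 1] (mod 3)"
      | "[b = 2] (mod 3)" "[x 2 - x 3 = 1] (mod 3)"
      by (auto simp: cong_def d_def)
    then have "\<exists>m e i i'. \<phi> (?U 1 0) = eta_pow i (eta'_pow i' (?U e (int m)))"
    proof cases
      case 1
      obtain m where "el x \<sigma> = el (\<lambda>_. 0) \<sigma> \<otimes>\<^bsub>W\<^esub> ?U 0 (int m)"
        using *[of "\<lambda>_. 0"] 1 by (auto simp: b_def)
      then have "el x \<sigma> = eta_pow 1 (eta'_pow 0 (?U (if \<sigma> = \<rho> then 1 else - 1) (int m)))"
        using \<sigma> by (cases "\<sigma> = \<rho>") (simp_all only: pow_U images(1,2) w if_True if_False simp_thms)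
      then show ?thesis unfolding x(1) by (intro exI)
    next
      case 2
      show ?thesis
      proof (cases "\<sigma> = \<rho>")
        case True
        obtain m where "el x \<sigma> = el (\<lambda>i. unit 1 i - unit 2 i) \<sigma> \<otimes>\<^bsub>W\<^esub> ?U 0 (int m)"
          using *[of "\<lambda>i. unit 1 i - unit 2 i"] 2 by (auto simp: b_def)
        then have "el x \<sigma> = eta_pow 2 (eta'_pow 0 (?U (- 1) (int m)))"
          using True by (simp only: pow_U images(4) w)
        then show ?thesis unfolding x(1) by (intro exI)
      next
        case False
        obtain m where "el x \<sigma> = el (\<lambda>i. unit 2 i - unit 3 i) \<sigma> \<otimes>\<^bsub>W\<^esub> ?U 0 (int m)"
          using *[of "\<lambda>i. unit 2 i - unit 3 i"] 2 by (auto simp: b_def cong_def)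
        then have "el x \<sigma> = eta_pow 0 (eta'_pow 1 (?U 1 (int m)))"
          using False \<sigma> by (simp only: pow_U images(5) w simp_thms)
        then show ?thesis unfolding x(1) by (intro exI)
      qed
    next
      case 3
      show ?thesis
      proof (cases "\<sigma> = \<rho>")
        case True
        obtain m where "el x \<sigma> = el (\<lambda>i. unit 1 i - unit 3 i) \<sigma> \<otimes>\<^bsub>W\<^esub> ?U 0 (int m)"
          using *[of "\<lambda>i. unit 1 i - unit 3 i"] 3 by (auto simp: b_def)
        then have "el x \<sigma> = eta_pow 0 (eta'_pow 1 (?U (- 1) (int m)))"
          using True by (simp only: pow_U images(6) w)
        then show ?thesis unfolding x(1) by (intro exI)
      next
        case False
        obtain m where "el x \<sigma> = el (\<lambda>i. unit 1 i - unit 3 i) \<sigma> \<otimes>\<^bsub>W\<^esub> ?U 0 (int m)"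
          using *[of "\<lambda>i. unit 1 i - unit 3 i"] 3 by (auto simp: b_def)
        then have "el x \<sigma> = eta_pow 2 (eta'_pow 0 (?U 1 (int m)))"
          using False \<sigma> by (simp only: pow_U images(3) w simp_thms)
        then show ?thesis unfolding x(1) by (intro exI)
      qed
    qed
    then show ?thesis using good_U by blast
  qed
  then obtain f i i' where f: "good f" "\<phi> (?U 1 0) = eta_pow i (eta'_pow i' (el f id))" by blast
  have f': "\<phi> (el (\<lambda>i. unit 1 i - unit 2 i) id) = eta_pow i (eta'_pow i' (el f id))"
    using f(2) by simp
  show ?thesis
    by (rule conclude_root[OF _ _ _ _ _ _ f(1) f']) simp_all
qed

text \<open>A nontrivial \<open>\<sigma>\<close> is a fixed point free involution, and replacing the
  root by a permuted one turns it into \<open>(1 2)(3 4)\<close>. Commutation with a further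
  conjugate leaves, up to constants, the vectors \<open>0\<close> and \<open>e_1 - e_2\<close>,
  reached by the square of \<open>eta\<close> and by \<open>eta\<close>.\<close>

lemma case_2_2_4:
  assumes "grpn_auto 2 4 2 \<phi>"
  shows "has_form 2 2 4 \<phi>"
proof -
  interpret grpn_auto 2 4 2 \<phi> by fact
  interpret E: grpn_auto 2 4 2 "eta 2 2 4"
    by unfold_locales (rule eta_auto)
  note pow = pow_apply[OF eta_auto] pow_apply[OF eta'_auto] one_AutoGroup
  let ?s1 = "gen_s 2 4 1" and ?s2 = "gen_s 2 4 2" and ?s3 = "gen_s 2 4 3" and ?s1' = "gen_s' 2 4 1"
  let ?U = "\<lambda>b m. el (\<lambda>i. b * (unit 1 i - unit 2 i) + m) id"
  define \<rho> where "\<rho> = transpose 1 2 \<circ> transpose 3 (4 :: nat)"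
  have t: "transpose 1 2 permutes {1..4::nat}" "transpose 2 3 permutes {1..4::nat}" "transpose 3 4 permutes {1..4::nat}"
    by (intro permutes_swap_id; simp)+
  have \<rho>: "\<rho> permutes {1..4}" "\<rho> 1 = 2" "\<rho> 2 = 1" "\<rho> 3 = 4" "\<rho> 4 = 3"
    using t by (simp_all add: \<rho>_def permutes_compose)
  have gens_el: "?s1 = el (\<lambda>_. 0) (transpose 1 2)" "?s2 = el (\<lambda>_. 0) (transpose 2 3)" "?s3 = el (\<lambda>_. 0) (transpose 3 4)"
    "?s1' = el (\<lambda>i. unit 1 i - unit 2 i) (transpose 1 2)"
    by (simp_all add: gen_s_el gen_s'_el)
  have G: "?s1 \<in> carrier G" "?s2 \<in> carrier G" "?s3 \<in> carrier G" "?s1' \<in> carrier G"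
    using t by (simp_all add: gens_el sum_subtractf)
  have closed: "g \<otimes>\<^bsub>W\<^esub> h \<in> carrier G" if "g \<in> carrier G" "h \<in> carrier G" for g h
    using G.m_closed[OF that] by simp
  have good_U: "good (\<lambda>i. b * (unit 1 i - unit 2 i) + m)" for b m
    by (simp add: sum.distrib sum_subtractf flip: sum_distrib_left)
  have U: "?U b m \<in> carrier G" for b m
    using good_U by (simp add: permutes_id)
  have u: "?s1 \<otimes>\<^bsub>W\<^esub> ?s1' = ?U 1 0"
    unfolding gens_el el_mult[OF t(1,1)] transpose_comp_involutory by (intro wr_cong) (simp add: transpose_def)
  have w: "?s3 \<otimes>\<^bsub>W\<^esub> ?s1 = el (\<lambda>_. 0) \<rho>"
    unfolding gens_el el_mult[OF t(3,1)]
    by (intro el_eqI permutes_compose t \<rho>(1)) (simp add: \<rho> atLeastAtMost_numerals)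
  have w': "?s1' \<otimes>\<^bsub>W\<^esub> ?s3 = el (\<lambda>i. unit 1 i - unit 2 i) \<rho>"
    unfolding gens_el el_mult[OF t(1,3)]
    by (intro el_eqI permutes_compose t \<rho>(1)) (simp add: \<rho> atLeastAtMost_numerals)
  let ?h = "?s2 \<otimes>\<^bsub>W\<^esub> (?s1 \<otimes>\<^bsub>W\<^esub> (?s3 \<otimes>\<^bsub>W\<^esub> ?s2))"
  let ?h' = "?s2 \<otimes>\<^bsub>W\<^esub> (?s1' \<otimes>\<^bsub>W\<^esub> (?s1 \<otimes>\<^bsub>W\<^esub> ?s2))"
  define \<kappa> where "\<kappa> = transpose 1 3 \<circ> transpose 2 (4 :: nat)"
  have \<kappa>: "\<kappa> permutes {1..4}" "\<kappa> 1 = 3" "\<kappa> 2 = 4" "\<kappa> 3 = 1" "\<kappa> 4 = 2"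
    unfolding \<kappa>_def by (auto intro!: permutes_compose permutes_swap_id)
  have \<rho>\<rho>: "\<rho> (\<rho> i) = i" "\<kappa> (\<kappa> i) = i" for i
    by (auto simp: \<rho>_def \<kappa>_def transpose_def)
  have h: "?h = el (\<lambda>_. 0) \<kappa>"
    unfolding gens_el by (simp add: el_mult t permutes_compose, intro el_eqI permutes_compose t \<kappa>(1))
      (simp add: \<kappa> atLeastAtMost_numerals)
  have h': "?h' = el (\<lambda>i. unit 1 i - unit 3 i) id"
    unfolding gens_el by (simp add: el_mult t permutes_compose, intro el_eqI permutes_compose t permutes_id)
      (simp add: atLeastAtMost_numerals cong_def)
  \<comment> \<open>Modulo 2 the constant vector is \<open>e_1 - e_2\<close> plus its copy on the
    coordinates 3 and 4; \<open>eta\<close> takes the first word to the second.\<close>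
  have c_word: "?U 0 1 = (?s1 \<otimes>\<^bsub>W\<^esub> ?s1') \<otimes>\<^bsub>W\<^esub> (?h \<otimes>\<^bsub>W\<^esub> ((?s1 \<otimes>\<^bsub>W\<^esub> ?s1') \<otimes>\<^bsub>W\<^esub> ?h))"
    "?U 0 1 = (?s1' \<otimes>\<^bsub>W\<^esub> ?s3) \<otimes>\<^bsub>W\<^esub> (?h' \<otimes>\<^bsub>W\<^esub> ((?s1' \<otimes>\<^bsub>W\<^esub> ?s3) \<otimes>\<^bsub>W\<^esub> ?h'))"
    unfolding h h' w' u
    by (simp_all add: el_mult \<rho>(1) \<kappa>(1) permutes_id permutes_compose)
      (simp_all add: wr_eq_iff fun_eq_iff \<rho>\<rho> \<rho> \<kappa> atLeastAtMost_numerals cong_def)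
  have "eta 2 2 4 ((?s1 \<otimes>\<^bsub>W\<^esub> ?s1') \<otimes>\<^bsub>W\<^esub> (?h \<otimes>\<^bsub>W\<^esub> ((?s1 \<otimes>\<^bsub>W\<^esub> ?s1') \<otimes>\<^bsub>W\<^esub> ?h)))
    = (?s1' \<otimes>\<^bsub>W\<^esub> ?s3) \<otimes>\<^bsub>W\<^esub> (?h' \<otimes>\<^bsub>W\<^esub> ((?s1' \<otimes>\<^bsub>W\<^esub> ?s3) \<otimes>\<^bsub>W\<^esub> ?h'))"
    using G by (simp only: E.phi_mult closed eta_2_2_4)
  then have "eta 2 2 4 (?U 0 1) = ?U 0 1"
    by (simp only: c_word[symmetric])
  then have eta_c: "eta 2 2 4 (?U 0 (int m)) = ?U 0 (int m)" for m
    using E.phi_const[of m] by simp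
  have U_split: "?U b m = ?U b 0 \<otimes>\<^bsub>W\<^esub> ?U 0 m" for b m
    by (simp add: el_mult_diag)
  have images:
    "eta 2 2 4 (?U 1 (int m)) = (?s1' \<otimes>\<^bsub>W\<^esub> ?s3) \<otimes>\<^bsub>W\<^esub> ?U 0 (int m)"
    "eta 2 2 4 (eta 2 2 4 (?U 1 (int m))) = (?s3 \<otimes>\<^bsub>W\<^esub> ?s1) \<otimes>\<^bsub>W\<^esub> ?U 0 (int m)" for m
    unfolding U_split[of 1 "int m"] u[symmetric] using G U
    by (simp_all only: E.phi_mult closed eta_2_2_4 eta_c)
  have pow_U: "eta_pow 1 (eta'_pow 0 (?U b m)) = eta 2 2 4 (?U b m)"
    "eta_pow 2 (eta'_pow 0 (?U b m)) = eta 2 2 4 (eta 2 2 4 (?U b m))" for b m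
    by (simp_all only: pow_apply[OF eta_auto U] pow_apply[OF eta'_auto U])
  show ?thesis
  proof (cases "snd (\<phi> (?U 1 0)) = id")
    case True
    obtain x \<sigma> where x: "\<phi> (?U 1 0) = el x \<sigma>" "\<sigma> permutes {1..4}" "good x"
      using phi_el[OF U] .
    then have eq: "\<phi> (el (\<lambda>i. unit 1 i - unit 2 i) id) = eta_pow 0 (eta'_pow 0 (el x id))"
      using True by (simp add: pow permutes_id)
    show ?thesis
      by (rule conclude_root[OF _ _ _ _ _ _ x(3) eq]) simp_all
  next
    case False
    obtain x \<sigma> where x: "\<phi> (?U 1 0) = el x \<sigma>" "\<sigma> permutes {1..4}" "good x"
      using phi_el[OF U] .
    then have \<sigma>: "\<sigma> \<noteq> id" using False by auto
    have inj: "\<sigma> i = \<sigma> j \<longleftrightarrow> i = j" for i j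
      using permutes_inj[OF x(2)] by (rule inj_eq)
    have "?U 1 0 \<otimes>\<^bsub>W\<^esub> ?U 1 0 = \<one>\<^bsub>W\<^esub>"
      unfolding el_mult_diag el_one by (intro wr_eqI) (simp add: cong_def)
    then have "el x \<sigma> \<otimes>\<^bsub>W\<^esub> el x \<sigma> = \<one>\<^bsub>W\<^esub>"
      using phi_mult[OF U U, of 1 0 1 0] x(1) hom_one[OF phi_hom G.is_group G.is_group] by simp
    then have square: "\<sigma> (\<sigma> i) = i" for i
      unfolding el_mult[OF x(2) x(2)] unfolding el_one wr_eq_iff by (metis comp_apply id_apply)
    obtain b where b: "\<sigma> b \<noteq> b" using \<sigma> by (auto simp: fun_eq_iff)
    then have bA: "b \<in> {1..4}" using permutes_not_in[OF x(2)] by metis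
    \<comment> \<open>If \<open>\<sigma>\<close> fixed \<open>a\<close> and moved \<open>b\<close>,
      then \<open>e_a - e_b\<close> would change by 0 at \<open>a\<close> and by 1 at
      \<open>b\<close>.\<close>
    have fpf: "\<sigma> a \<noteq> a" if a: "a \<in> {1..4}" for a
    proof
      assume fix_a: "\<sigma> a = a"
      have "good (\<lambda>i. unit a i - unit b i)"
        using a bA by (simp add: sum_subtractf)
      from commutator_constant[OF good_U x(1) \<sigma> this a bA] have "[0 = (1::int)] (mod int 2)"
        using fix_a b inj[of b a] by (auto split: if_splits)
      then show False by (simp add: cong_def)
    qed
    have A: "1 \<in> {1..4::nat}" "\<sigma> 1 \<in> {1..4}" "1 \<noteq> \<sigma> 1"
      using permutes_in_image[OF x(2), of 1] fpf[of 1] by auto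
    obtain \<pi> where \<pi>: "\<pi> permutes {1..4}" "\<pi> 1 = 1" "\<pi> (\<sigma> 1) = 2"
      using permutes_two_points[OF A, of 1 2] by auto
    define \<sigma>' where "\<sigma>' = \<pi> \<circ> \<sigma> \<circ> inv' \<pi>"
    define x' where "x' i = x (inv' \<pi> i)" for i
    obtain \<mu> where \<mu>: "\<mu> permutes {1..4}"
      "\<phi> (el (\<lambda>i. 1 * (unit 1 (\<mu> i) - unit 2 (\<mu> i)) + 0) id) = el x' \<sigma>'"
      using conj_perm_image[OF good_U x(1) \<pi>(1)] unfolding \<sigma>'_def x'_def .
    have pinv: "inv' \<pi> (\<pi> i) = i" "\<pi> (inv' \<pi> i) = i" for i
      using permutes_inverses[OF \<pi>(1)] by auto
    have \<sigma>'p: "\<sigma>' permutes {1..4}"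
      unfolding \<sigma>'_def using \<pi>(1) x(2) by (intro permutes_compose permutes_inv)
    have \<sigma>'_square: "\<sigma>' (\<sigma>' i) = i" for i
      by (simp add: \<sigma>'_def pinv square)
    have \<sigma>'_fpf: "\<sigma>' i \<noteq> i" if "i \<in> {1..4}" for i
    proof
      assume "\<sigma>' i = i"
      then have "\<sigma> (inv' \<pi> i) = inv' \<pi> i"
        using pinv(1)[of "\<sigma> (inv' \<pi> i)"] by (simp add: \<sigma>'_def)
      then show False
        using fpf permutes_in_image[OF permutes_inv[OF \<pi>(1)]] that by blast
    qed
    have 1: "\<sigma>' 1 = 2"
      using pinv(1)[of 1] \<pi> by (simp add: \<sigma>'_def)
    then have 2: "\<sigma>' 2 = 1" using \<sigma>'_square[of 1] by simp
    have inj': "\<sigma>' i = \<sigma>' j \<longleftrightarrow> i = j" for i j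
      using permutes_inj[OF \<sigma>'p] by (rule inj_eq)
    have "\<sigma>' 3 \<in> {1, 2, 3, 4}"
      using permutes_in_image[OF \<sigma>'p, of 3] unfolding atLeastAtMost_numerals by simp
    then have 3: "\<sigma>' 3 = 4"
      using \<sigma>'_fpf[of 3] inj'[of 3 2] inj'[of 3 1] 1 2 by auto
    then have 4: "\<sigma>' 4 = 3" using \<sigma>'_square[of 3] by simp
    have \<sigma>'_eq: "\<sigma>' = \<rho>"
      using 1 2 3 4 \<rho> permutes_not_in[OF \<sigma>'p] permutes_not_in[OF \<rho>(1)]
      by (intro ext, rename_tac i, case_tac "i \<in> {1..4}") (auto simp: atLeastAtMost_numerals)
    have good_\<mu>: "good (\<lambda>i. 1 * (unit 1 (\<mu> i) - unit 2 (\<mu> i)) + 0)"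
      using sum_perm[OF \<mu>(1), of "\<lambda>i. 1 * (unit 1 i - unit 2 i) + 0"] good_U[of 1 0] by simp
    have "(\<Sum>i = 1..4. x' i) = (\<Sum>i = 1..4. x i)"
      unfolding x'_def by (rule sum_perm[OF permutes_inv[OF \<pi>(1)]])
    then have sum: "even (x' 1 + x' 2 + x' 3 + x' 4)"
      using x(3) by (simp add: atLeastAtMost_numerals add.assoc)
    define \<rho>2 where "\<rho>2 = transpose 2 3 \<circ> \<rho> \<circ> transpose 2 (3 :: nat)"
    have \<rho>2: "\<rho>2 permutes {1..4}" "\<rho>2 1 = 3"
      using t(2) \<rho> by (simp_all add: \<rho>2_def permutes_compose)
    have \<rho>12: "transpose 1 2 \<circ> \<rho> \<circ> transpose 1 2 = \<rho>"
    proof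
      fix i show "(transpose 1 2 \<circ> \<rho> \<circ> transpose 1 2) i = \<rho> i"
        unfolding \<rho>_def comp_apply by (cases "i = 1"; cases "i = 2"; cases "i = 3"; cases "i = 4") simp_all
    qed
    \<comment> \<open>Conjugates by \<open>(1 2)\<close> and \<open>(2 3)\<close>, the first again
      over \<open>\<rho>\<close>. Comparing their two products at coordinate 1 gives
      \<open>x' 1\<close> and \<open>x' 2\<close> the same parity.\<close>
    have "el (\<lambda>i. x' (transpose 1 2 i)) \<rho> \<otimes>\<^bsub>W\<^esub> el (\<lambda>i. x' (transpose 2 3 i)) \<rho>2
      = el (\<lambda>i. x' (transpose 2 3 i)) \<rho>2 \<otimes>\<^bsub>W\<^esub> el (\<lambda>i. x' (transpose 1 2 i)) \<rho>"
      using conj_perm_commute[OF good_\<mu> \<mu>(2) t(1,2)] unfolding inv_transpose_eq \<sigma>'_eq \<rho>12 \<rho>2_def .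
    then have "\<forall>i\<in>{1..4}. [x' (transpose 1 2 (\<rho>2 i)) + x' (transpose 2 3 i)
      = x' (transpose 2 3 (\<rho> i)) + x' (transpose 1 2 i)] (mod int 2)"
      unfolding el_mult[OF \<rho>(1) \<rho>2(1)] el_mult[OF \<rho>2(1) \<rho>(1)] wr_eq_iff by (rule conjunct2)
    from bspec[OF this, of 1] have "[x' 3 + x' 1 = x' 3 + x' 2] (mod 2)"
      by (simp add: \<rho> \<rho>2)
    then have 12: "even (x' 1 - x' 2)"
      by (simp add: cong_iff_dvd_diff)
    then have 34: "even (x' 3 - x' 4)"
      using sum by auto
    have ab: "inv' \<mu> 1 \<in> {1..4}" "inv' \<mu> 2 \<in> {1..4}" "inv' \<mu> 1 \<noteq> inv' \<mu> 2"
      using permutes_in_image[OF permutes_inv[OF \<mu>(1)]] permutes_inj[OF permutes_inv[OF \<mu>(1)]]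
      by (auto simp: inj_eq)
    have "\<mu> i = k \<longleftrightarrow> i = inv' \<mu> k" for i k
      using permutes_inverses[OF \<mu>(1)] by metis
    then have "(\<lambda>i. 1 * (unit 1 (\<mu> i) - unit 2 (\<mu> i)) + 0) = (\<lambda>i. unit (inv' \<mu> 1) i - unit (inv' \<mu> 2) i)"
      by simp
    then have root: "\<phi> (el (\<lambda>i. unit (inv' \<mu> 1) i - unit (inv' \<mu> 2) i) id) = el x' \<rho>"
      using \<mu>(2) \<sigma>'_eq by simp
    define m where "m = nat (x' 3 mod 2)"
    have m: "even (x' 3 - int m)"
      by (simp add: m_def)
    have "el x' \<rho> = eta_pow (if even (x' 1 - x' 3) then 2 else 1) (eta'_pow 0 (?U 1 (int m)))"
    proof (cases "even (x' 1 - x' 3)")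
      case True
      have "el x' \<rho> = el (\<lambda>_. int m) \<rho>"
        by (rule el_eqI[OF \<rho>(1,1)]) (use True 12 34 m in \<open>auto simp: atLeastAtMost_numerals cong_iff_dvd_diff\<close>)
      also have "\<dots> = (?s3 \<otimes>\<^bsub>W\<^esub> ?s1) \<otimes>\<^bsub>W\<^esub> ?U 0 (int m)"
        unfolding w el_mult[OF \<rho>(1) permutes_id] by (simp only: comp_id) simp
      finally show ?thesis
        using True by (simp only: pow_U images(2) if_True)
    next
      case False
      have "el x' \<rho> = el (\<lambda>i. unit 1 i - unit 2 i + int m) \<rho>"
        by (rule el_eqI[OF \<rho>(1,1)]) (use False 12 34 m in \<open>auto simp: atLeastAtMost_numerals cong_iff_dvd_diff\<close>)
      also have "\<dots> = (?s1' \<otimes>\<^bsub>W\<^esub> ?s3) \<otimes>\<^bsub>W\<^esub> ?U 0 (int m)"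
        unfolding w' el_mult[OF \<rho>(1) permutes_id] by (simp only: comp_id) simp
      finally show ?thesis
        using False by (simp only: pow_U images(1) if_False)
    qed
    with root have eq: "\<phi> (el (\<lambda>i. unit (inv' \<mu> 1) i - unit (inv' \<mu> 2) i) id)
      = eta_pow (if even (x' 1 - x' 3) then 2 else 1) (eta'_pow 0 (?U 1 (int m)))"
      by (rule trans)
    show ?thesis
      by (rule conclude_root[OF _ _ _ ab good_U eq]) simp_all
  qed
qed

lemma (in grpn_auto) normal_form_has_form:
  assumes "\<exists>g\<in>carrier (Grpn r 1 n). \<exists>j k. \<exists>z\<in>Crpn r p n. \<phi> = compose (carrier G) (Ad r p n g) (alpha r p n j k z)"
  shows "has_form r p n \<phi>"
proof (rule conclude)
  fix \<psi> assume \<psi>: "\<psi> \<in> auto G" "\<And>g. g \<in> carrier G \<Longrightarrow> \<phi> g = eta_pow 0 (eta'_pow 0 (\<psi> g))"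
  interpret p: grpn_auto r n p \<psi>
    by unfold_locales (rule \<psi>(1))
  have "\<phi> = \<psi>"
  proof (rule extensionalityI[OF phi_ext p.phi_ext])
    fix g assume g: "g \<in> carrier G"
    show "\<phi> g = \<psi> g"
      unfolding \<psi>(2)[OF g] pow_apply(1)[OF eta'_auto p.phi_closed[OF g]]
      by (rule pow_apply(1)[OF eta_auto p.phi_closed[OF g]])
  qed
  then show "\<exists>g\<in>carrier (Grpn r 1 n). \<exists>j k. \<exists>z\<in>Crpn r p n. \<psi> = compose (carrier G) (Ad r p n g) (alpha r p n j k z)"
    using assms by simp
qed

text \<open>The image \<open>\<tau>\<close> of \<open>(1 2)\<close> is conjugate to
  \<open>(1 2)(3 4)(5 6)\<close>, which \<open>eta\<close> sends to \<open>(1 2)\<close>. So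
  \<open>eta\<close> after \<open>\<phi>\<close> sends \<open>(1 2)\<close> to a permutation with a
  fixed point and is inner. With exponent \<open>-1\<close> this works without knowing the inverse
  or the order of \<open>eta\<close>.\<close>

lemma case_1_1_6:
  assumes "grpn_auto 1 6 1 \<phi>"
    and fpf: "\<And>x. x \<in> {1..6} \<Longrightarrow> snd (\<phi> (wr 1 6 (\<lambda>_. 0) (transpose 1 2))) x \<noteq> x"
  shows "has_form 1 1 6 \<phi>"
proof -
  interpret grpn_auto 1 6 1 \<phi> by fact
  interpret E: grpn_auto 1 6 1 "eta 1 1 6"
    by unfold_locales (rule eta_auto)
  let ?e = "\<lambda>\<pi>. el (\<lambda>_. 0) \<pi>"
  have perm: "?e \<pi> \<in> carrier G" if "\<pi> permutes {1..6}" for \<pi>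
    using that by simp
  have t: "transpose 1 2 permutes {1..6::nat}"
    by (intro permutes_swap_id) auto
  define b where "b = triple_transpose 1 2 3 4 5 6"
  have b: "b permutes {1..6}" "b 1 = 2" "b 2 = 1" "b 3 = 4" "b 4 = 3" "b 5 = 6" "b 6 = 5"
    unfolding b_def by (auto intro!: permutes_compose permutes_swap_id)
  obtain x \<tau> where x: "\<phi> (?e (transpose 1 2)) = el x \<tau>" "\<tau> permutes {1..6}"
    using phi_el[OF perm[OF t]] .
  have \<tau>_eq: "\<phi> (?e (transpose 1 2)) = ?e \<tau>"
    using x S6_el_eq by simp
  have \<tau>_fpf: "\<tau> i \<noteq> i" if "i \<in> {1..6}" for i
    using fpf[OF that] x by simp
  have "?e (transpose 1 2) \<otimes>\<^bsub>W\<^esub> ?e (transpose 1 2) = \<one>\<^bsub>W\<^esub>"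
    by (simp only: el_mult[OF t t] transpose_comp_involutory el_one add_0)
  then have "?e \<tau> \<otimes>\<^bsub>W\<^esub> ?e \<tau> = \<one>\<^bsub>W\<^esub>"
    using phi_mult[OF perm[OF t] perm[OF t]] \<tau>_eq hom_one[OF phi_hom G.is_group G.is_group] by simp
  then have "\<tau> \<circ> \<tau> = id"
    unfolding el_mult[OF x(2) x(2)] el_one wr_eq_iff by (rule conjunct1)
  then have \<tau>\<tau>: "\<tau> (\<tau> i) = i" for i
    by (simp add: fun_eq_iff)
  have inj: "\<tau> i = \<tau> j \<longleftrightarrow> i = j" for i j
    using permutes_inj[OF x(2)] by (rule inj_eq)
  have inA: "\<tau> i \<in> {1..6}" if "i \<in> {1..6}" for i
    using permutes_in_image[OF x(2)] that by blast
  have "length [1, \<tau> 1] < 6" by simp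
  from ex_not_in_list[OF this] obtain c where c: "c \<in> {1..6}" "c \<noteq> 1" "c \<noteq> \<tau> 1" by auto
  have "length [1, \<tau> 1, c, \<tau> c] < 6" by simp
  from ex_not_in_list[OF this] obtain e where e: "e \<in> {1..6}" "e \<noteq> 1" "e \<noteq> \<tau> 1" "e \<noteq> c" "e \<noteq> \<tau> c" by auto
  \<comment> \<open>Relabels the points so that the two-cycles of \<open>\<tau>\<close> come from
    \<open>(1 2)\<close>, \<open>(3 4)\<close> and \<open>(5 6)\<close>.\<close>
  define \<gamma> where "\<gamma> i = (if i = 1 then 1 else if i = 2 then \<tau> 1 else if i = 3 then c else if i = 4 then \<tau> c
    else if i = 5 then e else if i = 6 then \<tau> e else i)" for i
  have in1: "(1 :: nat) \<in> {1..6}" by simp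
  have dist: "\<tau> 1 \<noteq> 1" "\<tau> c \<noteq> c" "\<tau> e \<noteq> e" "\<tau> c \<noteq> 1" "\<tau> c \<noteq> \<tau> 1" "\<tau> e \<noteq> 1" "\<tau> e \<noteq> \<tau> 1" "\<tau> e \<noteq> c" "\<tau> e \<noteq> \<tau> c"
    using \<tau>_fpf[OF in1] \<tau>_fpf[OF c(1)] \<tau>_fpf[OF e(1)] c e \<tau>\<tau>[of c] \<tau>\<tau>[of e] inj by auto
  have \<gamma>_val: "\<gamma> 1 = 1" "\<gamma> 2 = \<tau> 1" "\<gamma> 3 = c" "\<gamma> 4 = \<tau> c" "\<gamma> 5 = e" "\<gamma> 6 = \<tau> e"
    by (simp_all add: \<gamma>_def)
  have \<gamma>: "\<gamma> permutes {1..6}"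
  proof (rule inj_imp_permutes)
    show "inj_on \<gamma> {1..6}"
      unfolding atLeastAtMost_6 inj_on_def using dist c(2,3) e(2-5) by (simp add: \<gamma>_val)
    show "\<gamma> i \<in> {1..6}" if "i \<in> {1..6}" for i
      using inA[OF in1] inA[OF c(1)] inA[OF e(1)] c(1) e(1) that by (simp add: \<gamma>_def)
    show "\<gamma> i = i" if "i \<notin> {1..6}" for i
      using that by (auto simp: \<gamma>_def)
  qed simp
  have conj: "\<gamma> \<circ> b = \<tau> \<circ> \<gamma>"
  proof (rule fun_eq_on_6I)
    show "\<gamma> \<circ> b permutes {1..6}" "\<tau> \<circ> \<gamma> permutes {1..6}"
      using \<gamma> b(1) x(2) by (auto intro: permutes_compose)
  qed (simp_all add: b \<gamma>_val \<tau>\<tau>)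
  have "?e \<gamma> \<otimes>\<^bsub>W\<^esub> ?e b = ?e \<tau> \<otimes>\<^bsub>W\<^esub> ?e \<gamma>"
    using conj by (simp add: el_mult \<gamma> b(1) x(2))
  then have "eta 1 1 6 (?e \<gamma>) \<otimes>\<^bsub>W\<^esub> eta 1 1 6 (?e b) = eta 1 1 6 (?e \<tau>) \<otimes>\<^bsub>W\<^esub> eta 1 1 6 (?e \<gamma>)"
    using E.phi_mult[OF perm[OF \<gamma>] perm[OF b(1)]] E.phi_mult[OF perm[OF x(2)] perm[OF \<gamma>]] by simp
  moreover have "eta 1 1 6 (?e b) = ?e (transpose 1 2)"
  proof -
    have t6: "transpose 1 2 permutes {1..6::nat}" "transpose 3 4 permutes {1..6::nat}" "transpose 5 6 permutes {1..6::nat}"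
      "triple_transpose 1 2 3 4 5 6 permutes {1..6}" "triple_transpose 1 2 3 6 4 5 permutes {1..6}"
      "triple_transpose 1 2 3 5 4 6 permutes {1..6}"
      by (auto intro!: permutes_compose permutes_swap_id)
    have gens: "gen_s 1 6 1 = ?e (transpose 1 2)" "gen_s 1 6 3 = ?e (transpose 3 4)" "gen_s 1 6 5 = ?e (transpose 5 6)"
      by (simp_all add: gen_s_el)
    have "?e b = ?e (transpose 1 2) \<otimes>\<^bsub>W\<^esub> ?e (transpose 3 4) \<otimes>\<^bsub>W\<^esub> ?e (transpose 5 6)"
      unfolding b_def using t6 by (simp add: el_mult permutes_compose)
    then have "eta 1 1 6 (?e b) = eta 1 1 6 (gen_s 1 6 1) \<otimes>\<^bsub>W\<^esub> eta 1 1 6 (gen_s 1 6 3) \<otimes>\<^bsub>W\<^esub> eta 1 1 6 (gen_s 1 6 5)"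
      unfolding gens using t6(1-3) G.m_closed[OF perm[OF t6(1)] perm[OF t6(2)]]
      by (simp only: E.phi_mult perm G_mult)
    also have "\<dots> = ?e (triple_transpose 1 2 3 4 5 6 \<circ> triple_transpose 1 2 3 6 4 5 \<circ> triple_transpose 1 2 3 5 4 6)"
      unfolding eta_1_1_6 el_mult[OF t6(4,5)] el_mult[OF permutes_compose[OF t6(5,4)] t6(6)] add_0 ..
    finally show ?thesis
      by (simp only: triple_transpose_mult)
  qed
  ultimately have eq: "eta 1 1 6 (?e \<gamma>) \<otimes>\<^bsub>W\<^esub> ?e (transpose 1 2) = eta 1 1 6 (?e \<tau>) \<otimes>\<^bsub>W\<^esub> eta 1 1 6 (?e \<gamma>)"
    by simp
  obtain d \<delta> where d: "eta 1 1 6 (?e \<gamma>) = el d \<delta>" "\<delta> permutes {1..6}"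
    using E.phi_el[OF perm[OF \<gamma>]] .
  obtain y \<sigma> where y: "eta 1 1 6 (?e \<tau>) = el y \<sigma>" "\<sigma> permutes {1..6}"
    using E.phi_el[OF perm[OF x(2)]] .
  have "\<delta> \<circ> transpose 1 2 = \<sigma> \<circ> \<delta>"
    using eq unfolding d(1) y(1) el_mult[OF d(2) t] el_mult[OF y(2) d(2)] wr_eq_iff by (rule conjunct1)
  \<comment> \<open>The point 3 is fixed by \<open>(1 2)\<close>, so its image under
    \<open>\<delta>\<close> is fixed by the conjugate \<open>\<sigma>\<close>.\<close>
  from fun_cong[OF this, of 3] have fixed: "\<sigma> (\<delta> 3) = \<delta> 3"
    by simp
  show ?thesis
  proof (rule conclude)
    fix \<psi> assume \<psi>: "\<psi> \<in> auto G" "\<And>g. g \<in> carrier G \<Longrightarrow> \<phi> g = eta_pow (- 1) (eta'_pow 0 (\<psi> g))"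
    interpret p: grpn_auto 1 6 1 \<psi>
      by unfold_locales (rule \<psi>(1))
    interpret A: group "AutoGroup G" by (rule G.AutoGroup)
    interpret h: group_hom G G \<psi>
      using p.phi_hom by unfold_locales
    have eA: "eta 1 1 6 \<in> carrier (AutoGroup G)" using eta_auto by simp
    have "eta 1 1 6 \<otimes>\<^bsub>AutoGroup G\<^esub> eta_pow (- 1) = \<one>\<^bsub>AutoGroup G\<^esub>"
      using A.int_pow_neg[OF eA, of 1] A.int_pow_1[OF eA] A.r_inv[OF eA] by simp
    then have comp: "compose (carrier G) (eta 1 1 6) (eta_pow (- 1)) = (\<lambda>g\<in>carrier G. g)"
      by (simp only: mult_AutoGroup[OF eta_auto pow_auto[OF eta_auto]] one_AutoGroup)
    have inv: "eta 1 1 6 (eta_pow (- 1) g) = g" if "g \<in> carrier G" for g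
      using fun_cong[OF comp, of g] that by (simp add: compose_eq)
    have \<psi>_eq: "\<psi> g = eta 1 1 6 (\<phi> g)" if "g \<in> carrier G" for g
      unfolding \<psi>(2)[OF that] pow_apply(1)[OF eta'_auto p.phi_closed[OF that]]
      using inv[OF p.phi_closed[OF that]] by simp
    interpret D: grpn_diag_auto 1 6 1 \<psi>
    proof unfold_locales
      fix f :: "nat \<Rightarrow> int"
      have "el f id = \<one>\<^bsub>W\<^esub>"
        using S6_el_eq by (simp only: el_one)
      then show "snd (\<psi> (el f id)) = id"
        using h.hom_one by (simp add: el_one)
    qed
    have "D.\<beta> (transpose 1 2) (\<delta> 3) = \<delta> 3"
      unfolding D.\<beta>_def \<psi>_eq[OF perm[OF t]] \<tau>_eq y(1) snd_wr by (rule fixed)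
    moreover have "\<delta> 3 \<in> {1..6}"
      using permutes_in_image[OF d(2), of 3] by simp
    ultimately show "\<exists>g\<in>carrier (Grpn 1 1 6). \<exists>j k. \<exists>z\<in>Crpn 1 1 6. \<psi> = compose (carrier G) (Ad 1 1 6 g) (alpha 1 1 6 j k z)"
      by (intro D.normal_form exI[of _ 1] exI[of _ 2] exI[of _ "\<delta> 3"]) simp_all
  qed
qed

theorem theorem4p1:
  fixes r p n :: nat
    and \<phi> :: "(nat \<Rightarrow> int) \<times> (nat \<Rightarrow> nat) \<Rightarrow> (nat \<Rightarrow> int) \<times> (nat \<Rightarrow> nat)"
  assumes "r > 0" and "p > 0" and "n > 0" and "p dvd r"
    and "\<phi> \<in> auto (Grpn r p n)"
  shows "\<exists>g \<in> carrier (Grpn r 1 n). \<exists>(i1::int) (i2::int) (j::int) (k::int). \<exists>z \<in> Crpn r p n.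
    \<phi> = compose (carrier (Grpn r p n)) (eta r p n [^]\<^bsub>AutoGroup (Grpn r p n)\<^esub> i1)
          (compose (carrier (Grpn r p n)) (eta' r p n [^]\<^bsub>AutoGroup (Grpn r p n)\<^esub> i2)
            (compose (carrier (Grpn r p n)) (Ad r p n g) (alpha r p n j k z)))"
proof -
  interpret grpn_auto r n p \<phi>
    using assms by unfold_locales simp_all
  have diag: "has_form r p n \<phi>" if "grpn_diag_auto r n p \<phi>"
  proof -
    interpret D: grpn_diag_auto r n p \<phi> by fact
    let ?fixed = "\<exists>a b x. a \<in> {1..n} \<and> b \<in> {1..n} \<and> a \<noteq> b \<and> x \<in> {1..n} \<and> D.\<beta> (transpose a b) x = x"
    show ?thesis
    \<comment> \<open>Failure of this condition means that the induced automorphism of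
      \<open>S_6\<close> is exotic, which forces \<open>r = 1\<close>.\<close>
    proof (cases "n = 6 \<longrightarrow> ?fixed")
      case True
      then show ?thesis
        using assms(3) by (intro normal_form_has_form D.normal_form) simp_all
    next
      case False
      then have n: "n = 6" by simp
      then have r: "r = 1" using False D.not_fixed_point_free by blast
      then have p: "p = 1" using assms(4) by simp
      have "snd (\<phi> (el (\<lambda>_. 0) (transpose 1 2))) x \<noteq> x" if "x \<in> {1..n}" for x
      proof -
        have "1 \<in> {1..n}" "2 \<in> {1..n}" "1 \<noteq> (2 :: nat)" using n by simp_all
        then have "D.\<beta> (transpose 1 2) x \<noteq> x" using False that by blast
        then show ?thesis unfolding D.\<beta>_def .
      qed
      then have fpf: "snd (\<phi> (wr 1 6 (\<lambda>_. 0) (transpose 1 2))) x \<noteq> x" if "x \<in> {1..6}" for x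
        using that n r by simp
      have "grpn_auto 1 6 1 \<phi>"
        using grpn_auto_axioms n r p by simp
      then have "has_form 1 1 6 \<phi>" using fpf by (rule case_1_1_6)
      then show ?thesis using n r p by simp
    qed
  qed
  have "has_form r p n \<phi>"
  proof (cases "\<forall>u. good u \<longrightarrow> snd (\<phi> (el u id)) = id")
    case True
    then show ?thesis
      by (intro diag) (unfold_locales, blast)
  next
    case False
    then obtain u where u: "good u" "snd (\<phi> (el u id)) \<noteq> id" by blast
    then have G: "el u id \<in> carrier G" by (simp add: permutes_id)
    obtain x \<sigma> where x: "\<phi> (el u id) = el x \<sigma>" "\<sigma> permutes {1..n}" "good x"
      using phi_el[OF G] .
    have "\<sigma> \<noteq> id" using u(2) x(1) by simp
    from exceptional_cases[OF u(1) x(1) this]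
    consider "r = 2" "p = 1" "n = 2" | "r = 2" "p = 2" "n = 2" | "r = 4" "p = 2" "n = 2" | "r = 4" "p = 4" "n = 2"
      | "r = 3" "p = 3" "n = 3" | "r = 2" "p = 2" "n = 4" by auto
    then show ?thesis
    proof cases
      case 1
      with case_2_1_2 grpn_auto_axioms show ?thesis by simp
    next
      case 2
      with case_2_2_2 grpn_auto_axioms show ?thesis by simp
    next
      case 3
      with case_4_2_2 grpn_auto_axioms show ?thesis by simp
    next
      case 4
      with case_4_4_2 grpn_auto_axioms diag show ?thesis by simp
    next
      case 5
      with case_3_3_3 grpn_auto_axioms show ?thesis by simp
    next
      case 6
      with case_2_2_4 grpn_auto_axioms show ?thesis by simp
    qed
  qed
  then show ?thesis
    unfolding has_form_def .
qed

end
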